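(* Let $\mathcal{A}$ be a skeletally small abelian category and $\mathcal{F}$ a torsionfree class in $\mathcal{A}$. Put $\mathsf{M}_{\mathcal{F}}:=\{[F]\mid F\in\mathcal{F}\}\subseteq\mathsf{M}(\mathcal{A})$. Then the natural monoid homomorphism $\mathsf{M}(\mathcal{A})\to\mathsf{M}(\mathcal{F}[1]*\mathcal{A})$, $[A]\mapsto[A]$, induces an isomorphism of monoids $$\mathsf{M}(\mathcal{A})_{\mathsf{M}_{\mathcal{F}}}\cong\mathsf{M}(\mathcal{F}[1]*\mathcal{A}),$$ where the left-hand side is the localization of the monoid $\mathsf{M}(\mathcal{A})$ with respect to $\mathsf{M}_{\mathcal{F}}$.
   Context: Subcategories are full, closed under isomorphisms and additive. A torsionfree class in $\mathcal{A}$ is a subcategory closed under subobjects and extensions. $\mathsf{D}^{\mathrm b}(\mathcal{A})$ is the bounded derived category, and $\mathcal{A}$ is identified with the complexes having cohomology concentrated in degree $0$. $\mathcal{F}[1]*\mathcal{A}$ is the full subcategory of $\mathsf{D}^{\mathrm b}(\mathcal{A})$ of objects $X$ admitting a triangle $F[1]\to X\to A\to F[2]$ with $F\in\mathcal{F}$, $A\in\mathcal{A}$; it is closed under extensions, hence is an extriangulated category (Nakaoka--Palu) whose conflations $X\to Y\to Z\dashrightarrow$ are given by the triangles $X\to Y\to Z\to X[1]$ of $\mathsf{D}^{\mathrm b}(\mathcal{A})$ with $X,Y,Z\in\mathcal{F}[1]*\mathcal{A}$. In $\mathcal{A}$, conflations are short exact sequences. All monoids are commutative. For a skeletally small extriangulated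 category $\mathcal{C}$, the Grothendieck monoid $\mathsf{M}(\mathcal{C})$ is the monoid with a map $X\mapsto[X]$ from isomorphism classes of objects, universal among maps $f$ to monoids with $f[0]=0$ and $f[Y]=f[X]+f[Z]$ for every conflation $X\to Y\to Z\dashrightarrow$. For a subset $S$ of a monoid $M$, the localization $\rho\colon M\to M_S$ is the universal monoid homomorphism such that $\rho(s)$ is invertible for all $s\in S$. *)

theory Defs
  imports "HOL-Algebra.Group" "HOL-Library.Multiset"
begin

section \<open>Categories\<close>

text \<open>
  The objects of a category are elements of a HOL type, so every category here is small. The
  hom-sets of different pairs of objects may overlap; where the endpoints of a morphism matter,
  they are passed explicitly.
\<close>

record ('o, 'm) category =
  Ob :: "'o set"
  Mor :: "'o \<Rightarrow> 'o \<Rightarrow> 'm set"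
  idm :: "'o \<Rightarrow> 'm"
  cmp :: "'m \<Rightarrow> 'm \<Rightarrow> 'm" (infixl "\<cdot>\<index>" 70)

locale category =
  fixes C (structure)
  assumes Mor_Ob: "f \<in> Mor C X Y \<Longrightarrow> X \<in> Ob C \<and> Y \<in> Ob C"
    and idm_Mor: "X \<in> Ob C \<Longrightarrow> idm C X \<in> Mor C X X"
    and cmp_Mor: "f \<in> Mor C X Y \<Longrightarrow> g \<in> Mor C Y Z \<Longrightarrow> g \<cdot> f \<in> Mor C X Z"
    and idm_left: "f \<in> Mor C X Y \<Longrightarrow> idm C Y \<cdot> f = f"
    and idm_right: "f \<in> Mor C X Y \<Longrightarrow> f \<cdot> idm C X = f"
    and cmp_assoc: "f \<in> Mor C W X \<Longrightarrow> g \<in> Mor C X Y \<Longrightarrow> h \<in> Mor C Y Z \<Longrightarrow>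
      h \<cdot> (g \<cdot> f) = (h \<cdot> g) \<cdot> f"

definition is_isomorphism :: "('o, 'm, 'x) category_scheme \<Rightarrow> 'o \<Rightarrow> 'o \<Rightarrow> 'm \<Rightarrow> bool" where
  "is_isomorphism C X Y f \<longleftrightarrow> f \<in> Mor C X Y \<and>
     (\<exists>g \<in> Mor C Y X. g \<cdot>\<^bsub>C\<^esub> f = idm C X \<and> f \<cdot>\<^bsub>C\<^esub> g = idm C Y)"

definition isomorphic :: "('o, 'm, 'x) category_scheme \<Rightarrow> 'o \<Rightarrow> 'o \<Rightarrow> bool" where
  "isomorphic C X Y \<longleftrightarrow> (\<exists>f. is_isomorphism C X Y f)"

definition zero_object :: "('o, 'm, 'x) category_scheme \<Rightarrow> 'o \<Rightarrow> bool" where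
  "zero_object C Z \<longleftrightarrow> Z \<in> Ob C \<and>
     (\<forall>X \<in> Ob C. (\<exists>!f. f \<in> Mor C X Z) \<and> (\<exists>!f. f \<in> Mor C Z X))"

definition is_mono :: "('o, 'm, 'x) category_scheme \<Rightarrow> 'o \<Rightarrow> 'o \<Rightarrow> 'm \<Rightarrow> bool" where
  "is_mono C X Y f \<longleftrightarrow> f \<in> Mor C X Y \<and>
     (\<forall>W. \<forall>g \<in> Mor C W X. \<forall>h \<in> Mor C W X. f \<cdot>\<^bsub>C\<^esub> g = f \<cdot>\<^bsub>C\<^esub> h \<longrightarrow> g = h)"

definition is_epi :: "('o, 'm, 'x) category_scheme \<Rightarrow> 'o \<Rightarrow> 'o \<Rightarrow> 'm \<Rightarrow> bool" where
  "is_epi C X Y f \<longleftrightarrow> f \<in> Mor C X Y \<and>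
     (\<forall>W. \<forall>g \<in> Mor C Y W. \<forall>h \<in> Mor C Y W. g \<cdot>\<^bsub>C\<^esub> f = h \<cdot>\<^bsub>C\<^esub> f \<longrightarrow> g = h)"

definition is_functor ::
  "('o, 'm, 'x) category_scheme \<Rightarrow> ('p, 'n, 'y) category_scheme \<Rightarrow>
    ('o \<Rightarrow> 'p) \<Rightarrow> ('o \<Rightarrow> 'o \<Rightarrow> 'm \<Rightarrow> 'n) \<Rightarrow> bool" where
  "is_functor C E \<Phi> \<phi> \<longleftrightarrow>
     (\<forall>X \<in> Ob C. \<Phi> X \<in> Ob E \<and> \<phi> X X (idm C X) = idm E (\<Phi> X)) \<and>
     (\<forall>X Y. \<forall>f \<in> Mor C X Y. \<phi> X Y f \<in> Mor E (\<Phi> X) (\<Phi> Y)) \<and>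
     (\<forall>X Y Z. \<forall>f \<in> Mor C X Y. \<forall>g \<in> Mor C Y Z.
        \<phi> X Z (g \<cdot>\<^bsub>C\<^esub> f) = \<phi> Y Z g \<cdot>\<^bsub>E\<^esub> \<phi> X Y f)"

section \<open>Abelian categories\<close>

record ('o, 'm) preadditive = "('o, 'm) category" +
  madd :: "'m \<Rightarrow> 'm \<Rightarrow> 'm"
  mzero :: "'o \<Rightarrow> 'o \<Rightarrow> 'm"

definition hom_group :: "('o, 'm, 'x) preadditive_scheme \<Rightarrow> 'o \<Rightarrow> 'o \<Rightarrow> 'm monoid" where
  "hom_group A X Y = \<lparr>carrier = Mor A X Y, monoid.mult = madd A, one = mzero A X Y\<rparr>"

definition mneg :: "('o, 'm, 'x) preadditive_scheme \<Rightarrow> 'o \<Rightarrow> 'o \<Rightarrow> 'm \<Rightarrow> 'm" where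
  "mneg A X Y f = inv\<^bsub>hom_group A X Y\<^esub> f"

locale preadditive_category = category A for A (structure) +
  assumes hom_comm_group: "X \<in> Ob A \<Longrightarrow> Y \<in> Ob A \<Longrightarrow> comm_group (hom_group A X Y)"
    and cmp_add_left: "f \<in> Mor A X Y \<Longrightarrow> g \<in> Mor A Y Z \<Longrightarrow> h \<in> Mor A Y Z \<Longrightarrow>
      madd A g h \<cdot> f = madd A (g \<cdot> f) (h \<cdot> f)"
    and cmp_add_right: "f \<in> Mor A X Y \<Longrightarrow> g \<in> Mor A X Y \<Longrightarrow> h \<in> Mor A Y Z \<Longrightarrow>
      h \<cdot> madd A f g = madd A (h \<cdot> f) (h \<cdot> g)"

text \<open>\<open>k : K \<rightarrow> X\<close> is a kernel of \<open>f : X \<rightarrow> Y\<close>; dually for cokernels.\<close>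

definition is_kernel ::
  "('o, 'm, 'x) preadditive_scheme \<Rightarrow> 'o \<Rightarrow> 'o \<Rightarrow> 'm \<Rightarrow> 'o \<Rightarrow> 'm \<Rightarrow> bool" where
  "is_kernel A X Y f K k \<longleftrightarrow> f \<in> Mor A X Y \<and> k \<in> Mor A K X \<and> f \<cdot>\<^bsub>A\<^esub> k = mzero A K Y \<and>
     (\<forall>W. \<forall>h \<in> Mor A W X. f \<cdot>\<^bsub>A\<^esub> h = mzero A W Y \<longrightarrow>
        (\<exists>!u. u \<in> Mor A W K \<and> k \<cdot>\<^bsub>A\<^esub> u = h))"

definition is_cokernel ::
  "('o, 'm, 'x) preadditive_scheme \<Rightarrow> 'o \<Rightarrow> 'o \<Rightarrow> 'm \<Rightarrow> 'o \<Rightarrow> 'm \<Rightarrow> bool" where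
  "is_cokernel A X Y f Q q \<longleftrightarrow> f \<in> Mor A X Y \<and> q \<in> Mor A Y Q \<and> q \<cdot>\<^bsub>A\<^esub> f = mzero A X Q \<and>
     (\<forall>W. \<forall>h \<in> Mor A Y W. h \<cdot>\<^bsub>A\<^esub> f = mzero A X W \<longrightarrow>
        (\<exists>!u. u \<in> Mor A Q W \<and> u \<cdot>\<^bsub>A\<^esub> q = h))"

text \<open>\<open>S\<close> is a biproduct of \<open>X\<close> and \<open>Y\<close> with injections \<open>i, j\<close> and projections \<open>p, q\<close>.\<close>

definition is_biproduct ::
  "('o, 'm, 'x) preadditive_scheme \<Rightarrow> 'o \<Rightarrow> 'o \<Rightarrow> 'o \<Rightarrow> 'm \<Rightarrow> 'm \<Rightarrow> 'm \<Rightarrow> 'm \<Rightarrow> bool" where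
  "is_biproduct A X Y S i j p q \<longleftrightarrow>
     i \<in> Mor A X S \<and> j \<in> Mor A Y S \<and> p \<in> Mor A S X \<and> q \<in> Mor A S Y \<and>
     p \<cdot>\<^bsub>A\<^esub> i = idm A X \<and> q \<cdot>\<^bsub>A\<^esub> j = idm A Y \<and>
     q \<cdot>\<^bsub>A\<^esub> i = mzero A X Y \<and> p \<cdot>\<^bsub>A\<^esub> j = mzero A Y X \<and>
     madd A (i \<cdot>\<^bsub>A\<^esub> p) (j \<cdot>\<^bsub>A\<^esub> q) = idm A S"

locale abelian_category = preadditive_category +
  assumes ex_zero_object: "\<exists>Z. zero_object A Z"
    and ex_biproduct: "X \<in> Ob A \<Longrightarrow> Y \<in> Ob A \<Longrightarrow> \<exists>S i j p q. is_biproduct A X Y S i j p q"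
    and ex_kernel: "f \<in> Mor A X Y \<Longrightarrow> \<exists>K k. is_kernel A X Y f K k"
    and ex_cokernel: "f \<in> Mor A X Y \<Longrightarrow> \<exists>Q q. is_cokernel A X Y f Q q"
    and mono_is_kernel: "is_mono A X Y f \<Longrightarrow> \<exists>Z g. is_kernel A Y Z g X f"
    and epi_is_cokernel: "is_epi A X Y f \<Longrightarrow> \<exists>W g. is_cokernel A W X g Y f"

definition short_exact ::
  "('o, 'm, 'x) preadditive_scheme \<Rightarrow> 'o \<Rightarrow> 'o \<Rightarrow> 'o \<Rightarrow> 'm \<Rightarrow> 'm \<Rightarrow> bool" where
  "short_exact A X Y Z f g \<longleftrightarrow> is_kernel A Y Z g X f \<and> is_cokernel A X Y f Z g"

text \<open>
  Full subcategories are given by their sets of objects. The first three conditions say that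
  \<open>F\<close> is an additive subcategory closed under isomorphisms.
\<close>

definition torsionfree_class :: "('o, 'm, 'x) preadditive_scheme \<Rightarrow> 'o set \<Rightarrow> bool" where
  "torsionfree_class A F \<longleftrightarrow> F \<subseteq> Ob A \<and>
     (\<forall>X \<in> F. \<forall>Y. isomorphic A X Y \<longrightarrow> Y \<in> F) \<and>
     (\<forall>Z. zero_object A Z \<longrightarrow> Z \<in> F) \<and>
     (\<forall>X \<in> F. \<forall>Y \<in> F. \<forall>S i j p q. is_biproduct A X Y S i j p q \<longrightarrow> S \<in> F) \<and>
     (\<forall>X Y f. is_mono A X Y f \<and> Y \<in> F \<longrightarrow> X \<in> F) \<and>
     (\<forall>X Y Z f g. short_exact A X Y Z f g \<and> X \<in> F \<and> Z \<in> F \<longrightarrow> Y \<in> F)"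

section \<open>Localization of categories\<close>

text \<open>
  The Gabriel--Zisman localization of \<open>C\<close> at a class \<open>S\<close> of morphisms: morphisms are formal
  composites of morphisms of \<open>C\<close> (\<open>Gen X Y f\<close>, from \<open>X\<close> to \<open>Y\<close>) and of formal inverses of
  morphisms in \<open>S\<close> (\<open>Inv X Y w\<close>, from \<open>Y\<close> to \<open>X\<close>), modulo the congruence generated by the
  category axioms, the composition in \<open>C\<close> and the relations making \<open>Inv X Y w\<close> a two-sided
  inverse of \<open>Gen X Y w\<close>. \<open>Cmp t s\<close> stands for \<open>t\<close> after \<open>s\<close>.
\<close>

datatype ('o, 'm) formal_mor =
  Gen 'o 'o 'm
| Inv 'o 'o 'm
| Cmp "('o, 'm) formal_mor" "('o, 'm) formal_mor"

inductive fm_typ ::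
  "('o, 'm, 'x) category_scheme \<Rightarrow> ('o \<Rightarrow> 'o \<Rightarrow> 'm \<Rightarrow> bool) \<Rightarrow>
    'o \<Rightarrow> 'o \<Rightarrow> ('o, 'm) formal_mor \<Rightarrow> bool"
  for C S where
  gen: "f \<in> Mor C X Y \<Longrightarrow> fm_typ C S X Y (Gen X Y f)"
| inv: "w \<in> Mor C X Y \<Longrightarrow> S X Y w \<Longrightarrow> fm_typ C S Y X (Inv X Y w)"
| cmp: "fm_typ C S X Y s \<Longrightarrow> fm_typ C S Y Z t \<Longrightarrow> fm_typ C S X Z (Cmp t s)"

inductive fm_eq ::
  "('o, 'm, 'x) category_scheme \<Rightarrow> ('o \<Rightarrow> 'o \<Rightarrow> 'm \<Rightarrow> bool) \<Rightarrow>
    'o \<Rightarrow> 'o \<Rightarrow> ('o, 'm) formal_mor \<Rightarrow> ('o, 'm) formal_mor \<Rightarrow> bool"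
  for C S where
  refl: "fm_typ C S X Y s \<Longrightarrow> fm_eq C S X Y s s"
| sym: "fm_eq C S X Y s t \<Longrightarrow> fm_eq C S X Y t s"
| trans: "fm_eq C S X Y s t \<Longrightarrow> fm_eq C S X Y t u \<Longrightarrow> fm_eq C S X Y s u"
| cong: "fm_eq C S X Y s s' \<Longrightarrow> fm_eq C S Y Z t t' \<Longrightarrow> fm_eq C S X Z (Cmp t s) (Cmp t' s')"
| assoc: "fm_typ C S W X s \<Longrightarrow> fm_typ C S X Y t \<Longrightarrow> fm_typ C S Y Z u \<Longrightarrow>
    fm_eq C S W Z (Cmp u (Cmp t s)) (Cmp (Cmp u t) s)"
| unit_left: "fm_typ C S X Y s \<Longrightarrow> fm_eq C S X Y (Cmp (Gen Y Y (idm C Y)) s) s"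
| unit_right: "fm_typ C S X Y s \<Longrightarrow> fm_eq C S X Y (Cmp s (Gen X X (idm C X))) s"
| gen_cmp: "f \<in> Mor C X Y \<Longrightarrow> g \<in> Mor C Y Z \<Longrightarrow>
    fm_eq C S X Z (Cmp (Gen Y Z g) (Gen X Y f)) (Gen X Z (g \<cdot>\<^bsub>C\<^esub> f))"
| inv_left: "w \<in> Mor C X Y \<Longrightarrow> S X Y w \<Longrightarrow>
    fm_eq C S X X (Cmp (Inv X Y w) (Gen X Y w)) (Gen X X (idm C X))"
| inv_right: "w \<in> Mor C X Y \<Longrightarrow> S X Y w \<Longrightarrow>
    fm_eq C S Y Y (Cmp (Gen X Y w) (Inv X Y w)) (Gen Y Y (idm C Y))"

definition cat_localization ::
  "('o, 'm, 'x) category_scheme \<Rightarrow> ('o \<Rightarrow> 'o \<Rightarrow> 'm \<Rightarrow> bool) \<Rightarrow>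
    ('o, ('o, 'm) formal_mor set) category" where
  "cat_localization C S =
     \<lparr>Ob = Ob C,
      Mor = (\<lambda>X Y. {s. fm_typ C S X Y s} // {(s, t). fm_eq C S X Y s t}),
      idm = (\<lambda>X. {t. fm_eq C S X X (Gen X X (idm C X)) t}),
      cmp = (\<lambda>Q P. {r. \<exists>X Y Z. \<exists>s \<in> P. \<exists>t \<in> Q.
               fm_typ C S X Y s \<and> fm_typ C S Y Z t \<and> fm_eq C S X Z (Cmp t s) r})\<rparr>"

definition loc_arrow ::
  "('o, 'm, 'x) category_scheme \<Rightarrow> ('o \<Rightarrow> 'o \<Rightarrow> 'm \<Rightarrow> bool) \<Rightarrow>
    'o \<Rightarrow> 'o \<Rightarrow> 'm \<Rightarrow> ('o, 'm) formal_mor set" where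
  "loc_arrow C S X Y f = {t. fm_eq C S X Y (Gen X Y f) t}"

lemma fm_typ_Ob:
  assumes "category C"
  shows "fm_typ C S X Y s \<Longrightarrow> X \<in> Ob C \<and> Y \<in> Ob C"
  by (induction rule: fm_typ.induct) (auto dest: category.Mor_Ob[OF assms])

lemma fm_eq_typ:
  assumes "category C"
  shows "fm_eq C S X Y s t \<Longrightarrow> fm_typ C S X Y s \<and> fm_typ C S X Y t"
proof (induction rule: fm_eq.induct)
  case (unit_left X Y s)
  then show ?case
    using fm_typ_Ob[OF assms] by (auto intro!: fm_typ.intros category.idm_Mor[OF assms])
next
  case (unit_right X Y s)
  then show ?case
    using fm_typ_Ob[OF assms] by (auto intro!: fm_typ.intros category.idm_Mor[OF assms])
next
  case (gen_cmp f X Y g Z)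
  then show ?case
    by (auto intro: fm_typ.intros category.cmp_Mor[OF assms])
next
  case (inv_left w X Y)
  then show ?case
    using category.Mor_Ob[OF assms] by (blast intro: fm_typ.intros category.idm_Mor[OF assms])
next
  case (inv_right w X Y)
  then show ?case
    using category.Mor_Ob[OF assms] by (blast intro: fm_typ.intros category.idm_Mor[OF assms])
qed (auto intro: fm_typ.intros)

lemma fm_typ_unique: "fm_typ C S X Y s \<Longrightarrow> fm_typ C S X' Y' s \<Longrightarrow> X = X' \<and> Y = Y'"
proof (induction arbitrary: X' Y' rule: fm_typ.induct)
  case (gen f X Y)
  from gen.prems show ?case
    by cases auto
next
  case (inv w X Y)
  from inv.prems show ?case
    by cases auto
next
  case (cmp X Y s Z t)
  from cmp.prems show ?case
    by cases (use cmp.IH in blast)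
qed

lemma cat_localization_Mor:
  "P \<in> Mor (cat_localization C S) X Y \<longleftrightarrow>
     (\<exists>s. fm_typ C S X Y s \<and> P = {t. fm_eq C S X Y s t})"
  by (auto simp: cat_localization_def quotient_def)

lemma cat_localization_cmp:
  assumes "category C" "fm_typ C S X Y s" "fm_typ C S Y Z t"
  shows "{r. fm_eq C S Y Z t r} \<cdot>\<^bsub>cat_localization C S\<^esub> {r. fm_eq C S X Y s r} =
    {r. fm_eq C S X Z (Cmp t s) r}"
proof -
  have "fm_eq C S X Z (Cmp t s) r"
    if "fm_eq C S X Y s s'" "fm_eq C S Y Z t t'" "fm_typ C S X' Y' s'" "fm_typ C S Y' Z' t'"
      "fm_eq C S X' Z' (Cmp t' s') r" for r s' t' X' Y' Z'
  proof -
    have "X' = X" "Y' = Y" "Z' = Z"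
      using that fm_eq_typ[OF assms(1)] fm_typ_unique by metis+
    then show ?thesis
      using that fm_eq.cong fm_eq.trans by metis
  qed
  then show ?thesis
    using assms by (auto simp: cat_localization_def intro: fm_eq.refl) (metis fm_eq.refl)+
qed

lemma fm_class_eqI:
  "fm_eq C S X Y s t \<Longrightarrow> {r. fm_eq C S X Y s r} = {r. fm_eq C S X Y t r}"
  by (auto intro: fm_eq.trans fm_eq.sym)

lemma category_cat_localization:
  assumes "category C"
  shows "category (cat_localization C S)"
proof
  show "X \<in> Ob (cat_localization C S) \<and> Y \<in> Ob (cat_localization C S)"
    if "f \<in> Mor (cat_localization C S) X Y" for f X Y
    using that fm_typ_Ob[OF assms] unfolding cat_localization_Mor
    by (auto simp: cat_localization_def)
  show "idm (cat_localization C S) X \<in> Mor (cat_localization C S) X X"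
    if "X \<in> Ob (cat_localization C S)" for X
    using that category.idm_Mor[OF assms] unfolding cat_localization_Mor
    by (auto simp: cat_localization_def intro: fm_typ.gen)
  show "g \<cdot>\<^bsub>cat_localization C S\<^esub> f \<in> Mor (cat_localization C S) X Z"
    if "f \<in> Mor (cat_localization C S) X Y" "g \<in> Mor (cat_localization C S) Y Z" for f g X Y Z
    using that unfolding cat_localization_Mor
    by (metis assms cat_localization_cmp fm_typ.cmp)
  show "idm (cat_localization C S) Y \<cdot>\<^bsub>cat_localization C S\<^esub> f = f"
    if "f \<in> Mor (cat_localization C S) X Y" for f X Y
  proof -
    obtain s where s: "fm_typ C S X Y s" "f = {t. fm_eq C S X Y s t}"
      using \<open>f \<in> _\<close> unfolding cat_localization_Mor by blast
    have "fm_typ C S Y Y (Gen Y Y (idm C Y))"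
      using fm_typ_Ob[OF assms s(1)] category.idm_Mor[OF assms] by (blast intro: fm_typ.gen)
    from cat_localization_cmp[OF assms s(1) this] show ?thesis
      using fm_class_eqI[OF fm_eq.unit_left[OF s(1)]] s(2)
      by (simp add: cat_localization_def)
  qed
  show "f \<cdot>\<^bsub>cat_localization C S\<^esub> idm (cat_localization C S) X = f"
    if "f \<in> Mor (cat_localization C S) X Y" for f X Y
  proof -
    obtain s where s: "fm_typ C S X Y s" "f = {t. fm_eq C S X Y s t}"
      using \<open>f \<in> _\<close> unfolding cat_localization_Mor by blast
    have "fm_typ C S X X (Gen X X (idm C X))"
      using fm_typ_Ob[OF assms s(1)] category.idm_Mor[OF assms] by (blast intro: fm_typ.gen)
    from cat_localization_cmp[OF assms this s(1)] show ?thesis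
      using fm_class_eqI[OF fm_eq.unit_right[OF s(1)]] s(2)
      by (simp add: cat_localization_def)
  qed
  show "h \<cdot>\<^bsub>cat_localization C S\<^esub> (g \<cdot>\<^bsub>cat_localization C S\<^esub> f) =
      h \<cdot>\<^bsub>cat_localization C S\<^esub> g \<cdot>\<^bsub>cat_localization C S\<^esub> f"
    if asm: "f \<in> Mor (cat_localization C S) W X" "g \<in> Mor (cat_localization C S) X Y"
      "h \<in> Mor (cat_localization C S) Y Z" for f g h W X Y Z
  proof -
    obtain s where s: "fm_typ C S W X s" "f = {r. fm_eq C S W X s r}"
      using asm(1) unfolding cat_localization_Mor by blast
    obtain t where t: "fm_typ C S X Y t" "g = {r. fm_eq C S X Y t r}"
      using asm(2) unfolding cat_localization_Mor by blast
    obtain u where u: "fm_typ C S Y Z u" "h = {r. fm_eq C S Y Z u r}"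
      using asm(3) unfolding cat_localization_Mor by blast
    show ?thesis
      unfolding s(2) t(2) u(2)
      by (simp add: cat_localization_cmp[OF assms] s t u fm_typ.cmp[OF s(1) t(1)]
          fm_typ.cmp[OF t(1) u(1)] fm_class_eqI[OF fm_eq.assoc[OF s(1) t(1) u(1)]])
  qed
qed

lemma is_functor_loc_arrow:
  assumes "category C"
  shows "is_functor C (cat_localization C S) (\<lambda>X. X) (loc_arrow C S)"
proof -
  have "loc_arrow C S X Y f \<in> Mor (cat_localization C S) X Y" if "f \<in> Mor C X Y" for X Y f
    using that unfolding cat_localization_Mor loc_arrow_def by (blast intro: fm_typ.gen)
  moreover have "loc_arrow C S X Z (g \<cdot>\<^bsub>C\<^esub> f) =
      loc_arrow C S Y Z g \<cdot>\<^bsub>cat_localization C S\<^esub> loc_arrow C S X Y f"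
    if "f \<in> Mor C X Y" "g \<in> Mor C Y Z" for X Y Z f g
    unfolding loc_arrow_def cat_localization_cmp[OF assms fm_typ.gen[OF that(1)] fm_typ.gen[OF that(2)]]
    by (rule fm_class_eqI[OF fm_eq.sym[OF fm_eq.gen_cmp[OF that]]])
  ultimately show ?thesis
    by (auto simp: is_functor_def) (auto simp: loc_arrow_def cat_localization_def)
qed

lemma loc_arrow_inverts:
  assumes "category C" "w \<in> Mor C X Y" "S X Y w"
  shows "is_isomorphism (cat_localization C S) X Y (loc_arrow C S X Y w)"
proof -
  let ?v = "{t. fm_eq C S Y X (Inv X Y w) t}"
  have v: "?v \<in> Mor (cat_localization C S) Y X"
    using assms unfolding cat_localization_Mor by (blast intro: fm_typ.inv)
  have w: "loc_arrow C S X Y w \<in> Mor (cat_localization C S) X Y"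
    using assms unfolding cat_localization_Mor loc_arrow_def by (blast intro: fm_typ.gen)
  have "?v \<cdot>\<^bsub>cat_localization C S\<^esub> loc_arrow C S X Y w = idm (cat_localization C S) X"
    unfolding loc_arrow_def
      cat_localization_cmp[OF assms(1) fm_typ.gen[OF assms(2)] fm_typ.inv[where S = S, OF assms(2,3)]]
    using fm_class_eqI[OF fm_eq.inv_left[where S = S, OF assms(2,3)]]
    by (simp add: cat_localization_def)
  moreover have "loc_arrow C S X Y w \<cdot>\<^bsub>cat_localization C S\<^esub> ?v = idm (cat_localization C S) Y"
    unfolding loc_arrow_def
      cat_localization_cmp[OF assms(1) fm_typ.inv[where S = S, OF assms(2,3)] fm_typ.gen[OF assms(2)]]
    using fm_class_eqI[OF fm_eq.inv_right[where S = S, OF assms(2,3)]]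
    by (simp add: cat_localization_def)
  ultimately show ?thesis
    using v w unfolding is_isomorphism_def by blast
qed

primrec fm_eval ::
  "('p, 'n, 'y) category_scheme \<Rightarrow> ('o \<Rightarrow> 'p) \<Rightarrow> ('o \<Rightarrow> 'o \<Rightarrow> 'm \<Rightarrow> 'n) \<Rightarrow>
    ('o, 'm) formal_mor \<Rightarrow> 'n" where
  "fm_eval E \<Phi> \<phi> (Gen X Y f) = \<phi> X Y f"
| "fm_eval E \<Phi> \<phi> (Inv X Y w) = (SOME v. v \<in> Mor E (\<Phi> Y) (\<Phi> X) \<and>
     v \<cdot>\<^bsub>E\<^esub> \<phi> X Y w = idm E (\<Phi> X) \<and> \<phi> X Y w \<cdot>\<^bsub>E\<^esub> v = idm E (\<Phi> Y))"
| "fm_eval E \<Phi> \<phi> (Cmp t s) = fm_eval E \<Phi> \<phi> t \<cdot>\<^bsub>E\<^esub> fm_eval E \<Phi> \<phi> s"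

lemma cat_localization_universal:
  assumes C: "category C" and E: "category E" and \<phi>: "is_functor C E \<Phi> \<phi>"
    and S: "\<And>X Y w. w \<in> Mor C X Y \<Longrightarrow> S X Y w \<Longrightarrow> is_isomorphism E (\<Phi> X) (\<Phi> Y) (\<phi> X Y w)"
  shows "\<exists>\<psi>. is_functor (cat_localization C S) E \<Phi> \<psi> \<and>
      (\<forall>X Y. \<forall>f \<in> Mor C X Y. \<psi> X Y (loc_arrow C S X Y f) = \<phi> X Y f) \<and>
      (\<forall>\<psi>'. is_functor (cat_localization C S) E \<Phi> \<psi>' \<and>
         (\<forall>X Y. \<forall>f \<in> Mor C X Y. \<psi>' X Y (loc_arrow C S X Y f) = \<phi> X Y f) \<longrightarrow>
         (\<forall>X Y. \<forall>P \<in> Mor (cat_localization C S) X Y. \<psi>' X Y P = \<psi> X Y P))"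
proof -
  interpret C: category C by (rule C)
  interpret E: category E by (rule E)
  interpret L: category "cat_localization C S" by (rule category_cat_localization[OF C])
  let ?L = "cat_localization C S"
  let ?e = "fm_eval E \<Phi> \<phi>"
  have \<phi>_Ob: "\<Phi> X \<in> Ob E" "\<phi> X X (idm C X) = idm E (\<Phi> X)" if "X \<in> Ob C" for X
    using \<phi> that by (auto simp: is_functor_def)
  have \<phi>_Mor: "\<phi> X Y f \<in> Mor E (\<Phi> X) (\<Phi> Y)" if "f \<in> Mor C X Y" for X Y f
    using \<phi> that by (auto simp: is_functor_def)
  have \<phi>_cmp: "\<phi> X Z (g \<cdot>\<^bsub>C\<^esub> f) = \<phi> Y Z g \<cdot>\<^bsub>E\<^esub> \<phi> X Y f"
    if "f \<in> Mor C X Y" "g \<in> Mor C Y Z" for X Y Z f g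
    using \<phi> that unfolding is_functor_def by blast
  have e_Inv: "?e (Inv X Y w) \<in> Mor E (\<Phi> Y) (\<Phi> X) \<and>
      ?e (Inv X Y w) \<cdot>\<^bsub>E\<^esub> \<phi> X Y w = idm E (\<Phi> X) \<and> \<phi> X Y w \<cdot>\<^bsub>E\<^esub> ?e (Inv X Y w) = idm E (\<Phi> Y)"
    if "w \<in> Mor C X Y" "S X Y w" for X Y w
    unfolding fm_eval.simps by (rule someI_ex) (use S[OF that] in \<open>auto simp: is_isomorphism_def\<close>)
  have e_Mor: "?e s \<in> Mor E (\<Phi> X) (\<Phi> Y)" if "fm_typ C S X Y s" for X Y s
    using that
  proof (induction rule: fm_typ.induct)
    case (inv w X Y)
    then show ?case
      using e_Inv by blast
  qed (auto intro: \<phi>_Mor E.cmp_Mor)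
  have e_eq: "?e s = ?e t" if "fm_eq C S X Y s t" for X Y s t
    using that
  proof (induction rule: fm_eq.induct)
    case (assoc W X s Y t Z u)
    then show ?case
      using E.cmp_assoc[OF e_Mor e_Mor e_Mor] by simp
  next
    case (unit_left X Y s)
    then show ?case
      using fm_typ_Ob[OF C unit_left] \<phi>_Ob(2) E.idm_left[OF e_Mor[OF unit_left]] by simp
  next
    case (unit_right X Y s)
    then show ?case
      using fm_typ_Ob[OF C unit_right] \<phi>_Ob(2) E.idm_right[OF e_Mor[OF unit_right]] by simp
  next
    case (gen_cmp f X Y g Z)
    then show ?case
      using \<phi>_cmp by simp
  next
    case (inv_left w X Y)
    then show ?case
      using e_Inv[OF inv_left] C.Mor_Ob[OF inv_left(1)] \<phi>_Ob(2) by simp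
  next
    case (inv_right w X Y)
    then show ?case
      using e_Inv[OF inv_right] C.Mor_Ob[OF inv_right(1)] \<phi>_Ob(2) by simp
  qed simp_all
  define \<psi> where "\<psi> X Y P = ?e (SOME s. s \<in> P)" for X Y :: 'a and P
  have \<psi>: "\<psi> X Y {t. fm_eq C S X Y s t} = ?e s" if "fm_typ C S X Y s" for X Y s
  proof -
    have "fm_eq C S X Y s (SOME t. t \<in> {t. fm_eq C S X Y s t})"
      using fm_eq.refl[OF that] by (simp add: someI[of "fm_eq C S X Y s" s])
    then show ?thesis
      unfolding \<psi>_def by (rule e_eq[THEN HOL.sym])
  qed
  have \<psi>_loc: "\<psi> X Y (loc_arrow C S X Y f) = \<phi> X Y f" if "f \<in> Mor C X Y" for X Y f
    unfolding loc_arrow_def \<psi>[OF fm_typ.gen[OF that]] by simp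
  have idm: "idm ?L X = loc_arrow C S X X (idm C X)" for X
    by (simp add: loc_arrow_def cat_localization_def)
  have Ob: "Ob ?L = Ob C"
    by (simp add: cat_localization_def)
  have functor_\<psi>: "is_functor ?L E \<Phi> \<psi>"
    unfolding is_functor_def
  proof (intro conjI allI ballI)
    show "\<Phi> X \<in> Ob E" if "X \<in> Ob ?L" for X
      using that \<phi>_Ob by (simp add: Ob)
    show "\<psi> X X (idm ?L X) = idm E (\<Phi> X)" if "X \<in> Ob ?L" for X
      using that by (simp add: Ob idm \<psi>_loc \<phi>_Ob C.idm_Mor)
    show "\<psi> X Y P \<in> Mor E (\<Phi> X) (\<Phi> Y)" if "P \<in> Mor ?L X Y" for X Y P
      using that e_Mor \<psi> unfolding cat_localization_Mor by metis
    show "\<psi> X Z (Q \<cdot>\<^bsub>?L\<^esub> P) = \<psi> Y Z Q \<cdot>\<^bsub>E\<^esub> \<psi> X Y P"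
      if PQ: "P \<in> Mor ?L X Y" "Q \<in> Mor ?L Y Z" for X Y Z P Q
    proof -
      obtain s where s: "fm_typ C S X Y s" "P = {r. fm_eq C S X Y s r}"
        using PQ(1) unfolding cat_localization_Mor by blast
      obtain t where t: "fm_typ C S Y Z t" "Q = {r. fm_eq C S Y Z t r}"
        using PQ(2) unfolding cat_localization_Mor by blast
      show ?thesis
        unfolding s(2) t(2) cat_localization_cmp[OF C s(1) t(1)] \<psi>[OF s(1)] \<psi>[OF t(1)]
          \<psi>[OF fm_typ.cmp[OF s(1) t(1)]] by simp
    qed
  qed
  have unique: "\<psi>' X Y P = \<psi> X Y P"
    if F: "is_functor ?L E \<Phi> \<psi>'"
      and loc: "\<forall>X Y. \<forall>f \<in> Mor C X Y. \<psi>' X Y (loc_arrow C S X Y f) = \<phi> X Y f"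
      and P: "P \<in> Mor ?L X Y" for \<psi>' X Y P
  proof -
    have "\<psi>' X Y {t. fm_eq C S X Y s t} = ?e s" if "fm_typ C S X Y s" for X Y s
      using that
    proof (induction rule: fm_typ.induct)
      case (gen f X Y)
      then show ?case
        using loc by (simp add: loc_arrow_def)
    next
      case (inv w X Y)
      let ?v = "{t. fm_eq C S Y X (Inv X Y w) t}"
      have v: "?v \<in> Mor ?L Y X"
        using fm_typ.inv[where S = S, OF inv] unfolding cat_localization_Mor by blast
      have w: "loc_arrow C S X Y w \<in> Mor ?L X Y"
        using fm_typ.gen[OF inv(1)] unfolding cat_localization_Mor loc_arrow_def by blast
      have XY: "X \<in> Ob C" "Y \<in> Ob C"
        using C.Mor_Ob[OF inv(1)] by auto
      have "?v \<cdot>\<^bsub>?L\<^esub> loc_arrow C S X Y w = idm ?L X"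
        unfolding loc_arrow_def
          cat_localization_cmp[OF C fm_typ.gen[OF inv(1)] fm_typ.inv[where S = S, OF inv]]
        using fm_class_eqI[OF fm_eq.inv_left[where S = S, OF inv]]
        by (simp add: cat_localization_def)
      moreover have "\<psi>' X X (?v \<cdot>\<^bsub>?L\<^esub> loc_arrow C S X Y w) =
          \<psi>' Y X ?v \<cdot>\<^bsub>E\<^esub> \<psi>' X Y (loc_arrow C S X Y w)"
        using F v w unfolding is_functor_def by blast
      moreover have "\<psi>' X X (idm ?L X) = idm E (\<Phi> X)"
        using F XY Ob unfolding is_functor_def by blast
      ultimately have left: "\<psi>' Y X ?v \<cdot>\<^bsub>E\<^esub> \<phi> X Y w = idm E (\<Phi> X)"
        using loc inv(1) by simp
      have v': "\<psi>' Y X ?v \<in> Mor E (\<Phi> Y) (\<Phi> X)"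
        using F v unfolding is_functor_def by blast
      have e: "?e (Inv X Y w) \<in> Mor E (\<Phi> Y) (\<Phi> X)" "\<phi> X Y w \<cdot>\<^bsub>E\<^esub> ?e (Inv X Y w) = idm E (\<Phi> Y)"
        using e_Inv[OF inv] by auto
      show ?case
        using E.cmp_assoc[OF e(1) \<phi>_Mor[OF inv(1)] v'] E.idm_left[OF e(1)] E.idm_right[OF v']
        by (simp only: left e(2))
    next
      case (cmp X Y s Z t)
      have "{r. fm_eq C S X Y s r} \<in> Mor ?L X Y" "{r. fm_eq C S Y Z t r} \<in> Mor ?L Y Z"
        unfolding cat_localization_Mor using cmp.hyps by blast+
      then have "\<psi>' X Z ({r. fm_eq C S Y Z t r} \<cdot>\<^bsub>?L\<^esub> {r. fm_eq C S X Y s r}) =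
          \<psi>' Y Z {r. fm_eq C S Y Z t r} \<cdot>\<^bsub>E\<^esub> \<psi>' X Y {r. fm_eq C S X Y s r}"
        using F unfolding is_functor_def by blast
      then show ?case
        unfolding cat_localization_cmp[OF C cmp.hyps] cmp.IH by simp
    qed
    moreover obtain s where "fm_typ C S X Y s" "P = {t. fm_eq C S X Y s t}"
      using P unfolding cat_localization_Mor by blast
    ultimately show ?thesis
      using \<psi> by simp
  qed
  show ?thesis
    using functor_\<psi> \<psi>_loc unique by blast
qed

section \<open>The bounded derived category\<close>

record ('o, 'm) cochain_complex =
  cob :: "int \<Rightarrow> 'o"
  cdiff :: "int \<Rightarrow> 'm"

definition bounded_complex ::
  "('o, 'm, 'x) preadditive_scheme \<Rightarrow> ('o, 'm) cochain_complex \<Rightarrow> bool" where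
  "bounded_complex A X \<longleftrightarrow>
     (\<forall>n. cdiff X n \<in> Mor A (cob X n) (cob X (n + 1))) \<and>
     (\<forall>n. cdiff X (n + 1) \<cdot>\<^bsub>A\<^esub> cdiff X n = mzero A (cob X n) (cob X (n + 2))) \<and>
     finite {n. \<not> zero_object A (cob X n)}"

definition chain_map ::
  "('o, 'm, 'x) preadditive_scheme \<Rightarrow> ('o, 'm) cochain_complex \<Rightarrow> ('o, 'm) cochain_complex \<Rightarrow>
    (int \<Rightarrow> 'm) \<Rightarrow> bool" where
  "chain_map A X Y f \<longleftrightarrow>
     (\<forall>n. f n \<in> Mor A (cob X n) (cob Y n)) \<and>
     (\<forall>n. f (n + 1) \<cdot>\<^bsub>A\<^esub> cdiff X n = cdiff Y n \<cdot>\<^bsub>A\<^esub> f n)"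

definition bounded_complexes ::
  "('o, 'm, 'x) preadditive_scheme \<Rightarrow> (('o, 'm) cochain_complex, int \<Rightarrow> 'm) category" where
  "bounded_complexes A =
     \<lparr>Ob = {X. bounded_complex A X},
      Mor = (\<lambda>X Y. {f. bounded_complex A X \<and> bounded_complex A Y \<and> chain_map A X Y f}),
      idm = (\<lambda>X n. idm A (cob X n)),
      cmp = (\<lambda>g f n. g n \<cdot>\<^bsub>A\<^esub> f n)\<rparr>"

lemma category_bounded_complexes:
  assumes "preadditive_category A"
  shows "category (bounded_complexes A)"
proof -
  interpret preadditive_category A by fact
  have Ob: "cob X n \<in> Ob A" if "bounded_complex A X" for X n
    using that Mor_Ob unfolding bounded_complex_def by blast
  show ?thesis
  proof
    fix f X Y
    assume "f \<in> Mor (bounded_complexes A) X Y"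
    then show "X \<in> Ob (bounded_complexes A) \<and> Y \<in> Ob (bounded_complexes A)"
      and "idm (bounded_complexes A) Y \<cdot>\<^bsub>bounded_complexes A\<^esub> f = f"
      and "f \<cdot>\<^bsub>bounded_complexes A\<^esub> idm (bounded_complexes A) X = f"
      by (auto simp: bounded_complexes_def chain_map_def fun_eq_iff
          intro!: idm_left idm_right)
  next
    fix X
    assume "X \<in> Ob (bounded_complexes A)"
    then have X: "bounded_complex A X"
      by (simp add: bounded_complexes_def)
    then have d: "cdiff X n \<in> Mor A (cob X n) (cob X (n + 1))" for n
      by (simp add: bounded_complex_def)
    show "idm (bounded_complexes A) X \<in> Mor (bounded_complexes A) X X"
      using X Ob idm_Mor idm_left[OF d] idm_right[OF d]
      by (simp add: bounded_complexes_def chain_map_def)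
  next
    fix f g X Y Z
    assume fg: "f \<in> Mor (bounded_complexes A) X Y" "g \<in> Mor (bounded_complexes A) Y Z"
    have "g (n + 1) \<cdot>\<^bsub>A\<^esub> f (n + 1) \<cdot>\<^bsub>A\<^esub> cdiff X n = cdiff Z n \<cdot>\<^bsub>A\<^esub> (g n \<cdot>\<^bsub>A\<^esub> f n)" for n
    proof -
      have Mor: "f n \<in> Mor A (cob X n) (cob Y n)" "f (n + 1) \<in> Mor A (cob X (n + 1)) (cob Y (n + 1))"
        "g n \<in> Mor A (cob Y n) (cob Z n)" "g (n + 1) \<in> Mor A (cob Y (n + 1)) (cob Z (n + 1))"
        "cdiff X n \<in> Mor A (cob X n) (cob X (n + 1))"
        "cdiff Y n \<in> Mor A (cob Y n) (cob Y (n + 1))"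
        "cdiff Z n \<in> Mor A (cob Z n) (cob Z (n + 1))"
        using fg by (auto simp: bounded_complexes_def chain_map_def bounded_complex_def)
      have comm: "f (n + 1) \<cdot>\<^bsub>A\<^esub> cdiff X n = cdiff Y n \<cdot>\<^bsub>A\<^esub> f n"
        "g (n + 1) \<cdot>\<^bsub>A\<^esub> cdiff Y n = cdiff Z n \<cdot>\<^bsub>A\<^esub> g n"
        using fg by (auto simp: bounded_complexes_def chain_map_def)
      show ?thesis
        using cmp_assoc[OF Mor(5,2,4)] cmp_assoc[OF Mor(1,6,4)] cmp_assoc[OF Mor(1,3,7)] comm
        by simp
    qed
    with fg show "g \<cdot>\<^bsub>bounded_complexes A\<^esub> f \<in> Mor (bounded_complexes A) X Z"
      by (auto simp: bounded_complexes_def chain_map_def intro: cmp_Mor)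
  next
    fix f g h W X Y Z
    assume "f \<in> Mor (bounded_complexes A) W X" "g \<in> Mor (bounded_complexes A) X Y"
      "h \<in> Mor (bounded_complexes A) Y Z"
    then show "h \<cdot>\<^bsub>bounded_complexes A\<^esub> (g \<cdot>\<^bsub>bounded_complexes A\<^esub> f) =
        h \<cdot>\<^bsub>bounded_complexes A\<^esub> g \<cdot>\<^bsub>bounded_complexes A\<^esub> f"
      by (auto simp: bounded_complexes_def chain_map_def intro!: ext cmp_assoc)
  qed
qed

text \<open>
  \<open>H\<close> is the cohomology of \<open>X\<close> in degree \<open>n\<close>: \<open>k : K \<rightarrow> X\<^sup>n\<close> is a kernel of the differential, and
  \<open>c : K \<rightarrow> H\<close> is a cokernel of the map \<open>X\<^bsup>n-1\<^esup> \<rightarrow> K\<close> through which the previous differential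
  factors.
\<close>

definition is_cohomology ::
  "('o, 'm, 'x) preadditive_scheme \<Rightarrow> ('o, 'm) cochain_complex \<Rightarrow> int \<Rightarrow>
    'o \<times> 'm \<times> 'o \<times> 'm \<Rightarrow> bool" where
  "is_cohomology A X n = (\<lambda>(K, k, H, c).
     is_kernel A (cob X n) (cob X (n + 1)) (cdiff X n) K k \<and>
     (\<exists>e \<in> Mor A (cob X (n - 1)) K. k \<cdot>\<^bsub>A\<^esub> e = cdiff X (n - 1) \<and>
        is_cokernel A (cob X (n - 1)) K e H c))"

definition cohomology ::
  "('o, 'm, 'x) preadditive_scheme \<Rightarrow> ('o, 'm) cochain_complex \<Rightarrow> int \<Rightarrow> 'o \<times> 'm \<times> 'o \<times> 'm" where
  "cohomology A X n = (SOME D. is_cohomology A X n D)"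

definition cohomology_ob ::
  "('o, 'm, 'x) preadditive_scheme \<Rightarrow> ('o, 'm) cochain_complex \<Rightarrow> int \<Rightarrow> 'o" where
  "cohomology_ob A X n = (case cohomology A X n of (K, k, H, c) \<Rightarrow> H)"

definition cohomology_map ::
  "('o, 'm, 'x) preadditive_scheme \<Rightarrow> ('o, 'm) cochain_complex \<Rightarrow> ('o, 'm) cochain_complex \<Rightarrow>
    (int \<Rightarrow> 'm) \<Rightarrow> int \<Rightarrow> 'm" where
  "cohomology_map A X Y f n =
     (case cohomology A X n of (K, k, H, c) \<Rightarrow> case cohomology A Y n of (K', k', H', c') \<Rightarrow>
        (THE h. h \<in> Mor A H H' \<and>
           (\<exists>z \<in> Mor A K K'. k' \<cdot>\<^bsub>A\<^esub> z = f n \<cdot>\<^bsub>A\<^esub> k \<and> h \<cdot>\<^bsub>A\<^esub> c = c' \<cdot>\<^bsub>A\<^esub> z)))"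

definition quasi_isomorphism ::
  "('o, 'm, 'x) preadditive_scheme \<Rightarrow> ('o, 'm) cochain_complex \<Rightarrow> ('o, 'm) cochain_complex \<Rightarrow>
    (int \<Rightarrow> 'm) \<Rightarrow> bool" where
  "quasi_isomorphism A X Y f \<longleftrightarrow> chain_map A X Y f \<and>
     (\<forall>n. is_isomorphism A (cohomology_ob A X n) (cohomology_ob A Y n) (cohomology_map A X Y f n))"

text \<open>
  Homotopic chain maps need not be identified beforehand: they become equal once
  quasi-isomorphisms are inverted, because the projection from the cylinder of a complex onto the
  complex is a quasi-isomorphism.
\<close>

type_synonym ('o, 'm) derived_mor =
  "(('o, 'm) cochain_complex, int \<Rightarrow> 'm) formal_mor set"

definition derived_category ::
  "('o, 'm, 'x) preadditive_scheme \<Rightarrow>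
    (('o, 'm) cochain_complex, ('o, 'm) derived_mor) category" where
  "derived_category A = cat_localization (bounded_complexes A) (quasi_isomorphism A)"

definition derived_arrow ::
  "('o, 'm, 'x) preadditive_scheme \<Rightarrow> ('o, 'm) cochain_complex \<Rightarrow> ('o, 'm) cochain_complex \<Rightarrow>
    (int \<Rightarrow> 'm) \<Rightarrow> ('o, 'm) derived_mor" where
  "derived_arrow A = loc_arrow (bounded_complexes A) (quasi_isomorphism A)"

text \<open>The shift \<open>[1]\<close> on complexes, on chain maps and on morphisms of the derived category.\<close>

definition shift ::
  "('o, 'm, 'x) preadditive_scheme \<Rightarrow> ('o, 'm) cochain_complex \<Rightarrow> ('o, 'm) cochain_complex" where
  "shift A X = \<lparr>cob = (\<lambda>n. cob X (n + 1)),
     cdiff = (\<lambda>n. mneg A (cob X (n + 1)) (cob X (n + 2)) (cdiff X (n + 1)))\<rparr>"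

definition shift_map :: "(int \<Rightarrow> 'm) \<Rightarrow> int \<Rightarrow> 'm" where
  "shift_map f n = f (n + 1)"

definition derived_shift ::
  "('o, 'm, 'x) preadditive_scheme \<Rightarrow> ('o, 'm) derived_mor \<Rightarrow> ('o, 'm) derived_mor" where
  "derived_shift A P = {t. \<exists>X Y. \<exists>s \<in> P.
     fm_typ (bounded_complexes A) (quasi_isomorphism A) X Y s \<and>
     fm_eq (bounded_complexes A) (quasi_isomorphism A) (shift A X) (shift A Y)
       (map_formal_mor (shift A) shift_map s) t}"

text \<open>
  \<open>Z\<close> is a mapping cone of \<open>u : X \<rightarrow> Y\<close> with canonical chain maps \<open>v : Y \<rightarrow> Z\<close> and \<open>w : Z \<rightarrow> X[1]\<close>:
  \<open>Z\<^sup>n\<close> is a biproduct of \<open>X\<^bsup>n+1\<^esup>\<close> and \<open>Y\<^sup>n\<close>, and the differential of \<open>Z\<close> is the lower triangular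
  matrix with diagonal entries the differentials of \<open>X[1]\<close> and \<open>Y\<close> and lower left entry \<open>u\<^bsup>n+1\<^esup>\<close>.
\<close>

definition mapping_cone ::
  "('o, 'm, 'x) preadditive_scheme \<Rightarrow> ('o, 'm) cochain_complex \<Rightarrow> ('o, 'm) cochain_complex \<Rightarrow>
    (int \<Rightarrow> 'm) \<Rightarrow> ('o, 'm) cochain_complex \<Rightarrow> (int \<Rightarrow> 'm) \<Rightarrow> (int \<Rightarrow> 'm) \<Rightarrow> bool" where
  "mapping_cone A X Y u Z v w \<longleftrightarrow> (\<exists>i q. \<forall>n.
     is_biproduct A (cob X (n + 1)) (cob Y n) (cob Z n) (i n) (v n) (w n) (q n) \<and>
     cdiff Z n =
       madd A (i (n + 1) \<cdot>\<^bsub>A\<^esub> cdiff (shift A X) n \<cdot>\<^bsub>A\<^esub> w n)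
         (madd A (v (n + 1) \<cdot>\<^bsub>A\<^esub> u (n + 1) \<cdot>\<^bsub>A\<^esub> w n) (v (n + 1) \<cdot>\<^bsub>A\<^esub> cdiff Y n \<cdot>\<^bsub>A\<^esub> q n)))"

text \<open>
  \<open>X \<rightarrow> Y \<rightarrow> Z \<rightarrow> X[1]\<close> is a triangle if it is isomorphic in the derived category to the triangle
  \<open>X' \<rightarrow> Y' \<rightarrow> Z' \<rightarrow> X'[1]\<close> given by the mapping cone \<open>Z'\<close> of a chain map \<open>X' \<rightarrow> Y'\<close>.
\<close>

definition triangle ::
  "('o, 'm, 'x) preadditive_scheme \<Rightarrow>
    ('o, 'm) cochain_complex \<Rightarrow> ('o, 'm) cochain_complex \<Rightarrow> ('o, 'm) cochain_complex \<Rightarrow>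
    ('o, 'm) derived_mor \<Rightarrow> ('o, 'm) derived_mor \<Rightarrow> ('o, 'm) derived_mor \<Rightarrow> bool" where
  "triangle A X Y Z f g h \<longleftrightarrow>
     f \<in> Mor (derived_category A) X Y \<and>
     g \<in> Mor (derived_category A) Y Z \<and>
     h \<in> Mor (derived_category A) Z (shift A X) \<and>
     (\<exists>X' Y' Z' u v w a b c.
        bounded_complex A X' \<and> bounded_complex A Y' \<and> bounded_complex A Z' \<and>
        chain_map A X' Y' u \<and> mapping_cone A X' Y' u Z' v w \<and>
        is_isomorphism (derived_category A) X X' a \<and>
        is_isomorphism (derived_category A) Y Y' b \<and>
        is_isomorphism (derived_category A) Z Z' c \<and>
        b \<cdot>\<^bsub>derived_category A\<^esub> f = derived_arrow A X' Y' u \<cdot>\<^bsub>derived_category A\<^esub> a \<and>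
        c \<cdot>\<^bsub>derived_category A\<^esub> g = derived_arrow A Y' Z' v \<cdot>\<^bsub>derived_category A\<^esub> b \<and>
        derived_shift A a \<cdot>\<^bsub>derived_category A\<^esub> h =
          derived_arrow A Z' (shift A X') w \<cdot>\<^bsub>derived_category A\<^esub> c)"

definition stalk :: "('o, 'm, 'x) preadditive_scheme \<Rightarrow> 'o \<Rightarrow> ('o, 'm) cochain_complex" where
  "stalk A X =
     (let c = (\<lambda>n::int. if n = 0 then X else (SOME Z. zero_object A Z))
      in \<lparr>cob = c, cdiff = (\<lambda>n. mzero A (c n) (c (n + 1)))\<rparr>)"

section \<open>Categories with conflations\<close>

text \<open>
  \<open>conflation C X Y Z f g\<close> means that \<open>X \<rightarrow> Y \<rightarrow> Z\<close>, with morphisms \<open>f\<close> and \<open>g\<close>, is a conflation.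
  The Grothendieck monoid of an extriangulated category depends only on the underlying category
  and on its conflations, so the remaining extriangulated structure is not recorded.
\<close>

record ('o, 'm) conflation_category = "('o, 'm) category" +
  conflation :: "'o \<Rightarrow> 'o \<Rightarrow> 'o \<Rightarrow> 'm \<Rightarrow> 'm \<Rightarrow> bool"

definition with_short_exact ::
  "('o, 'm, 'x) preadditive_scheme \<Rightarrow> ('o, 'm) conflation_category" where
  "with_short_exact A =
     \<lparr>Ob = Ob A, Mor = Mor A, idm = idm A, cmp = cmp A, conflation = short_exact A\<rparr>"

text \<open>
  The objects of \<open>F[1] * A\<close>. Triangles are invariant under isomorphism in the derived category, so
  letting the outer terms range over (shifted) stalk complexes gives the same objects as letting
  them range over the essential images of \<open>F\<close> and \<open>A\<close> under the embedding \<open>stalk\<close>.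
\<close>

definition shifted_star ::
  "('o, 'm, 'x) preadditive_scheme \<Rightarrow> 'o set \<Rightarrow> ('o, 'm) cochain_complex set" where
  "shifted_star A F = {X \<in> Ob (derived_category A). \<exists>T \<in> F. \<exists>B \<in> Ob A. \<exists>f g h.
     triangle A (shift A (stalk A T)) X (stalk A B) f g h}"

definition shifted_star_category ::
  "('o, 'm, 'x) preadditive_scheme \<Rightarrow> 'o set \<Rightarrow>
    (('o, 'm) cochain_complex, ('o, 'm) derived_mor) conflation_category" where
  "shifted_star_category A F =
     \<lparr>Ob = shifted_star A F,
      Mor = (\<lambda>X Y. if X \<in> shifted_star A F \<and> Y \<in> shifted_star A F
               then Mor (derived_category A) X Y else {}),
      idm = idm (derived_category A),
      cmp = cmp (derived_category A),
      conflation = (\<lambda>X Y Z f g.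
        X \<in> shifted_star A F \<and> Y \<in> shifted_star A F \<and> Z \<in> shifted_star A F \<and>
        (\<exists>h. triangle A X Y Z f g h))\<rparr>"

section \<open>Commutative monoids\<close>

definition monoid_hom :: "('a, 'x) monoid_scheme \<Rightarrow> ('b, 'y) monoid_scheme \<Rightarrow> ('a \<Rightarrow> 'b) set" where
  "monoid_hom M N = {h \<in> hom M N. h \<one>\<^bsub>M\<^esub> = \<one>\<^bsub>N\<^esub>}"

text \<open>
  The Grothendieck monoid: the free commutative monoid on the objects (finite multisets of
  objects) modulo the congruence generated by the relations below.
\<close>

inductive gm_eq ::
  "('o, 'm, 'x) conflation_category_scheme \<Rightarrow> 'o multiset \<Rightarrow> 'o multiset \<Rightarrow> bool"
  for C where
  refl: "set_mset a \<subseteq> Ob C \<Longrightarrow> gm_eq C a a"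
| sym: "gm_eq C a b \<Longrightarrow> gm_eq C b a"
| trans: "gm_eq C a b \<Longrightarrow> gm_eq C b c \<Longrightarrow> gm_eq C a c"
| add: "gm_eq C a b \<Longrightarrow> gm_eq C c d \<Longrightarrow> gm_eq C (a + c) (b + d)"
| iso: "X \<in> Ob C \<Longrightarrow> Y \<in> Ob C \<Longrightarrow> isomorphic C X Y \<Longrightarrow> gm_eq C {#X#} {#Y#}"
| zero: "zero_object C Z \<Longrightarrow> gm_eq C {#Z#} {#}"
| conf: "X \<in> Ob C \<Longrightarrow> Y \<in> Ob C \<Longrightarrow> Z \<in> Ob C \<Longrightarrow> conflation C X Y Z f g \<Longrightarrow>
    gm_eq C {#Y#} {#X, Z#}"

definition grothendieck_monoid ::
  "('o, 'm, 'x) conflation_category_scheme \<Rightarrow> 'o multiset set monoid" where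
  "grothendieck_monoid C =
     \<lparr>carrier = {a. set_mset a \<subseteq> Ob C} // {(a, b). gm_eq C a b},
      monoid.mult = (\<lambda>P Q. {c. \<exists>a \<in> P. \<exists>b \<in> Q. gm_eq C (a + b) c}),
      one = {c. gm_eq C {#} c}\<rparr>"

definition gm_class ::
  "('o, 'm, 'x) conflation_category_scheme \<Rightarrow> 'o \<Rightarrow> 'o multiset set" where
  "gm_class C X = {c. gm_eq C {#X#} c}"

lemma gm_eq_Ob: "gm_eq C a b \<Longrightarrow> set_mset a \<subseteq> Ob C \<and> set_mset b \<subseteq> Ob C"
  by (induction rule: gm_eq.induct) (auto simp: zero_object_def)

lemma gm_class_eqI: "gm_eq C a b \<Longrightarrow> {c. gm_eq C a c} = {c. gm_eq C b c}"
  by (auto intro: gm_eq.trans gm_eq.sym)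

lemma gm_carrier:
  "P \<in> carrier (grothendieck_monoid C) \<longleftrightarrow>
     (\<exists>a. set_mset a \<subseteq> Ob C \<and> P = {c. gm_eq C a c})"
  by (auto simp: grothendieck_monoid_def quotient_def)

lemma gm_mult:
  assumes "set_mset a \<subseteq> Ob C" "set_mset b \<subseteq> Ob C"
  shows "{c. gm_eq C a c} \<otimes>\<^bsub>grothendieck_monoid C\<^esub> {c. gm_eq C b c} = {c. gm_eq C (a + b) c}"
proof -
  have "gm_eq C (a + b) c" if "gm_eq C a a'" "gm_eq C b b'" "gm_eq C (a' + b') c" for a' b' c
    using that by (meson gm_eq.add gm_eq.trans)
  then show ?thesis
    using assms by (auto simp: grothendieck_monoid_def) (meson gm_eq.refl)
qed

lemma comm_monoid_grothendieck_monoid: "comm_monoid (grothendieck_monoid C)"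
proof (rule comm_monoidI)
  have one: "\<one>\<^bsub>grothendieck_monoid C\<^esub> = {c. gm_eq C {#} c}"
    by (simp add: grothendieck_monoid_def)
  show "\<one>\<^bsub>grothendieck_monoid C\<^esub> \<in> carrier (grothendieck_monoid C)"
    unfolding one gm_carrier by (intro exI[of _ "{#}"]) simp
  show "P \<otimes>\<^bsub>grothendieck_monoid C\<^esub> Q \<in> carrier (grothendieck_monoid C)"
    if PQ: "P \<in> carrier (grothendieck_monoid C)" "Q \<in> carrier (grothendieck_monoid C)" for P Q
  proof -
    obtain a b where "set_mset a \<subseteq> Ob C" "P = {c. gm_eq C a c}"
      "set_mset b \<subseteq> Ob C" "Q = {c. gm_eq C b c}"
      using PQ unfolding gm_carrier by blast
    then show ?thesis
      unfolding gm_carrier by (intro exI[of _ "a + b"]) (simp add: gm_mult)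
  qed
  show "P \<otimes>\<^bsub>grothendieck_monoid C\<^esub> Q \<otimes>\<^bsub>grothendieck_monoid C\<^esub> R =
      P \<otimes>\<^bsub>grothendieck_monoid C\<^esub> (Q \<otimes>\<^bsub>grothendieck_monoid C\<^esub> R)"
    if "P \<in> carrier (grothendieck_monoid C)" "Q \<in> carrier (grothendieck_monoid C)"
      "R \<in> carrier (grothendieck_monoid C)" for P Q R
    using that unfolding gm_carrier by (force simp: gm_mult add.assoc)
  show "\<one>\<^bsub>grothendieck_monoid C\<^esub> \<otimes>\<^bsub>grothendieck_monoid C\<^esub> P = P"
    if "P \<in> carrier (grothendieck_monoid C)" for P
    using that unfolding gm_carrier one by (force simp: gm_mult)
  show "P \<otimes>\<^bsub>grothendieck_monoid C\<^esub> Q = Q \<otimes>\<^bsub>grothendieck_monoid C\<^esub> P"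
    if "P \<in> carrier (grothendieck_monoid C)" "Q \<in> carrier (grothendieck_monoid C)" for P Q
    using that unfolding gm_carrier by (force simp: gm_mult add.commute)
qed

lemma gm_class_relations:
  shows "X \<in> Ob C \<Longrightarrow> gm_class C X \<in> carrier (grothendieck_monoid C)"
    and "X \<in> Ob C \<Longrightarrow> Y \<in> Ob C \<Longrightarrow> isomorphic C X Y \<Longrightarrow> gm_class C X = gm_class C Y"
    and "zero_object C Z \<Longrightarrow> gm_class C Z = \<one>\<^bsub>grothendieck_monoid C\<^esub>"
    and "X \<in> Ob C \<Longrightarrow> Y \<in> Ob C \<Longrightarrow> Z \<in> Ob C \<Longrightarrow> conflation C X Y Z f g \<Longrightarrow>
      gm_class C Y = gm_class C X \<otimes>\<^bsub>grothendieck_monoid C\<^esub> gm_class C Z"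
proof -
  show "X \<in> Ob C \<Longrightarrow> gm_class C X \<in> carrier (grothendieck_monoid C)"
    unfolding gm_carrier gm_class_def by (intro exI[of _ "{#X#}"]) simp
  show "X \<in> Ob C \<Longrightarrow> Y \<in> Ob C \<Longrightarrow> isomorphic C X Y \<Longrightarrow> gm_class C X = gm_class C Y"
    unfolding gm_class_def by (intro gm_class_eqI gm_eq.iso)
  show "zero_object C Z \<Longrightarrow> gm_class C Z = \<one>\<^bsub>grothendieck_monoid C\<^esub>"
    using gm_class_eqI[OF gm_eq.zero] by (simp add: gm_class_def grothendieck_monoid_def)
  show "gm_class C Y = gm_class C X \<otimes>\<^bsub>grothendieck_monoid C\<^esub> gm_class C Z"
    if "X \<in> Ob C" "Y \<in> Ob C" "Z \<in> Ob C" "conflation C X Y Z f g"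
    using gm_class_eqI[OF gm_eq.conf[OF that]] gm_mult[of "{#X#}" C "{#Z#}"] that
    by (simp add: gm_class_def add_mset_commute)
qed

lemma grothendieck_monoid_universal:
  assumes "comm_monoid N"
    and "\<And>X. X \<in> Ob C \<Longrightarrow> \<xi> X \<in> carrier N"
    and "\<And>X Y. X \<in> Ob C \<Longrightarrow> Y \<in> Ob C \<Longrightarrow> isomorphic C X Y \<Longrightarrow> \<xi> X = \<xi> Y"
    and "\<And>Z. zero_object C Z \<Longrightarrow> \<xi> Z = \<one>\<^bsub>N\<^esub>"
    and "\<And>X Y Z f g. X \<in> Ob C \<Longrightarrow> Y \<in> Ob C \<Longrightarrow> Z \<in> Ob C \<Longrightarrow> conflation C X Y Z f g \<Longrightarrow>
      \<xi> Y = \<xi> X \<otimes>\<^bsub>N\<^esub> \<xi> Z"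
  shows "\<exists>h \<in> monoid_hom (grothendieck_monoid C) N. (\<forall>X \<in> Ob C. h (gm_class C X) = \<xi> X) \<and>
    (\<forall>h' \<in> monoid_hom (grothendieck_monoid C) N. (\<forall>X \<in> Ob C. h' (gm_class C X) = \<xi> X) \<longrightarrow>
       (\<forall>P \<in> carrier (grothendieck_monoid C). h' P = h P))"
proof -
  interpret N: comm_monoid N by fact
  define \<xi>' where "\<xi>' X = (if X \<in> Ob C then \<xi> X else \<one>\<^bsub>N\<^esub>)" for X
  have \<xi>'_carrier: "\<xi>' X \<in> carrier N" for X
    using assms(2) by (simp add: \<xi>'_def)
  define E where "E a = fold_mset (\<lambda>X y. \<xi>' X \<otimes>\<^bsub>N\<^esub> (if y \<in> carrier N then y else \<one>\<^bsub>N\<^esub>)) \<one>\<^bsub>N\<^esub> a"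
    for a
  interpret E: comp_fun_commute "\<lambda>X y. \<xi>' X \<otimes>\<^bsub>N\<^esub> (if y \<in> carrier N then y else \<one>\<^bsub>N\<^esub>)"
    by standard (auto simp: fun_eq_iff \<xi>'_carrier N.m_lcomm)
  have E_empty: "E {#} = \<one>\<^bsub>N\<^esub>"
    by (simp add: E_def)
  have E_carrier: "E a \<in> carrier N" for a
    by (induction a) (auto simp: E_def \<xi>'_carrier)
  have E_add_mset: "E (add_mset X a) = \<xi>' X \<otimes>\<^bsub>N\<^esub> E a" for X a
    using E_carrier[of a] by (simp add: E_def)
  have E_add: "E (a + b) = E a \<otimes>\<^bsub>N\<^esub> E b" for a b
    by (induction a) (simp_all add: E_empty E_add_mset E_carrier \<xi>'_carrier N.m_assoc)
  have E_eq: "E a = E b" if "gm_eq C a b" for a b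
    using that
  proof (induction rule: gm_eq.induct)
    case (iso X Y)
    then show ?case
      using assms(3)[of X Y] by (simp add: E_empty E_add_mset \<xi>'_def)
  next
    case (zero Z)
    then show ?case
      using assms(4)[of Z] by (simp add: E_empty E_add_mset \<xi>'_def)
  next
    case (conf X Y Z f g)
    then show ?case
      using assms(2) assms(5)[of X Y Z f g] by (simp add: E_empty E_add_mset \<xi>'_def)
  qed (simp_all add: E_add)
  define h where "h P = E (SOME a. a \<in> P)" for P
  have h: "h {c. gm_eq C a c} = E a" if "set_mset a \<subseteq> Ob C" for a
  proof -
    have "(SOME b. b \<in> {c. gm_eq C a c}) \<in> {c. gm_eq C a c}"
      using gm_eq.refl[OF that] by (simp add: someI[of "gm_eq C a" a])
    then have "E a = E (SOME b. b \<in> {c. gm_eq C a c})"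
      by (intro E_eq) simp
    then show ?thesis
      unfolding h_def by (rule HOL.sym)
  qed
  have one: "\<one>\<^bsub>grothendieck_monoid C\<^esub> = {c. gm_eq C {#} c}"
    by (simp add: grothendieck_monoid_def)
  have h_carrier: "h P \<in> carrier N" if "P \<in> carrier (grothendieck_monoid C)" for P
    unfolding h_def by (rule E_carrier)
  have h_mult: "h (P \<otimes>\<^bsub>grothendieck_monoid C\<^esub> Q) = h P \<otimes>\<^bsub>N\<^esub> h Q"
    if PQ: "P \<in> carrier (grothendieck_monoid C)" "Q \<in> carrier (grothendieck_monoid C)" for P Q
  proof -
    obtain a b where a: "set_mset a \<subseteq> Ob C" "P = {c. gm_eq C a c}"
      and b: "set_mset b \<subseteq> Ob C" "Q = {c. gm_eq C b c}"
      using PQ unfolding gm_carrier by blast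
    have "set_mset (a + b) \<subseteq> Ob C"
      using a b by simp
    then show ?thesis
      unfolding a(2) b(2) gm_mult[OF a(1) b(1)] by (simp only: h a b E_add)
  qed
  have "h \<one>\<^bsub>grothendieck_monoid C\<^esub> = \<one>\<^bsub>N\<^esub>"
    unfolding one by (subst h) (simp_all add: E_empty)
  with h_carrier h_mult have "h \<in> monoid_hom (grothendieck_monoid C) N"
    unfolding monoid_hom_def hom_def by blast
  moreover have "\<forall>X \<in> Ob C. h (gm_class C X) = \<xi> X"
    using assms(2) by (simp add: gm_class_def h E_empty E_add_mset \<xi>'_def)
  moreover have "h' P = h P"
    if h': "h' \<in> monoid_hom (grothendieck_monoid C) N" "\<forall>X \<in> Ob C. h' (gm_class C X) = \<xi> X"
      and P: "P \<in> carrier (grothendieck_monoid C)" for h' P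
  proof -
    have "h' {c. gm_eq C a c} = E a" if "set_mset a \<subseteq> Ob C" for a
      using that
    proof (induction a)
      case empty
      then show ?case
        using h'(1) by (simp add: monoid_hom_def one E_empty)
    next
      case (add X a)
      have "{c. gm_eq C (add_mset X a) c} =
          gm_class C X \<otimes>\<^bsub>grothendieck_monoid C\<^esub> {c. gm_eq C a c}"
        using add.prems gm_mult[of "{#X#}" C a] by (simp add: gm_class_def)
      moreover have "gm_class C X \<in> carrier (grothendieck_monoid C)"
        "{c. gm_eq C a c} \<in> carrier (grothendieck_monoid C)"
        using add.prems gm_class_relations(1)[of X C] gm_carrier[of "{c. gm_eq C a c}" C] by auto
      ultimately show ?case
        using h' add by (simp add: monoid_hom_def hom_def E_add_mset \<xi>'_def)
    qed
    moreover obtain a where "set_mset a \<subseteq> Ob C" "P = {c. gm_eq C a c}"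
      using P unfolding gm_carrier by blast
    ultimately show ?thesis
      using h by metis
  qed
  ultimately show ?thesis
    by blast
qed

text \<open>
  The localization of a commutative monoid at a subset: fractions whose denominators lie in the
  submonoid generated by the subset.
\<close>

inductive_set submonoid_generated :: "('a, 'x) monoid_scheme \<Rightarrow> 'a set \<Rightarrow> 'a set"
  for M S where
  one: "\<one>\<^bsub>M\<^esub> \<in> submonoid_generated M S"
| mult: "s \<in> S \<Longrightarrow> x \<in> submonoid_generated M S \<Longrightarrow> s \<otimes>\<^bsub>M\<^esub> x \<in> submonoid_generated M S"

definition fraction_rel ::
  "('a, 'x) monoid_scheme \<Rightarrow> 'a set \<Rightarrow> (('a \<times> 'a) \<times> ('a \<times> 'a)) set" where
  "fraction_rel M S = {((x, s), (y, t)).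
     x \<in> carrier M \<and> y \<in> carrier M \<and>
     s \<in> submonoid_generated M S \<and> t \<in> submonoid_generated M S \<and>
     (\<exists>u \<in> submonoid_generated M S. x \<otimes>\<^bsub>M\<^esub> t \<otimes>\<^bsub>M\<^esub> u = y \<otimes>\<^bsub>M\<^esub> s \<otimes>\<^bsub>M\<^esub> u)}"

definition monoid_localization ::
  "('a, 'x) monoid_scheme \<Rightarrow> 'a set \<Rightarrow> ('a \<times> 'a) set monoid" where
  "monoid_localization M S =
     \<lparr>carrier = (carrier M \<times> submonoid_generated M S) // fraction_rel M S,
      monoid.mult = (\<lambda>P Q. {r. \<exists>(x, s) \<in> P. \<exists>(y, t) \<in> Q.
                ((x \<otimes>\<^bsub>M\<^esub> y, s \<otimes>\<^bsub>M\<^esub> t), r) \<in> fraction_rel M S}),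
      one = fraction_rel M S `` {(\<one>\<^bsub>M\<^esub>, \<one>\<^bsub>M\<^esub>)}\<rparr>"

definition localization_map :: "('a, 'x) monoid_scheme \<Rightarrow> 'a set \<Rightarrow> 'a \<Rightarrow> ('a \<times> 'a) set" where
  "localization_map M S x = fraction_rel M S `` {(x, \<one>\<^bsub>M\<^esub>)}"

context
  fixes M :: "('a, 'x) monoid_scheme" (structure) and S :: "'a set"
  assumes comm_monoid_M: "comm_monoid M" and S_subset: "S \<subseteq> carrier M"
begin

interpretation comm_monoid M by (rule comm_monoid_M)

private abbreviation (input) "T \<equiv> submonoid_generated M S"
private abbreviation (input) "R \<equiv> fraction_rel M S"
private abbreviation (input) "L \<equiv> monoid_localization M S"

lemma submonoid_generated_carrier: "t \<in> T \<Longrightarrow> t \<in> carrier M"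
  by (induction rule: submonoid_generated.induct) (use S_subset in auto)

lemma submonoid_generated_mult: "s \<in> T \<Longrightarrow> t \<in> T \<Longrightarrow> s \<otimes> t \<in> T"
proof (induction rule: submonoid_generated.induct)
  case one
  then show ?case
    using submonoid_generated_carrier by simp
next
  case (mult s x)
  then have "s \<in> carrier M" "x \<in> carrier M" "t \<in> carrier M"
    using submonoid_generated_carrier S_subset by auto
  then show ?case
    using mult by (simp add: m_assoc submonoid_generated.mult)
qed

lemma subset_submonoid_generated: "s \<in> S \<Longrightarrow> s \<in> T"
  using submonoid_generated.mult[OF _ submonoid_generated.one, of s S M] S_subset by auto

lemma fraction_rel_trans:
  assumes "((x, s), (y, t)) \<in> R" "((y, t), (z, r)) \<in> R"
  shows "((x, s), (z, r)) \<in> R"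
proof -
  from assms obtain u v where *: "u \<in> T" "v \<in> T" "x \<otimes> t \<otimes> u = y \<otimes> s \<otimes> u" "y \<otimes> r \<otimes> v = z \<otimes> t \<otimes> v"
    and T: "s \<in> T" "t \<in> T" "r \<in> T" and M: "x \<in> carrier M" "y \<in> carrier M" "z \<in> carrier M"
    by (auto simp: fraction_rel_def)
  have c: "u \<in> carrier M" "v \<in> carrier M" "s \<in> carrier M" "t \<in> carrier M" "r \<in> carrier M"
    using * T submonoid_generated_carrier by auto
  have "x \<otimes> r \<otimes> (t \<otimes> u \<otimes> v) = (x \<otimes> t \<otimes> u) \<otimes> (r \<otimes> v)"
    using M c by (simp add: m_ac)
  also have "\<dots> = (y \<otimes> r \<otimes> v) \<otimes> (s \<otimes> u)"
    unfolding *(3) using M c by (simp add: m_ac)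
  also have "\<dots> = z \<otimes> s \<otimes> (t \<otimes> u \<otimes> v)"
    unfolding * using M c by (simp add: m_ac)
  finally show ?thesis
    using T M * submonoid_generated_mult by (auto simp: fraction_rel_def)
qed

lemma equiv_fraction_rel: "equiv (carrier M \<times> T) R"
proof (rule equivI)
  show "R \<subseteq> (carrier M \<times> T) \<times> (carrier M \<times> T)"
    by (auto simp: fraction_rel_def)
  show "refl_on (carrier M \<times> T) R"
    using submonoid_generated.one by (fastforce simp: refl_on_def fraction_rel_def)
  show "sym R"
    unfolding sym_def fraction_rel_def by simp metis
  show "trans R"
    using fraction_rel_trans by (auto intro!: transI)
qed

lemma fraction_rel_mult:
  assumes "((x, s), (x', s')) \<in> R" "((y, t), (y', t')) \<in> R"
  shows "((x \<otimes> y, s \<otimes> t), (x' \<otimes> y', s' \<otimes> t')) \<in> R"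
proof -
  from assms obtain u v where *: "u \<in> T" "v \<in> T" "x \<otimes> s' \<otimes> u = x' \<otimes> s \<otimes> u" "y \<otimes> t' \<otimes> v = y' \<otimes> t \<otimes> v"
    and T: "s \<in> T" "t \<in> T" "s' \<in> T" "t' \<in> T"
    and M: "x \<in> carrier M" "y \<in> carrier M" "x' \<in> carrier M" "y' \<in> carrier M"
    by (auto simp: fraction_rel_def)
  have c: "u \<in> carrier M" "v \<in> carrier M" "s \<in> carrier M" "t \<in> carrier M"
    "s' \<in> carrier M" "t' \<in> carrier M"
    using * T submonoid_generated_carrier by auto
  have "x \<otimes> y \<otimes> (s' \<otimes> t') \<otimes> (u \<otimes> v) = (x \<otimes> s' \<otimes> u) \<otimes> (y \<otimes> t' \<otimes> v)"
    using M c by (simp add: m_ac)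
  also have "\<dots> = x' \<otimes> y' \<otimes> (s \<otimes> t) \<otimes> (u \<otimes> v)"
    unfolding * using M c by (simp add: m_ac)
  finally show ?thesis
    using T M * submonoid_generated_mult by (auto simp: fraction_rel_def)
qed

lemma localization_carrier:
  "P \<in> carrier L \<longleftrightarrow> (\<exists>x \<in> carrier M. \<exists>s \<in> T. P = R `` {(x, s)})"
  by (auto simp: monoid_localization_def quotient_def)

lemma localization_mult:
  assumes "x \<in> carrier M" "s \<in> T" "y \<in> carrier M" "t \<in> T"
  shows "R `` {(x, s)} \<otimes>\<^bsub>L\<^esub> R `` {(y, t)} = R `` {(x \<otimes> y, s \<otimes> t)}"
proof -
  have "(x, s) \<in> R `` {(x, s)}" "(y, t) \<in> R `` {(y, t)}"
    using assms equiv_class_self[OF equiv_fraction_rel] by auto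
  moreover have "((x \<otimes> y, s \<otimes> t), q) \<in> R"
    if "((x, s), (x', s')) \<in> R" "((y, t), (y', t')) \<in> R" "((x' \<otimes> y', s' \<otimes> t'), q) \<in> R" for x' s' y' t' q
    using fraction_rel_trans[OF fraction_rel_mult[OF that(1,2)]] that(3) by (cases q) blast
  ultimately show ?thesis
    unfolding monoid_localization_def by auto
qed

lemma fraction_class_eq_iff:
  assumes "x \<in> carrier M" "s \<in> T" "y \<in> carrier M" "t \<in> T"
  shows "R `` {(x, s)} = R `` {(y, t)} \<longleftrightarrow> (\<exists>u \<in> T. x \<otimes> t \<otimes> u = y \<otimes> s \<otimes> u)"
  using assms eq_equiv_class_iff[OF equiv_fraction_rel, of "(x, s)" "(y, t)"]
  by (auto simp: fraction_rel_def)

lemma comm_monoid_monoid_localization: "comm_monoid L"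
proof (rule comm_monoidI)
  have one: "\<one>\<^bsub>L\<^esub> = R `` {(\<one>, \<one>)}"
    by (simp add: monoid_localization_def)
  show "\<one>\<^bsub>L\<^esub> \<in> carrier L"
    unfolding one localization_carrier using submonoid_generated.one by blast
  show "P \<otimes>\<^bsub>L\<^esub> Q \<in> carrier L" if "P \<in> carrier L" "Q \<in> carrier L" for P Q
    using that unfolding localization_carrier
    by (metis localization_mult m_closed submonoid_generated_mult)
  show "P \<otimes>\<^bsub>L\<^esub> Q \<otimes>\<^bsub>L\<^esub> U = P \<otimes>\<^bsub>L\<^esub> (Q \<otimes>\<^bsub>L\<^esub> U)"
    if "P \<in> carrier L" "Q \<in> carrier L" "U \<in> carrier L" for P Q U
    using that unfolding localization_carrier
    by (elim bexE)
      (simp add: localization_mult submonoid_generated_mult submonoid_generated_carrier m_assoc)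
  show "\<one>\<^bsub>L\<^esub> \<otimes>\<^bsub>L\<^esub> P = P" if "P \<in> carrier L" for P
    using that unfolding localization_carrier one
    by (elim bexE)
      (simp add: localization_mult submonoid_generated.one submonoid_generated_carrier)
  show "P \<otimes>\<^bsub>L\<^esub> Q = Q \<otimes>\<^bsub>L\<^esub> P" if "P \<in> carrier L" "Q \<in> carrier L" for P Q
    using that unfolding localization_carrier
    by (elim bexE) (simp add: localization_mult submonoid_generated_carrier m_comm)
qed

lemma localization_map_hom: "localization_map M S \<in> monoid_hom M L"
proof -
  have "localization_map M S x \<in> carrier L" if "x \<in> carrier M" for x
    using that submonoid_generated.one unfolding localization_map_def localization_carrier by blast
  moreover have "localization_map M S \<one> = \<one>\<^bsub>L\<^esub>"
    by (simp add: localization_map_def monoid_localization_def)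
  moreover have "localization_map M S (x \<otimes> y) = localization_map M S x \<otimes>\<^bsub>L\<^esub> localization_map M S y"
    if "x \<in> carrier M" "y \<in> carrier M" for x y
    using that by (simp add: localization_map_def localization_mult submonoid_generated.one)
  ultimately show ?thesis
    unfolding monoid_hom_def hom_def by blast
qed

lemma localization_map_inverts:
  assumes "s \<in> S"
  shows "localization_map M S s \<in> Units L"
proof -
  have s: "s \<in> T" "s \<in> carrier M"
    using assms subset_submonoid_generated S_subset by auto
  have one: "\<one>\<^bsub>L\<^esub> = R `` {(\<one>, \<one>)}"
    by (simp add: monoid_localization_def)
  have "R `` {(s, s)} = R `` {(\<one>, \<one>)}"
    using s submonoid_generated.one[of M S] by (auto simp: fraction_class_eq_iff)
  then have "R `` {(\<one>, s)} \<otimes>\<^bsub>L\<^esub> localization_map M S s = \<one>\<^bsub>L\<^esub>"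
    "localization_map M S s \<otimes>\<^bsub>L\<^esub> R `` {(\<one>, s)} = \<one>\<^bsub>L\<^esub>"
    using s submonoid_generated.one[of M S]
    by (simp_all add: one localization_map_def localization_mult)
  moreover have "R `` {(\<one>, s)} \<in> carrier L" "localization_map M S s \<in> carrier L"
    unfolding localization_carrier localization_map_def
    using s submonoid_generated.one by blast+
  ultimately show ?thesis
    unfolding Units_def by blast
qed

lemma monoid_localization_universal:
  assumes "comm_monoid N" and g: "g \<in> monoid_hom M N" and gS: "\<And>s. s \<in> S \<Longrightarrow> g s \<in> Units N"
  shows "\<exists>h \<in> monoid_hom L N. (\<forall>x \<in> carrier M. h (localization_map M S x) = g x) \<and>
    (\<forall>h' \<in> monoid_hom L N. (\<forall>x \<in> carrier M. h' (localization_map M S x) = g x) \<longrightarrow>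
       (\<forall>P \<in> carrier L. h' P = h P))"
proof -
  interpret N: comm_monoid N by fact
  have g_closed: "g x \<in> carrier N" if "x \<in> carrier M" for x
    using g that by (auto simp: monoid_hom_def hom_def)
  have g_mult: "g (x \<otimes> y) = g x \<otimes>\<^bsub>N\<^esub> g y" if "x \<in> carrier M" "y \<in> carrier M" for x y
    using g that by (auto simp: monoid_hom_def hom_def)
  have g_one: "g \<one> = \<one>\<^bsub>N\<^esub>"
    using g by (simp add: monoid_hom_def)
  have gT: "g t \<in> Units N" if "t \<in> T" for t
    using that
  proof (induction rule: submonoid_generated.induct)
    case (mult s x)
    then show ?case
      using gS S_subset submonoid_generated_carrier by (simp add: g_mult subsetD)
  qed (simp add: g_one)
  have gT_inv: "inv\<^bsub>N\<^esub> g t \<in> carrier N" "g t \<in> carrier N"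
    "g t \<otimes>\<^bsub>N\<^esub> inv\<^bsub>N\<^esub> g t = \<one>\<^bsub>N\<^esub>" if "t \<in> T" for t
    using gT[OF that] by auto
  have val: "g x \<otimes>\<^bsub>N\<^esub> inv\<^bsub>N\<^esub> g s = g y \<otimes>\<^bsub>N\<^esub> inv\<^bsub>N\<^esub> g t" if r: "((x, s), (y, t)) \<in> R" for x s y t
  proof -
    from r obtain u where u: "u \<in> T" "x \<otimes> t \<otimes> u = y \<otimes> s \<otimes> u" and T: "s \<in> T" "t \<in> T"
      and M: "x \<in> carrier M" "y \<in> carrier M"
      by (auto simp: fraction_rel_def)
    note c = submonoid_generated_carrier[OF T(1)] submonoid_generated_carrier[OF T(2)]
      submonoid_generated_carrier[OF u(1)]
    note i = gT_inv[OF T(1)] gT_inv[OF T(2)] gT_inv[OF u(1)]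
    have "g x \<otimes>\<^bsub>N\<^esub> inv\<^bsub>N\<^esub> g s = g x \<otimes>\<^bsub>N\<^esub> inv\<^bsub>N\<^esub> g s \<otimes>\<^bsub>N\<^esub> (g t \<otimes>\<^bsub>N\<^esub> inv\<^bsub>N\<^esub> g t) \<otimes>\<^bsub>N\<^esub>
        (g u \<otimes>\<^bsub>N\<^esub> inv\<^bsub>N\<^esub> g u)"
      using M i g_closed by simp
    also have "\<dots> = g (x \<otimes> t \<otimes> u) \<otimes>\<^bsub>N\<^esub> (inv\<^bsub>N\<^esub> g s \<otimes>\<^bsub>N\<^esub> inv\<^bsub>N\<^esub> g t \<otimes>\<^bsub>N\<^esub> inv\<^bsub>N\<^esub> g u)"
      using M c i(1,2,4,5,7,8) g_closed by (simp add: g_mult N.m_ac)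
    also have "\<dots> = g y \<otimes>\<^bsub>N\<^esub> inv\<^bsub>N\<^esub> g t \<otimes>\<^bsub>N\<^esub> (g s \<otimes>\<^bsub>N\<^esub> inv\<^bsub>N\<^esub> g s) \<otimes>\<^bsub>N\<^esub> (g u \<otimes>\<^bsub>N\<^esub> inv\<^bsub>N\<^esub> g u)"
      unfolding u(2) using M c i(1,2,4,5,7,8) g_closed by (simp add: g_mult N.m_ac)
    also have "\<dots> = g y \<otimes>\<^bsub>N\<^esub> inv\<^bsub>N\<^esub> g t"
      using M i g_closed by simp
    finally show ?thesis .
  qed
  define h where "h P = (case SOME p. p \<in> P of (x, s) \<Rightarrow> g x \<otimes>\<^bsub>N\<^esub> inv\<^bsub>N\<^esub> g s)" for P
  have h: "h (R `` {(x, s)}) = g x \<otimes>\<^bsub>N\<^esub> inv\<^bsub>N\<^esub> g s" if "x \<in> carrier M" "s \<in> T" for x s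
  proof -
    obtain y t where yt: "(SOME p. p \<in> R `` {(x, s)}) = (y, t)"
      by (cases "SOME p. p \<in> R `` {(x, s)}")
    have "(x, s) \<in> R `` {(x, s)}"
      using that equiv_class_self[OF equiv_fraction_rel] by auto
    then have "(y, t) \<in> R `` {(x, s)}"
      unfolding yt[symmetric] by (rule someI)
    then have "((x, s), (y, t)) \<in> R"
      by simp
    then show ?thesis
      using val unfolding h_def yt by simp
  qed
  have one: "\<one>\<^bsub>L\<^esub> = R `` {(\<one>, \<one>)}"
    by (simp add: monoid_localization_def)
  have h_mult: "h (P \<otimes>\<^bsub>L\<^esub> Q) = h P \<otimes>\<^bsub>N\<^esub> h Q" if PQ: "P \<in> carrier L" "Q \<in> carrier L" for P Q
  proof -
    obtain x s y t where *: "x \<in> carrier M" "s \<in> T" "P = R `` {(x, s)}"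
      "y \<in> carrier M" "t \<in> T" "Q = R `` {(y, t)}"
      using PQ unfolding localization_carrier by blast
    have "inv\<^bsub>N\<^esub> g (s \<otimes> t) = inv\<^bsub>N\<^esub> g s \<otimes>\<^bsub>N\<^esub> inv\<^bsub>N\<^esub> g t"
    proof -
      note i = gT_inv[OF *(2)] gT_inv[OF *(5)]
      have "g (s \<otimes> t) \<otimes>\<^bsub>N\<^esub> (inv\<^bsub>N\<^esub> g s \<otimes>\<^bsub>N\<^esub> inv\<^bsub>N\<^esub> g t) =
          (g s \<otimes>\<^bsub>N\<^esub> inv\<^bsub>N\<^esub> g s) \<otimes>\<^bsub>N\<^esub> (g t \<otimes>\<^bsub>N\<^esub> inv\<^bsub>N\<^esub> g t)"
        using * i(1,2,4,5) submonoid_generated_carrier by (simp add: g_mult N.m_ac)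
      then have "g (s \<otimes> t) \<otimes>\<^bsub>N\<^esub> (inv\<^bsub>N\<^esub> g s \<otimes>\<^bsub>N\<^esub> inv\<^bsub>N\<^esub> g t) = \<one>\<^bsub>N\<^esub>"
        using i by simp
      moreover have "g (s \<otimes> t) \<in> carrier N" "inv\<^bsub>N\<^esub> g s \<otimes>\<^bsub>N\<^esub> inv\<^bsub>N\<^esub> g t \<in> carrier N"
        using * i submonoid_generated_carrier by (auto simp: g_mult)
      ultimately show ?thesis
        using N.inv_unique' N.m_comm by metis
    qed
    then show ?thesis
      using * submonoid_generated_mult gT_inv(1)[OF *(2)] gT_inv(1)[OF *(5)] g_closed
      by (simp add: localization_mult h g_mult N.m_ac)
  qed
  have h_hom: "h \<in> monoid_hom L N"
    using h_mult gT_inv submonoid_generated.one[of M S]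
    by (auto simp: monoid_hom_def hom_def localization_carrier h one g_one g_closed)
  moreover have "h (localization_map M S x) = g x" if "x \<in> carrier M" for x
    using that submonoid_generated.one[of M S]
    by (simp add: localization_map_def h g_one g_closed)
  moreover have "h' P = h P"
    if h': "h' \<in> monoid_hom L N" "\<forall>x \<in> carrier M. h' (localization_map M S x) = g x"
      and P: "P \<in> carrier L" for h' P
  proof -
    obtain x s where *: "x \<in> carrier M" "s \<in> T" "P = R `` {(x, s)}"
      using P unfolding localization_carrier by blast
    have s: "s \<in> carrier M"
      using * submonoid_generated_carrier by blast
    have L: "localization_map M S s \<in> carrier L"
      using s submonoid_generated.one unfolding localization_map_def localization_carrier by blast
    have "P \<otimes>\<^bsub>L\<^esub> localization_map M S s = localization_map M S x"
      using * s submonoid_generated.one[of M S]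
      by (auto simp: localization_map_def localization_mult fraction_class_eq_iff
          intro!: bexI[of _ "\<one>"])
    then have "h' P \<otimes>\<^bsub>N\<^esub> g s = g x"
      using h' P L * s by (metis (no_types, lifting) monoid_hom_def hom_mult mem_Collect_eq)
    moreover have "h' P \<in> carrier N"
      using h'(1) P by (auto simp: monoid_hom_def hom_def)
    ultimately have "h' P = g x \<otimes>\<^bsub>N\<^esub> inv\<^bsub>N\<^esub> g s"
      using gT_inv[OF *(2)] N.m_assoc N.r_one by metis
    then show ?thesis
      using h * by simp
  qed
  ultimately show ?thesis
    by blast
qed

end

end

theory Submission
  imports Defs
begin

text \<open>
  Every triangle \<open>X \<rightarrow> Y \<rightarrow> Z \<rightarrow> X[1]\<close> in \<open>F[1] * A\<close> has an exact cohomology sequence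
  \<open>0 \<rightarrow> H\<^sup>-\<^sup>1 X \<rightarrow> H\<^sup>-\<^sup>1 Y \<rightarrow> H\<^sup>-\<^sup>1 Z \<rightarrow> H\<^sup>0 X \<rightarrow> H\<^sup>0 Y \<rightarrow> H\<^sup>0 Z \<rightarrow> 0\<close>. Cutting it into short exact sequences shows
  that the alternating sum of its classes vanishes already in \<open>M(A)\<close> (written without
  subtraction), so \<open>X \<mapsto> [H\<^sup>0 X] - [H\<^sup>-\<^sup>1 X]\<close> is additive with values in the localization of \<open>M(A)\<close>; it
  makes sense because \<open>H\<^sup>-\<^sup>1 X\<close> lies in \<open>F\<close>. In the other direction, the conflation \<open>T \<rightarrow> 0 \<rightarrow> T[1]\<close>
  makes \<open>[T]\<close> invertible in \<open>M(F[1] * A)\<close> for \<open>T\<close> in \<open>F\<close>. The two homomorphisms so obtained are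
  inverse to each other, since the defining triangle \<open>T[1] \<rightarrow> X \<rightarrow> B\<close> gives \<open>[X] = [B] - [T]\<close>.
\<close>

section \<open>Abelian categories\<close>

text \<open>Morphisms of the derived category are words in chain maps and formal inverses modulo a
  congruence, not roofs, so they are handled in two ways: the universal property of the localization
  extends \<open>cohomology_map\<close> to them, and inductions over words and relations treat the
  shift and the zero object. Since classes in \<open>M(A)\<close> depend only on isomorphism
  classes, a triangle may be replaced by an actual mapping cone once the cohomology objects are
  known to correspond; only the objects of the exact sequence are transported, not its maps. In the
  other direction, triangles have to be produced, and all of them come from cones of maps between
  stalks placed in a single degree: such a cone is a two-term complex, which is again a stalk up to
  quasi-isomorphism. To avoid carrying coherence isomorphisms, stalks, their shifts and the
  cohomology of shifts are arranged to agree by equality. That the two homomorphisms are mutually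
  inverse is tested on generators, where the class of \<open>T[1]\<close> is pinned down as the
  inverse of the class of \<open>T\<close>.\<close>

context category
begin

lemma isomorphic_sym: "isomorphic C X Y \<Longrightarrow> isomorphic C Y X"
  unfolding isomorphic_def is_isomorphism_def by blast

lemma isomorphic_trans:
  assumes "isomorphic C X Y" "isomorphic C Y Z"
  shows "isomorphic C X Z"
proof -
  obtain f f' where f: "f \<in> Mor C X Y" "f' \<in> Mor C Y X" "f' \<cdot> f = idm C X" "f \<cdot> f' = idm C Y"
    using assms(1) unfolding isomorphic_def is_isomorphism_def by blast
  obtain g g' where g: "g \<in> Mor C Y Z" "g' \<in> Mor C Z Y" "g' \<cdot> g = idm C Y" "g \<cdot> g' = idm C Z"
    using assms(2) unfolding isomorphic_def is_isomorphism_def by blast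
  have "f' \<cdot> g' \<cdot> (g \<cdot> f) = f' \<cdot> (g' \<cdot> g \<cdot> f)"
    using cmp_assoc[OF cmp_Mor[OF f(1) g(1)] g(2) f(2)] cmp_assoc[OF f(1) g(1,2)] by simp
  then have "f' \<cdot> g' \<cdot> (g \<cdot> f) = idm C X"
    using f g by (simp add: idm_left)
  moreover have "g \<cdot> f \<cdot> (f' \<cdot> g') = g \<cdot> (f \<cdot> f' \<cdot> g')"
    using cmp_assoc[OF cmp_Mor[OF g(2) f(2)] f(1) g(1)] cmp_assoc[OF g(2) f(2,1)] by simp
  then have "g \<cdot> f \<cdot> (f' \<cdot> g') = idm C Z"
    using f g by (simp add: idm_left)
  ultimately show ?thesis
    using cmp_Mor[OF f(1) g(1)] cmp_Mor[OF g(2) f(2)]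
    unfolding isomorphic_def is_isomorphism_def by blast
qed

lemma is_epi_cancel:
  "is_epi C X Y p \<Longrightarrow> g \<in> Mor C Y W \<Longrightarrow> h \<in> Mor C Y W \<Longrightarrow> g \<cdot> p = h \<cdot> p \<Longrightarrow> g = h"
  unfolding is_epi_def by blast

lemma is_mono_cancel:
  "is_mono C X Y p \<Longrightarrow> g \<in> Mor C W X \<Longrightarrow> h \<in> Mor C W X \<Longrightarrow> p \<cdot> g = p \<cdot> h \<Longrightarrow> g = h"
  unfolding is_mono_def by blast

lemma is_epi_Mor: "is_epi C X Y p \<Longrightarrow> p \<in> Mor C X Y"
  unfolding is_epi_def by blast

lemma is_epi_idm: "X \<in> Ob C \<Longrightarrow> is_epi C X X (idm C X)"
  unfolding is_epi_def using idm_Mor idm_right by metis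

lemma is_epi_cmp:
  assumes "is_epi C X Y p" "is_epi C Y Z q"
  shows "is_epi C X Z (q \<cdot> p)"
proof -
  have M: "p \<in> Mor C X Y" "q \<in> Mor C Y Z"
    using assms by (auto dest: is_epi_Mor)
  moreover have "g = h" if "g \<in> Mor C Z W" "h \<in> Mor C Z W" "g \<cdot> (q \<cdot> p) = h \<cdot> (q \<cdot> p)" for W g h
  proof (rule is_epi_cancel[OF assms(2) that(1,2)])
    show "g \<cdot> q = h \<cdot> q"
      by (rule is_epi_cancel[OF assms(1)])
        (use M that in \<open>auto simp: cmp_assoc[symmetric] intro: cmp_Mor\<close>)
  qed
  ultimately show ?thesis
    unfolding is_epi_def using cmp_Mor by blast
qed

text \<open>Element chases produce surjectivity in this form: once some \<open>q\<close> makes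
  \<open>p \<cdot> q\<close> a known epimorphism, \<open>p\<close> is one too.\<close>

lemma is_epi_rightI:
  assumes p: "p \<in> Mor C Y Z" and q: "q \<in> Mor C X Y" and "is_epi C X Z (p \<cdot> q)"
  shows "is_epi C Y Z p"
  unfolding is_epi_def
proof (intro conjI p allI ballI impI)
  fix W g h
  assume g: "g \<in> Mor C Z W" and h: "h \<in> Mor C Z W" and "g \<cdot> p = h \<cdot> p"
  then have "g \<cdot> (p \<cdot> q) = h \<cdot> (p \<cdot> q)"
    by (simp add: cmp_assoc[OF q p])
  then show "g = h"
    using is_epi_cancel[OF assms(3) g h] by blast
qed

end

section \<open>Zero morphisms, negatives, kernels and cokernels in preadditive categories\<close>

context preadditive_category
begin

lemma hom_group_simps [simp]:
  "carrier (hom_group A X Y) = Mor A X Y"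
  "f \<otimes>\<^bsub>hom_group A X Y\<^esub> g = madd A f g"
  "\<one>\<^bsub>hom_group A X Y\<^esub> = mzero A X Y"
  "inv\<^bsub>hom_group A X Y\<^esub> f = mneg A X Y f"
  by (simp_all add: hom_group_def mneg_def)

lemma hom_group_Mor: "f \<in> Mor A X Y \<Longrightarrow> comm_group (hom_group A X Y)"
  using Mor_Ob hom_comm_group by blast

lemma mzero_Mor: "X \<in> Ob A \<Longrightarrow> Y \<in> Ob A \<Longrightarrow> mzero A X Y \<in> Mor A X Y"
  using hom_comm_group[THEN comm_group.axioms(2), THEN group.is_monoid, THEN monoid.one_closed]
  by simp

lemma madd_Mor: "f \<in> Mor A X Y \<Longrightarrow> g \<in> Mor A X Y \<Longrightarrow> madd A f g \<in> Mor A X Y"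
  using hom_group_Mor[THEN comm_group.axioms(2), THEN group.is_monoid, THEN monoid.m_closed]
  by simp

lemma mneg_Mor: "f \<in> Mor A X Y \<Longrightarrow> mneg A X Y f \<in> Mor A X Y"
  using hom_group_Mor[THEN comm_group.axioms(2), THEN group.inv_closed] by simp

lemma madd_assoc:
  "f \<in> Mor A X Y \<Longrightarrow> g \<in> Mor A X Y \<Longrightarrow> h \<in> Mor A X Y \<Longrightarrow>
    madd A (madd A f g) h = madd A f (madd A g h)"
  using hom_group_Mor[THEN comm_group.axioms(2), THEN group.is_monoid, THEN monoid.m_assoc, of f X Y f g h]
  by simp

lemma madd_commute: "f \<in> Mor A X Y \<Longrightarrow> g \<in> Mor A X Y \<Longrightarrow> madd A f g = madd A g f"
  using comm_monoid.m_comm[OF comm_group.axioms(1), OF hom_group_Mor, of f X Y f g] by simp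

lemma madd_zero_left: "f \<in> Mor A X Y \<Longrightarrow> madd A (mzero A X Y) f = f"
  using hom_group_Mor[THEN comm_group.axioms(2), THEN group.is_monoid, THEN monoid.l_one] by simp

lemma madd_zero_right: "f \<in> Mor A X Y \<Longrightarrow> madd A f (mzero A X Y) = f"
  using hom_group_Mor[THEN comm_group.axioms(2), THEN group.is_monoid, THEN monoid.r_one] by simp

lemma madd_neg_right: "f \<in> Mor A X Y \<Longrightarrow> madd A f (mneg A X Y f) = mzero A X Y"
  using hom_group_Mor[THEN comm_group.axioms(2), THEN group.r_inv] by simp

lemma madd_neg_left: "f \<in> Mor A X Y \<Longrightarrow> madd A (mneg A X Y f) f = mzero A X Y"
  using hom_group_Mor[THEN comm_group.axioms(2), THEN group.l_inv] by simp

lemma madd_cancel_left: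
  "f \<in> Mor A X Y \<Longrightarrow> g \<in> Mor A X Y \<Longrightarrow> h \<in> Mor A X Y \<Longrightarrow> madd A f g = madd A f h \<Longrightarrow> g = h"
  using group.is_monoid[OF comm_group.axioms(2), OF hom_group_Mor, THEN monoid.Units_l_cancel, of f X Y f g h]
    group.Units_eq[OF comm_group.axioms(2), OF hom_group_Mor, of f X Y]
  by simp

lemma mneg_unique:
  "f \<in> Mor A X Y \<Longrightarrow> g \<in> Mor A X Y \<Longrightarrow> madd A f g = mzero A X Y \<Longrightarrow> g = mneg A X Y f"
  by (rule madd_cancel_left[of f X Y]) (simp_all add: madd_neg_right mneg_Mor)

lemma mneg_mneg: "f \<in> Mor A X Y \<Longrightarrow> mneg A X Y (mneg A X Y f) = f"
  using mneg_unique[of "mneg A X Y f" X Y f] by (simp add: mneg_Mor madd_neg_left)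

lemma mneg_mzero: "X \<in> Ob A \<Longrightarrow> Y \<in> Ob A \<Longrightarrow> mneg A X Y (mzero A X Y) = mzero A X Y"
  using mneg_unique[of "mzero A X Y" X Y "mzero A X Y"] by (simp add: mzero_Mor madd_zero_left)

text \<open>By biadditivity the composite c satisfies c + c = c = c + 0, and cancellation in the
  hom-group leaves c = 0.\<close>

lemma mzero_cmp:
  assumes f: "f \<in> Mor A X Y" and Z: "Z \<in> Ob A"
  shows "mzero A Y Z \<cdot> f = mzero A X Z"
proof -
  have z: "mzero A Y Z \<in> Mor A Y Z"
    using f Z Mor_Ob mzero_Mor by blast
  have zf: "mzero A Y Z \<cdot> f \<in> Mor A X Z"
    using f z by (rule cmp_Mor)
  have "madd A (mzero A Y Z \<cdot> f) (mzero A Y Z \<cdot> f) = madd A (mzero A Y Z \<cdot> f) (mzero A X Z)"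
    using cmp_add_left[OF f z z] zf by (simp add: madd_zero_left[OF z] madd_zero_right[OF zf])
  then show ?thesis
    using madd_cancel_left zf mzero_Mor Mor_Ob by metis
qed

lemma cmp_mzero:
  assumes f: "f \<in> Mor A X Y" and W: "W \<in> Ob A"
  shows "f \<cdot> mzero A W X = mzero A W Y"
proof -
  have z: "mzero A W X \<in> Mor A W X"
    using f W Mor_Ob mzero_Mor by blast
  have fz: "f \<cdot> mzero A W X \<in> Mor A W Y"
    using z f by (rule cmp_Mor)
  have "madd A (f \<cdot> mzero A W X) (f \<cdot> mzero A W X) = madd A (f \<cdot> mzero A W X) (mzero A W Y)"
    using cmp_add_right[OF z z f] fz by (simp add: madd_zero_left[OF z] madd_zero_right[OF fz])
  then show ?thesis
    using madd_cancel_left fz mzero_Mor Mor_Ob by metis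
qed

lemma mneg_cmp:
  assumes f: "f \<in> Mor A X Y" and g: "g \<in> Mor A Y Z"
  shows "mneg A Y Z g \<cdot> f = mneg A X Z (g \<cdot> f)"
proof (rule mneg_unique)
  show "madd A (g \<cdot> f) (mneg A Y Z g \<cdot> f) = mzero A X Z"
    using f g Mor_Ob by (simp add: cmp_add_left[symmetric, OF f g mneg_Mor[OF g]] madd_neg_right mzero_cmp)
qed (use f g in \<open>auto intro: cmp_Mor mneg_Mor\<close>)

lemma cmp_mneg:
  assumes f: "f \<in> Mor A X Y" and g: "g \<in> Mor A Y Z"
  shows "g \<cdot> mneg A X Y f = mneg A X Z (g \<cdot> f)"
proof (rule mneg_unique)
  show "madd A (g \<cdot> f) (g \<cdot> mneg A X Y f) = mzero A X Z"
    using f g Mor_Ob by (simp add: cmp_add_right[symmetric, OF f mneg_Mor[OF f] g] madd_neg_right cmp_mzero)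
qed (use f g in \<open>auto intro: cmp_Mor mneg_Mor\<close>)

lemma eq_if_diff_mzero:
  "f \<in> Mor A X Y \<Longrightarrow> g \<in> Mor A X Y \<Longrightarrow> madd A f (mneg A X Y g) = mzero A X Y \<Longrightarrow> f = g"
  by (metis mneg_Mor mneg_mneg mneg_unique)

text \<open>The identity and the zero morphism are both endomorphisms of \<open>Z\<close>, so they
  agree when \<open>Z\<close> is a zero object; conversely every morphism into or out of
  \<open>Z\<close> factors through \<open>idm A Z\<close> and hence vanishes. The universal property
  thus becomes an equation usable for rewriting.\<close>

lemma zero_object_iff: "zero_object A Z \<longleftrightarrow> Z \<in> Ob A \<and> idm A Z = mzero A Z Z"
proof
  assume "zero_object A Z"
  then show "Z \<in> Ob A \<and> idm A Z = mzero A Z Z"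
    unfolding zero_object_def using idm_Mor mzero_Mor by blast
next
  assume Z: "Z \<in> Ob A \<and> idm A Z = mzero A Z Z"
  have "f = mzero A X Z" if "f \<in> Mor A X Z" for f X
    using Z that by (metis idm_left mzero_cmp)
  moreover have "f = mzero A Z X" if "f \<in> Mor A Z X" for f X
    using Z that by (metis idm_right cmp_mzero)
  ultimately show "zero_object A Z"
    unfolding zero_object_def using Z mzero_Mor by metis
qed

lemma zero_object_Mor_to: "zero_object A Z \<Longrightarrow> f \<in> Mor A X Z \<Longrightarrow> f = mzero A X Z"
  unfolding zero_object_iff by (metis idm_left mzero_cmp)

lemma zero_object_Mor_from: "zero_object A Z \<Longrightarrow> f \<in> Mor A Z X \<Longrightarrow> f = mzero A Z X"
  unfolding zero_object_iff by (metis idm_right cmp_mzero)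

text \<open>Two morphisms agree after composition with \<open>p\<close> exactly when their
  difference composes to zero, so testing against zero suffices.\<close>

lemma is_epiI:
  assumes p: "p \<in> Mor A X Y"
    and *: "\<And>W g. g \<in> Mor A Y W \<Longrightarrow> g \<cdot> p = mzero A X W \<Longrightarrow> g = mzero A Y W"
  shows "is_epi A X Y p"
  unfolding is_epi_def
proof (intro conjI p allI ballI impI)
  fix W g h
  assume g: "g \<in> Mor A Y W" and h: "h \<in> Mor A Y W" and eq: "g \<cdot> p = h \<cdot> p"
  have "madd A g (mneg A Y W h) \<cdot> p = mzero A X W"
    using eq cmp_Mor[OF p h]
    by (simp add: cmp_add_left[OF p g mneg_Mor[OF h]] mneg_cmp[OF p h] madd_neg_right)
  then show "g = h"
    using * eq_if_diff_mzero g h madd_Mor mneg_Mor by meson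
qed

lemma is_monoI:
  assumes p: "p \<in> Mor A X Y"
    and *: "\<And>W g. g \<in> Mor A W X \<Longrightarrow> p \<cdot> g = mzero A W Y \<Longrightarrow> g = mzero A W X"
  shows "is_mono A X Y p"
  unfolding is_mono_def
proof (intro conjI p allI ballI impI)
  fix W g h
  assume g: "g \<in> Mor A W X" and h: "h \<in> Mor A W X" and eq: "p \<cdot> g = p \<cdot> h"
  have "p \<cdot> madd A g (mneg A W X h) = mzero A W Y"
    using eq cmp_Mor[OF h p]
    by (simp add: cmp_add_right[OF g mneg_Mor[OF h] p] cmp_mneg[OF h p] madd_neg_right)
  then show "g = h"
    using * eq_if_diff_mzero g h madd_Mor mneg_Mor by meson
qed

lemma is_epi_mzeroD:
  "is_epi A X Y p \<Longrightarrow> g \<in> Mor A Y W \<Longrightarrow> g \<cdot> p = mzero A X W \<Longrightarrow> g = mzero A Y W"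
  using is_epi_cancel[of X Y p g W "mzero A Y W"] Mor_Ob mzero_Mor mzero_cmp is_epi_Mor by metis

lemma is_mono_mzeroD:
  "is_mono A X Y p \<Longrightarrow> g \<in> Mor A W X \<Longrightarrow> p \<cdot> g = mzero A W Y \<Longrightarrow> g = mzero A W X"
  using is_mono_cancel[of X Y p g W "mzero A W X"] Mor_Ob mzero_Mor cmp_mzero
  unfolding is_mono_def by metis

text \<open>Both \<open>g\<close> and the zero morphism factor the zero morphism through
  \<open>k\<close>, and such factorizations are unique.\<close>

lemma is_kernel_mono:
  assumes "is_kernel A X Y f K k"
  shows "is_mono A K X k"
proof (rule is_monoI)
  show k: "k \<in> Mor A K X"
    using assms unfolding is_kernel_def by blast
  have f: "f \<in> Mor A X Y"
    using assms unfolding is_kernel_def by blast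
  fix W g
  assume g: "g \<in> Mor A W K" and kg: "k \<cdot> g = mzero A W X"
  have W: "W \<in> Ob A" "K \<in> Ob A" "X \<in> Ob A"
    using g k Mor_Ob by auto
  then have "k \<cdot> mzero A W K = mzero A W X" "mzero A W K \<in> Mor A W K"
    using k cmp_mzero mzero_Mor by auto
  moreover have "mzero A W X \<in> Mor A W X" "f \<cdot> mzero A W X = mzero A W Y"
    using W f cmp_mzero mzero_Mor by auto
  ultimately show "g = mzero A W K"
    using assms g kg unfolding is_kernel_def by metis
qed

lemma is_cokernel_epi:
  assumes "is_cokernel A X Y f Q q"
  shows "is_epi A Y Q q"
proof (rule is_epiI)
  show q: "q \<in> Mor A Y Q"
    using assms unfolding is_cokernel_def by blast
  have f: "f \<in> Mor A X Y"
    using assms unfolding is_cokernel_def by blast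
  fix W g
  assume g: "g \<in> Mor A Q W" and gq: "g \<cdot> q = mzero A Y W"
  have W: "W \<in> Ob A" "Q \<in> Ob A" "Y \<in> Ob A"
    using g q Mor_Ob by auto
  then have "mzero A Q W \<cdot> q = mzero A Y W" "mzero A Q W \<in> Mor A Q W"
    using q mzero_cmp mzero_Mor by auto
  moreover have "mzero A Y W \<in> Mor A Y W" "mzero A Y W \<cdot> f = mzero A X W"
    using W f mzero_cmp mzero_Mor by auto
  ultimately show "g = mzero A Q W"
    using assms g gq unfolding is_cokernel_def by metis
qed

text \<open>The monomorphism hypothesis supplies the uniqueness half of the universal property,
  leaving only a factorization to be found.\<close>

lemma is_kernelI:
  assumes f: "f \<in> Mor A X Y" and k: "is_mono A K X k" and "f \<cdot> k = mzero A K Y"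
    and "\<And>W h. h \<in> Mor A W X \<Longrightarrow> f \<cdot> h = mzero A W Y \<Longrightarrow> \<exists>u \<in> Mor A W K. k \<cdot> u = h"
  shows "is_kernel A X Y f K k"
  using assms is_mono_cancel[OF k] unfolding is_kernel_def is_mono_def by metis

lemma is_cokernelI:
  assumes f: "f \<in> Mor A X Y" and q: "is_epi A Y Q q" and "q \<cdot> f = mzero A X Q"
    and "\<And>W h. h \<in> Mor A Y W \<Longrightarrow> h \<cdot> f = mzero A X W \<Longrightarrow> \<exists>u \<in> Mor A Q W. u \<cdot> q = h"
  shows "is_cokernel A X Y f Q q"
  using assms is_epi_cancel[OF q] unfolding is_cokernel_def is_epi_def by metis

lemma is_kernel_factor:
  "is_kernel A X Y f K k \<Longrightarrow> h \<in> Mor A W X \<Longrightarrow> f \<cdot> h = mzero A W Y \<Longrightarrow> \<exists>u \<in> Mor A W K. k \<cdot> u = h"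
  unfolding is_kernel_def by blast

lemma is_cokernel_factor:
  "is_cokernel A X Y f Q q \<Longrightarrow> h \<in> Mor A Y W \<Longrightarrow> h \<cdot> f = mzero A X W \<Longrightarrow> \<exists>u \<in> Mor A Q W. u \<cdot> q = h"
  unfolding is_cokernel_def by blast

lemma is_kernelD:
  assumes "is_kernel A X Y f K k"
  shows "f \<in> Mor A X Y" "k \<in> Mor A K X" "f \<cdot> k = mzero A K Y"
  using assms unfolding is_kernel_def by auto

lemma is_cokernelD:
  assumes "is_cokernel A X Y f Q q"
  shows "f \<in> Mor A X Y" "q \<in> Mor A Y Q" "q \<cdot> f = mzero A X Q"
  using assms unfolding is_cokernel_def by auto

end

section \<open>Lifting along epimorphisms, and exactness\<close>

context abelian_category
begin

text \<open>\<open>p\<close> is the cokernel of some \<open>g\<close>, and \<open>g\<close> factors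
  through the kernel \<open>k\<close>; a morphism that kills \<open>k\<close> therefore kills
  \<open>g\<close> and factors through \<open>p\<close>.\<close>

lemma epi_is_cokernel_of_kernel:
  assumes p: "is_epi A X Y p" and k: "is_kernel A X Y p K k"
  shows "is_cokernel A K X k Y p"
proof -
  obtain W g where g: "is_cokernel A W X g Y p"
    using epi_is_cokernel p by blast
  obtain t where t: "t \<in> Mor A W K" "k \<cdot> t = g"
    using is_kernel_factor[OF k] is_cokernelD[OF g] by blast
  show ?thesis
  proof (rule is_cokernelI[OF _ p])
    fix V h
    assume h: "h \<in> Mor A X V" "h \<cdot> k = mzero A K V"
    then have "h \<cdot> g = mzero A W V"
      using t cmp_assoc[OF t(1) is_kernelD(2)[OF k] h(1)] mzero_cmp[OF t(1)] Mor_Ob[OF h(1)] by simp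
    then show "\<exists>u \<in> Mor A Y V. u \<cdot> p = h"
      using is_cokernel_factor[OF g h(1)] by blast
  qed (use is_kernelD[OF k] in auto)
qed

text \<open>Dually, \<open>m\<close> is the kernel of some \<open>g\<close>, and \<open>g\<close>
  factors through the cokernel \<open>q\<close>, so whatever \<open>q\<close> kills is killed by
  \<open>g\<close>.\<close>

lemma mono_is_kernel_of_cokernel:
  assumes m: "is_mono A X Y m" and q: "is_cokernel A X Y m Q q"
  shows "is_kernel A Y Q q X m"
proof -
  obtain Z g where g: "is_kernel A Y Z g X m"
    using mono_is_kernel m by blast
  obtain t where t: "t \<in> Mor A Q Z" "t \<cdot> q = g"
    using is_cokernel_factor[OF q] is_kernelD[OF g] by blast
  show ?thesis
  proof (rule is_kernelI[OF _ m])
    fix V h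
    assume h: "h \<in> Mor A V Y" "q \<cdot> h = mzero A V Q"
    then have "g \<cdot> h = mzero A V Z"
      using t cmp_assoc[OF h(1) is_cokernelD(2)[OF q] t(1)] cmp_mzero[OF t(1)] Mor_Ob[OF h(1)] by simp
    then show "\<exists>u \<in> Mor A V X. m \<cdot> u = h"
      using is_kernel_factor[OF g h(1)] by blast
  qed (use is_cokernelD[OF q] in auto)
qed

text \<open>
  A morphism \<open>T \<rightarrow> X\<close> is treated as an element of \<open>X\<close> over \<open>T\<close>. Diagrams can be chased with such
  elements because preimages exist after passing to an epimorphism \<open>T' \<rightarrow> T\<close>.
\<close>

lemma epi_lift:
  assumes p: "is_epi A X Y p" and y: "y \<in> Mor A T Y"
  shows "\<exists>T' e x. is_epi A T' T e \<and> x \<in> Mor A T' X \<and> p \<cdot> x = y \<cdot> e"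
proof -
  have pM: "p \<in> Mor A X Y"
    using p by (rule is_epi_Mor)
  have Ob: "X \<in> Ob A" "Y \<in> Ob A" "T \<in> Ob A"
    using pM y Mor_Ob by auto
  obtain S i j a b where "is_biproduct A X T S i j a b"
    using ex_biproduct Ob by blast
  then have S: "i \<in> Mor A X S" "j \<in> Mor A T S" "a \<in> Mor A S X" "b \<in> Mor A S T"
    "a \<cdot> i = idm A X" "b \<cdot> j = idm A T" "b \<cdot> i = mzero A X T" "a \<cdot> j = mzero A T X"
    by (auto simp: is_biproduct_def)
  \<comment> \<open>\<open>m\<close> is the morphism (p, -y) from the biproduct of \<open>X\<close>
    and \<open>T\<close> to \<open>Y\<close>. Its kernel \<open>T'\<close> is the pullback of
    \<open>p\<close> and \<open>y\<close>, with projections \<open>a \<cdot> k\<close> and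
    \<open>b \<cdot> k\<close>.\<close>
  define n where "n = mneg A S Y (y \<cdot> b)"
  define m where "m = madd A (p \<cdot> a) n"
  have nM: "y \<cdot> b \<in> Mor A S Y" "p \<cdot> a \<in> Mor A S Y" "n \<in> Mor A S Y"
    unfolding n_def using S pM y by (auto intro: cmp_Mor mneg_Mor)
  have mM: "m \<in> Mor A S Y"
    unfolding m_def using nM by (auto intro: madd_Mor)
  have "n \<cdot> i = mzero A X Y"
    unfolding n_def using nM S y Ob by (simp add: mneg_cmp cmp_assoc[symmetric] cmp_mzero mneg_mzero)
  moreover have "p \<cdot> a \<cdot> i = p"
    using S pM by (simp add: cmp_assoc[symmetric] idm_right)
  ultimately have mi: "m \<cdot> i = p"
    unfolding m_def cmp_add_left[OF S(1) nM(2,3)] using pM by (simp add: madd_zero_right)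
  have m: "is_epi A S Y m"
    by (rule is_epi_rightI[OF mM S(1)]) (simp add: mi p)
  obtain T' k where k: "is_kernel A S Y m T' k"
    using ex_kernel mM by blast
  note kM = is_kernelD[OF k]
  have "madd A (p \<cdot> a \<cdot> k) (n \<cdot> k) = mzero A T' Y"
    using kM(3) unfolding m_def cmp_add_left[OF kM(2) nM(2,3)] .
  moreover have "n \<cdot> k = mneg A T' Y (y \<cdot> b \<cdot> k)"
    unfolding n_def by (rule mneg_cmp[OF kM(2) nM(1)])
  ultimately have "p \<cdot> a \<cdot> k = y \<cdot> b \<cdot> k"
    using eq_if_diff_mzero cmp_Mor[OF kM(2)] nM by metis
  then have eq: "p \<cdot> (a \<cdot> k) = y \<cdot> (b \<cdot> k)"
    using cmp_assoc kM(2) S pM y by simp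
  \<comment> \<open>Pulling back preserves epimorphisms: \<open>m\<close> is the cokernel of
    \<open>k\<close>, so a \<open>g\<close> killing \<open>b \<cdot> k\<close> satisfies
    \<open>g \<cdot> b = t \<cdot> m\<close>. Restricting to the summand \<open>X\<close> gives
    \<open>t \<cdot> p = 0\<close>, hence \<open>t = 0\<close>; restricting to the summand
    \<open>T\<close> then gives \<open>g = 0\<close>.\<close>
  have "is_epi A T' T (b \<cdot> k)"
  proof (rule is_epiI)
    show "b \<cdot> k \<in> Mor A T' T"
      using kM S by (auto intro: cmp_Mor)
    fix W g
    assume g: "g \<in> Mor A T W" and gbk: "g \<cdot> (b \<cdot> k) = mzero A T' W"
    have gb: "g \<cdot> b \<in> Mor A S W" "g \<cdot> b \<cdot> k = mzero A T' W"
      using g gbk S kM(2) by (auto simp: cmp_assoc intro: cmp_Mor)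
    obtain t where t: "t \<in> Mor A Y W" "t \<cdot> m = g \<cdot> b"
      using is_cokernel_factor[OF epi_is_cokernel_of_kernel[OF m k] gb] by blast
    have "t \<cdot> p = g \<cdot> b \<cdot> i"
      using t mi cmp_assoc[OF S(1) mM t(1)] by simp
    also have "\<dots> = mzero A X W"
      using g S Ob by (simp add: cmp_assoc[symmetric] cmp_mzero)
    finally have "t = mzero A Y W"
      using is_epi_mzeroD[OF p t(1)] by blast
    then have "g \<cdot> b = mzero A S W"
      using t mM g by (metis Mor_Ob mzero_cmp)
    moreover have "g = g \<cdot> b \<cdot> j"
      using g S by (simp add: cmp_assoc[symmetric] idm_right)
    ultimately show "g = mzero A T W"
      using S(2) g by (metis Mor_Ob mzero_cmp)
  qed
  then show ?thesis
    using eq cmp_Mor[OF kM(2) S(3)] by blast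
qed

text \<open>What the cokernel \<open>c\<close> of \<open>f\<close> kills lies in the kernel
  \<open>I\<close> of \<open>c\<close>, the image of \<open>f\<close>. The point is that the
  corestriction \<open>f0\<close> of \<open>f\<close> to \<open>I\<close> is epi; then
  \<open>epi_lift\<close> applies.\<close>

lemma image_lift:
  assumes c: "is_cokernel A X Y f Q c" and y: "y \<in> Mor A T Y" and cy: "c \<cdot> y = mzero A T Q"
  shows "\<exists>T' e x. is_epi A T' T e \<and> x \<in> Mor A T' X \<and> f \<cdot> x = y \<cdot> e"
proof -
  note cM = is_cokernelD[OF c]
  obtain I m where m: "is_kernel A Y Q c I m"
    using ex_kernel cM by blast
  note mM = is_kernelD[OF m] and m_mono = is_kernel_mono[OF m]
  obtain f0 where f0: "f0 \<in> Mor A X I" "m \<cdot> f0 = f"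
    using is_kernel_factor[OF m] cM by blast
  have Ob: "X \<in> Ob A" "Y \<in> Ob A" "I \<in> Ob A" "Q \<in> Ob A"
    using cM f0 Mor_Ob by auto
  have "is_epi A X I f0"
  proof (rule is_epiI[OF f0(1)])
    fix W g
    assume g: "g \<in> Mor A I W" and gf0: "g \<cdot> f0 = mzero A X W"
    \<comment> \<open>If \<open>g\<close> kills \<open>f0\<close>, then \<open>f\<close> factors
      through the subobject \<open>L\<close> of \<open>I\<close>. As a subobject of
      \<open>Y\<close>, \<open>L\<close> is the kernel of some \<open>r\<close>; this
      \<open>r\<close> kills \<open>f\<close>, so it factors through \<open>c\<close> and kills
      \<open>I\<close>. Hence \<open>L\<close> is all of \<open>I\<close>, and
      \<open>g = 0\<close>.\<close>
    obtain L k where k: "is_kernel A I W g L k"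
      using ex_kernel g by blast
    note kM = is_kernelD[OF k]
    obtain f1 where f1: "f1 \<in> Mor A X L" "k \<cdot> f1 = f0"
      using is_kernel_factor[OF k f0(1) gf0] by blast
    have mk: "m \<cdot> k \<in> Mor A L Y"
      using kM(2) mM(2) by (rule cmp_Mor)
    have "is_mono A L Y (m \<cdot> k)"
    proof (rule is_monoI[OF mk])
      fix V h
      assume h: "h \<in> Mor A V L" "m \<cdot> k \<cdot> h = mzero A V Y"
      then have "m \<cdot> (k \<cdot> h) = mzero A V Y"
        using cmp_assoc kM mM by simp
      then show "h = mzero A V L"
        using is_mono_mzeroD m_mono is_kernel_mono[OF k] h kM(2) cmp_Mor by meson
    qed
    then obtain R r where r: "is_kernel A Y R r L (m \<cdot> k)"
      using mono_is_kernel by blast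
    note rM = is_kernelD[OF r]
    have f_eq: "f = m \<cdot> k \<cdot> f1"
      using f0 f1 cmp_assoc[OF f1(1) kM(2) mM(2)] by simp
    have "r \<cdot> f = mzero A X R"
      unfolding f_eq using rM f1 mk Mor_Ob by (simp add: cmp_assoc mzero_cmp)
    then obtain s where s: "s \<in> Mor A Q R" "s \<cdot> c = r"
      using is_cokernel_factor[OF c rM(1)] by blast
    have "r \<cdot> m = mzero A I R"
      using s mM cmp_assoc[OF mM(2) cM(2) s(1)] cmp_mzero[OF s(1)] Ob by simp
    then obtain t where t: "t \<in> Mor A I L" "m \<cdot> k \<cdot> t = m"
      using is_kernel_factor[OF r mM(2)] by blast
    have kt: "k \<cdot> t = idm A I"
    proof (rule is_mono_cancel[OF m_mono])
      show "m \<cdot> (k \<cdot> t) = m \<cdot> idm A I"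
        using t kM mM cmp_assoc idm_right by simp
    qed (use t kM Ob in \<open>auto intro: cmp_Mor idm_Mor\<close>)
    have "g = g \<cdot> k \<cdot> t"
      using kt g kM(2) t(1) by (simp add: cmp_assoc[symmetric] idm_right)
    then show "g = mzero A I W"
      using kM(3) t(1) g by (metis Mor_Ob mzero_cmp)
  qed
  moreover obtain y0 where y0: "y0 \<in> Mor A T I" "m \<cdot> y0 = y"
    using is_kernel_factor[OF m y cy] by blast
  ultimately obtain T' e x where ex: "is_epi A T' T e" "x \<in> Mor A T' X" "f0 \<cdot> x = y0 \<cdot> e"
    using epi_lift by blast
  then have "f \<cdot> x = y \<cdot> e"
    using f0 y0 cmp_assoc[OF ex(2) f0(1) mM(2)] cmp_assoc[OF is_epi_Mor[OF ex(1)] y0(1) mM(2)] by simp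
  then show ?thesis
    using ex by blast
qed

text \<open>The cokernel map of an epimorphism is zero, so the monomorphism \<open>f\<close> is the
  kernel of a zero morphism, and the identity of \<open>Y\<close> factors through it.\<close>

lemma mono_epi_is_isomorphism:
  assumes m: "is_mono A X Y f" and e: "is_epi A X Y f"
  shows "is_isomorphism A X Y f"
proof -
  have f: "f \<in> Mor A X Y"
    using e by (rule is_epi_Mor)
  obtain Q q where q: "is_cokernel A X Y f Q q"
    using ex_cokernel f by blast
  have "q = mzero A Y Q"
    using is_epi_mzeroD[OF e] is_cokernelD[OF q] by blast
  then have "q \<cdot> idm A Y = mzero A Y Q"
    using is_cokernelD[OF q] by (simp add: idm_right)
  then obtain s where s: "s \<in> Mor A Y X" "f \<cdot> s = idm A Y"
    using is_kernel_factor[OF mono_is_kernel_of_cokernel[OF m q]] idm_Mor Mor_Ob[OF f] by blast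
  have "s \<cdot> f = idm A X"
  proof (rule is_mono_cancel[OF m])
    show "f \<cdot> (s \<cdot> f) = f \<cdot> idm A X"
      using cmp_assoc[OF f s(1) f] s f by (simp add: idm_left idm_right)
  qed (use s f Mor_Ob in \<open>auto intro: cmp_Mor idm_Mor\<close>)
  then show ?thesis
    unfolding is_isomorphism_def using f s by blast
qed

text \<open>Exactness is phrased by lifting elements after an epimorphism rather than by comparing
  an image with a kernel: this is the form in which chases both prove and consume it.\<close>

definition exact_at :: "'a \<Rightarrow> 'a \<Rightarrow> 'a \<Rightarrow> 'b \<Rightarrow> 'b \<Rightarrow> bool" where
  "exact_at X Y Z f g \<longleftrightarrow> f \<in> Mor A X Y \<and> g \<in> Mor A Y Z \<and> g \<cdot> f = mzero A X Z \<and>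
     (\<forall>T. \<forall>y \<in> Mor A T Y. g \<cdot> y = mzero A T Z \<longrightarrow>
        (\<exists>T' e x. is_epi A T' T e \<and> x \<in> Mor A T' X \<and> f \<cdot> x = y \<cdot> e))"

text \<open>By exactness \<open>L\<close> is the image of \<open>f\<close>: write
  \<open>f = l \<cdot> p\<close>; lifting the element \<open>l\<close> of \<open>Y\<close> along
  \<open>f\<close> shows that \<open>p\<close> is epi, and \<open>p\<close> has the same kernel as
  \<open>f\<close> because \<open>l\<close> is mono.\<close>

lemma exact_at_short_exact:
  assumes ex: "exact_at X Y Z f g" and k: "is_kernel A X Y f K k" and l: "is_kernel A Y Z g L l"
  shows "\<exists>p. short_exact A K X L k p"
proof -
  have f: "f \<in> Mor A X Y" "g \<cdot> f = mzero A X Z"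
    using ex unfolding exact_at_def by auto
  note kM = is_kernelD[OF k] and lM = is_kernelD[OF l]
  obtain p where p: "p \<in> Mor A X L" "l \<cdot> p = f"
    using is_kernel_factor[OF l f] by blast
  obtain T' e x where e: "is_epi A T' L e" "x \<in> Mor A T' X" "f \<cdot> x = l \<cdot> e"
    using ex lM(2,3) unfolding exact_at_def by blast
  have "p \<cdot> x = e"
    by (rule is_mono_cancel[OF is_kernel_mono[OF l]])
      (use e p lM cmp_assoc[OF e(2) p(1) lM(2)] in \<open>auto intro: cmp_Mor is_epi_Mor\<close>)
  then have epi: "is_epi A X L p"
    using is_epi_rightI[OF p(1) e(2)] e(1) by simp
  have "is_kernel A X L p K k"
  proof (rule is_kernelI[OF p(1) is_kernel_mono[OF k]])
    have "l \<cdot> (p \<cdot> k) = mzero A K Y"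
      using cmp_assoc[OF kM(2) p(1) lM(2)] p kM by simp
    then show "p \<cdot> k = mzero A K L"
      using is_mono_mzeroD[OF is_kernel_mono[OF l] cmp_Mor[OF kM(2) p(1)]] by blast
  next
    fix W h
    assume h: "h \<in> Mor A W X" "p \<cdot> h = mzero A W L"
    then have "f \<cdot> h = mzero A W Y"
      using cmp_assoc[OF h(1) p(1) lM(2)] h p cmp_mzero[OF lM(2)] Mor_Ob[OF h(1)] by simp
    then show "\<exists>u \<in> Mor A W K. k \<cdot> u = h"
      using is_kernel_factor[OF k h(1)] by blast
  qed
  then show ?thesis
    unfolding short_exact_def using epi_is_cokernel_of_kernel[OF epi] by blast
qed

end

section \<open>Cohomology\<close>

context preadditive_category
begin

lemma bounded_complex_Ob: "bounded_complex A X \<Longrightarrow> cob X n \<in> Ob A"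
  unfolding bounded_complex_def using Mor_Ob by blast

text \<open>Index arithmetic such as \<open>n - 1 + 1\<close> is normalized here once, since later
  steps match degrees syntactically.\<close>

lemma bounded_complex_cdiff:
  assumes "bounded_complex A X"
  shows "cdiff X n \<in> Mor A (cob X n) (cob X (n + 1))"
    and "cdiff X (n - 1) \<in> Mor A (cob X (n - 1)) (cob X n)"
    and "cdiff X n \<cdot> cdiff X (n - 1) = mzero A (cob X (n - 1)) (cob X (n + 1))"
proof -
  have *: "cdiff X n \<in> Mor A (cob X n) (cob X (n + 1))"
    "cdiff X (n + 1) \<cdot> cdiff X n = mzero A (cob X n) (cob X (n + 2))" for n
    using assms by (auto simp: bounded_complex_def)
  show "cdiff X n \<in> Mor A (cob X n) (cob X (n + 1))"
    by (rule *)
  show "cdiff X (n - 1) \<in> Mor A (cob X (n - 1)) (cob X n)"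
    using *(1)[of "n - 1"] by simp
  have "n - 1 + 2 = n + 1"
    by simp
  then show "cdiff X n \<cdot> cdiff X (n - 1) = mzero A (cob X (n - 1)) (cob X (n + 1))"
    using *(2)[of "n - 1"] by (simp only: diff_add_cancel)
qed

lemma chain_mapD:
  assumes "chain_map A X Y f"
  shows "f n \<in> Mor A (cob X n) (cob Y n)"
    and "f (n + 1) \<cdot> cdiff X n = cdiff Y n \<cdot> f n"
    and "f n \<cdot> cdiff X (n - 1) = cdiff Y (n - 1) \<cdot> f (n - 1)"
proof -
  have *: "f n \<in> Mor A (cob X n) (cob Y n)" "f (n + 1) \<cdot> cdiff X n = cdiff Y n \<cdot> f n" for n
    using assms by (auto simp: chain_map_def)
  show "f n \<in> Mor A (cob X n) (cob Y n)" "f (n + 1) \<cdot> cdiff X n = cdiff Y n \<cdot> f n"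
    by (rule *)+
  show "f n \<cdot> cdiff X (n - 1) = cdiff Y (n - 1) \<cdot> f (n - 1)"
    using *(2)[of "n - 1"] by simp
qed

lemma bounded_complexes_simps:
  "Ob (bounded_complexes A) = {X. bounded_complex A X}"
  "f \<in> Mor (bounded_complexes A) X Y \<longleftrightarrow> bounded_complex A X \<and> bounded_complex A Y \<and> chain_map A X Y f"
  "idm (bounded_complexes A) X = (\<lambda>n. idm A (cob X n))"
  "g \<cdot>\<^bsub>bounded_complexes A\<^esub> f = (\<lambda>n. g n \<cdot> f n)"
  by (simp_all add: bounded_complexes_def)

lemma bounded_complexes_category: "category (bounded_complexes A)"
  using category_bounded_complexes preadditive_category_axioms by blast

lemma chain_map_idm: "bounded_complex A X \<Longrightarrow> chain_map A X X (\<lambda>n. idm A (cob X n))"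
  using category.idm_Mor[OF bounded_complexes_category, of X] by (simp add: bounded_complexes_simps)

end

section \<open>Cohomology through classes of generalized cocycles\<close>

definition cocycle ::
  "('o, 'm, 'x) preadditive_scheme \<Rightarrow> ('o, 'm) cochain_complex \<Rightarrow> int \<Rightarrow> 'o \<Rightarrow> 'm \<Rightarrow> bool" where
  "cocycle A X n T x \<longleftrightarrow> x \<in> Mor A T (cob X n) \<and> cdiff X n \<cdot>\<^bsub>A\<^esub> x = mzero A T (cob X (n + 1))"

text \<open>The projection from cocycles to cohomology, applied to an element over \<open>T\<close>.
  The definite description picks the lift of \<open>x\<close> to the chosen kernel, which exists and
  is unique when \<open>x\<close> is a cocycle.\<close>

definition cohomology_class ::
  "('o, 'm, 'x) preadditive_scheme \<Rightarrow> ('o, 'm) cochain_complex \<Rightarrow> int \<Rightarrow> 'o \<Rightarrow> 'm \<Rightarrow> 'm" where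
  "cohomology_class A X n T x = (case cohomology A X n of (K, k, H, c) \<Rightarrow>
     c \<cdot>\<^bsub>A\<^esub> (THE u. u \<in> Mor A T K \<and> k \<cdot>\<^bsub>A\<^esub> u = x))"

context abelian_category
begin

text \<open>Kernels and cokernels exist, so the choice operator in \<open>cohomology\<close> meets
  its specification. The last fact replaces the description hidden in
  \<open>cohomology_class\<close> by \<open>c \<cdot> u\<close>, which is what the chases compute
  with.\<close>

lemma cohomology_data:
  assumes X: "bounded_complex A X"
  obtains K k c e where
    "is_kernel A (cob X n) (cob X (n + 1)) (cdiff X n) K k"
    "e \<in> Mor A (cob X (n - 1)) K" "k \<cdot> e = cdiff X (n - 1)"
    "is_cokernel A (cob X (n - 1)) K e (cohomology_ob A X n) c"
    "cohomology A X n = (K, k, cohomology_ob A X n, c)"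
    "\<And>T u. u \<in> Mor A T K \<Longrightarrow> cohomology_class A X n T (k \<cdot> u) = c \<cdot> u"
proof -
  note d = bounded_complex_cdiff[OF X]
  have "\<exists>D. is_cohomology A X n D"
  proof -
    obtain K k where k: "is_kernel A (cob X n) (cob X (n + 1)) (cdiff X n) K k"
      using ex_kernel d(1) by blast
    obtain e where e: "e \<in> Mor A (cob X (n - 1)) K" "k \<cdot> e = cdiff X (n - 1)"
      using is_kernel_factor[OF k d(2,3)] by blast
    obtain H c where "is_cokernel A (cob X (n - 1)) K e H c"
      using ex_cokernel e(1) by blast
    then have "is_cohomology A X n (K, k, H, c)"
      using k e by (auto simp: is_cohomology_def)
    then show ?thesis
      by blast
  qed
  then have "is_cohomology A X n (cohomology A X n)"
    unfolding cohomology_def by (rule someI_ex)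
  moreover obtain K k H c where D: "cohomology A X n = (K, k, H, c)"
    by (cases "cohomology A X n")
  moreover have H: "cohomology_ob A X n = H"
    by (simp add: cohomology_ob_def D)
  ultimately obtain e where *: "is_kernel A (cob X n) (cob X (n + 1)) (cdiff X n) K k"
    "e \<in> Mor A (cob X (n - 1)) K" "k \<cdot> e = cdiff X (n - 1)"
    "is_cokernel A (cob X (n - 1)) K e (cohomology_ob A X n) c"
    by (auto simp: is_cohomology_def)
  moreover have "cohomology_class A X n T (k \<cdot> u) = c \<cdot> u" if u: "u \<in> Mor A T K" for T u
  proof -
    have "(THE u'. u' \<in> Mor A T K \<and> k \<cdot> u' = k \<cdot> u) = u"
      using u is_mono_cancel[OF is_kernel_mono[OF *(1)]] by blast
    then show ?thesis
      by (simp add: cohomology_class_def D)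
  qed
  ultimately show thesis
    using that D H by blast
qed

lemma cocycle_lift:
  "is_kernel A (cob X n) (cob X (n + 1)) (cdiff X n) K k \<Longrightarrow> cocycle A X n T x \<Longrightarrow>
    \<exists>u \<in> Mor A T K. k \<cdot> u = x"
  unfolding cocycle_def using is_kernel_factor by blast

lemma cocycleI:
  "x \<in> Mor A T (cob X n) \<Longrightarrow> cdiff X n \<cdot> x = mzero A T (cob X (n + 1)) \<Longrightarrow> cocycle A X n T x"
  by (simp add: cocycle_def)

lemma cohomology_ob_Ob:
  assumes "bounded_complex A X"
  shows "cohomology_ob A X n \<in> Ob A"
  by (rule cohomology_data[OF assms, of n]) (use is_cokernelD(2) Mor_Ob in blast)

lemma cohomology_class_Mor:
  assumes X: "bounded_complex A X" and x: "cocycle A X n T x"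
  shows "cohomology_class A X n T x \<in> Mor A T (cohomology_ob A X n)"
proof (rule cohomology_data[OF X, of n])
  fix K k c e
  assume k: "is_kernel A (cob X n) (cob X (n + 1)) (cdiff X n) K k"
    and c: "is_cokernel A (cob X (n - 1)) K e (cohomology_ob A X n) c"
    and cl: "\<And>T u. u \<in> Mor A T K \<Longrightarrow> cohomology_class A X n T (k \<cdot> u) = c \<cdot> u"
  obtain u where "u \<in> Mor A T K" "k \<cdot> u = x"
    using cocycle_lift[OF k x] by blast
  then show ?thesis
    using cl is_cokernelD(2)[OF c] cmp_Mor by metis
qed

lemma cocycle_cmp:
  assumes X: "bounded_complex A X" and x: "cocycle A X n T x" and t: "t \<in> Mor A T' T"
  shows "cocycle A X n T' (x \<cdot> t)"
proof (rule cocycleI)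
  have x': "x \<in> Mor A T (cob X n)" "cdiff X n \<cdot> x = mzero A T (cob X (n + 1))"
    using x by (auto simp: cocycle_def)
  then show "x \<cdot> t \<in> Mor A T' (cob X n)"
    using t by (auto intro: cmp_Mor)
  show "cdiff X n \<cdot> (x \<cdot> t) = mzero A T' (cob X (n + 1))"
    using cmp_assoc[OF t x'(1) bounded_complex_cdiff(1)[OF X]] x' t bounded_complex_Ob[OF X]
    by (simp add: mzero_cmp)
qed

lemma cohomology_class_cmp:
  assumes X: "bounded_complex A X" and x: "cocycle A X n T x" and t: "t \<in> Mor A T' T"
  shows "cohomology_class A X n T' (x \<cdot> t) = cohomology_class A X n T x \<cdot> t"
proof (rule cohomology_data[OF X, of n])
  fix K k c e
  assume k: "is_kernel A (cob X n) (cob X (n + 1)) (cdiff X n) K k"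
    and c: "is_cokernel A (cob X (n - 1)) K e (cohomology_ob A X n) c"
    and cl: "\<And>T u. u \<in> Mor A T K \<Longrightarrow> cohomology_class A X n T (k \<cdot> u) = c \<cdot> u"
  obtain u where u: "u \<in> Mor A T K" "k \<cdot> u = x"
    using cocycle_lift[OF k x] by blast
  have "x \<cdot> t = k \<cdot> (u \<cdot> t)"
    using u cmp_assoc[OF t u(1) is_kernelD(2)[OF k]] by simp
  then have "cohomology_class A X n T' (x \<cdot> t) = c \<cdot> (u \<cdot> t)"
    using cl[OF cmp_Mor[OF t u(1)]] by simp
  moreover have "cohomology_class A X n T x = c \<cdot> u"
    using cl[OF u(1)] u(2) by simp
  ultimately show ?thesis
    using cmp_assoc[OF t u(1) is_cokernelD(2)[OF c]] by simp
qed

lemma cohomology_class_add: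
  assumes X: "bounded_complex A X" and x: "cocycle A X n T x" and y: "cocycle A X n T y"
  shows "cohomology_class A X n T (madd A x y) =
    madd A (cohomology_class A X n T x) (cohomology_class A X n T y)"
proof (rule cohomology_data[OF X, of n])
  fix K k c e
  assume k: "is_kernel A (cob X n) (cob X (n + 1)) (cdiff X n) K k"
    and c: "is_cokernel A (cob X (n - 1)) K e (cohomology_ob A X n) c"
    and cl: "\<And>T u. u \<in> Mor A T K \<Longrightarrow> cohomology_class A X n T (k \<cdot> u) = c \<cdot> u"
  obtain u v where uv: "u \<in> Mor A T K" "k \<cdot> u = x" "v \<in> Mor A T K" "k \<cdot> v = y"
    using cocycle_lift[OF k] x y by metis
  have "madd A x y = k \<cdot> madd A u v"
    using uv cmp_add_right[OF uv(1,3) is_kernelD(2)[OF k]] by simp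
  then have "cohomology_class A X n T (madd A x y) = c \<cdot> madd A u v"
    using cl[OF madd_Mor[OF uv(1,3)]] by simp
  moreover have "cohomology_class A X n T x = c \<cdot> u" "cohomology_class A X n T y = c \<cdot> v"
    using cl[OF uv(1)] cl[OF uv(3)] uv by auto
  ultimately show ?thesis
    using cmp_add_right[OF uv(1,3) is_cokernelD(2)[OF c]] by simp
qed

lemma cocycle_boundary:
  assumes X: "bounded_complex A X" and y: "y \<in> Mor A T (cob X (n - 1))"
  shows "cocycle A X n T (cdiff X (n - 1) \<cdot> y)"
proof (rule cocycleI)
  note d = bounded_complex_cdiff[OF X]
  show "cdiff X (n - 1) \<cdot> y \<in> Mor A T (cob X n)"
    using y d(2) by (rule cmp_Mor)
  show "cdiff X n \<cdot> (cdiff X (n - 1) \<cdot> y) = mzero A T (cob X (n + 1))"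
    using cmp_assoc[OF y d(2) d(1)] d(3) y bounded_complex_Ob[OF X] by (simp add: mzero_cmp)
qed

lemma cohomology_class_boundary:
  assumes X: "bounded_complex A X" and y: "y \<in> Mor A T (cob X (n - 1))"
  shows "cohomology_class A X n T (cdiff X (n - 1) \<cdot> y) = mzero A T (cohomology_ob A X n)"
proof (rule cohomology_data[OF X, of n])
  fix K k c e
  assume k: "is_kernel A (cob X n) (cob X (n + 1)) (cdiff X n) K k"
    and e: "e \<in> Mor A (cob X (n - 1)) K" "k \<cdot> e = cdiff X (n - 1)"
    and c: "is_cokernel A (cob X (n - 1)) K e (cohomology_ob A X n) c"
    and cl: "\<And>T u. u \<in> Mor A T K \<Longrightarrow> cohomology_class A X n T (k \<cdot> u) = c \<cdot> u"
  note kM = is_kernelD[OF k] and cM = is_cokernelD[OF c]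
  have "cdiff X (n - 1) \<cdot> y = k \<cdot> (e \<cdot> y)"
    using cmp_assoc[OF y e(1) kM(2)] e by simp
  then have "cohomology_class A X n T (cdiff X (n - 1) \<cdot> y) = c \<cdot> (e \<cdot> y)"
    using cl[OF cmp_Mor[OF y e(1)]] by simp
  then show ?thesis
    using cmp_assoc[OF y e(1) cM(2)] cM(3) y cohomology_ob_Ob[OF X] by (simp add: mzero_cmp)
qed

text \<open>A cocycle of class zero lifts to an element of the kernel \<open>K\<close> that the
  cokernel \<open>c\<close> kills; \<open>image_lift\<close> turns it into a boundary, though only
  after an epimorphism.\<close>

lemma cohomology_class_zeroD:
  assumes X: "bounded_complex A X" and x: "cocycle A X n T x"
    and zero: "cohomology_class A X n T x = mzero A T (cohomology_ob A X n)"
  shows "\<exists>T' t y. is_epi A T' T t \<and> y \<in> Mor A T' (cob X (n - 1)) \<and> cdiff X (n - 1) \<cdot> y = x \<cdot> t"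
proof (rule cohomology_data[OF X, of n])
  fix K k c e
  assume k: "is_kernel A (cob X n) (cob X (n + 1)) (cdiff X n) K k"
    and e: "e \<in> Mor A (cob X (n - 1)) K" "k \<cdot> e = cdiff X (n - 1)"
    and c: "is_cokernel A (cob X (n - 1)) K e (cohomology_ob A X n) c"
    and cl: "\<And>T u. u \<in> Mor A T K \<Longrightarrow> cohomology_class A X n T (k \<cdot> u) = c \<cdot> u"
  note kM = is_kernelD[OF k] and cM = is_cokernelD[OF c]
  obtain u where u: "u \<in> Mor A T K" "k \<cdot> u = x"
    using cocycle_lift[OF k x] by blast
  have "c \<cdot> u = mzero A T (cohomology_ob A X n)"
    using cl[OF u(1)] u(2) zero by simp
  then obtain T' t y where t: "is_epi A T' T t" "y \<in> Mor A T' (cob X (n - 1))" "e \<cdot> y = u \<cdot> t"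
    using image_lift[OF c u(1)] by blast
  have "cdiff X (n - 1) \<cdot> y = x \<cdot> t"
    using cmp_assoc[OF t(2) e(1) kM(2)] cmp_assoc[OF is_epi_Mor[OF t(1)] u(1) kM(2)] t e u by simp
  then show ?thesis
    using t by blast
qed

lemma cohomology_class_surj:
  assumes X: "bounded_complex A X" and h: "h \<in> Mor A T (cohomology_ob A X n)"
  shows "\<exists>T' t x. is_epi A T' T t \<and> cocycle A X n T' x \<and> cohomology_class A X n T' x = h \<cdot> t"
proof (rule cohomology_data[OF X, of n])
  fix K k c e
  assume k: "is_kernel A (cob X n) (cob X (n + 1)) (cdiff X n) K k"
    and c: "is_cokernel A (cob X (n - 1)) K e (cohomology_ob A X n) c"
    and cl: "\<And>T u. u \<in> Mor A T K \<Longrightarrow> cohomology_class A X n T (k \<cdot> u) = c \<cdot> u"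
  note kM = is_kernelD[OF k] and cM = is_cokernelD[OF c]
  obtain T' t u where t: "is_epi A T' T t" "u \<in> Mor A T' K" "c \<cdot> u = h \<cdot> t"
    using epi_lift[OF is_cokernel_epi[OF c] h] by blast
  have "cocycle A X n T' (k \<cdot> u)"
  proof (rule cocycleI)
    show "k \<cdot> u \<in> Mor A T' (cob X n)"
      using t(2) kM(2) by (rule cmp_Mor)
    show "cdiff X n \<cdot> (k \<cdot> u) = mzero A T' (cob X (n + 1))"
      using cmp_assoc[OF t(2) kM(2,1)] kM(3) t(2) bounded_complex_Ob[OF X] by (simp add: mzero_cmp)
  qed
  then show ?thesis
    using t cl by metis
qed

text \<open>Lifting the identity of the cohomology object gives a cocycle whose class is an
  epimorphism, so morphisms out of cohomology are determined by their values on classes.\<close>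

lemma cohomology_map_ext:
  assumes X: "bounded_complex A X"
    and h: "h \<in> Mor A (cohomology_ob A X n) Y" "h' \<in> Mor A (cohomology_ob A X n) Y"
    and eq: "\<And>T x. cocycle A X n T x \<Longrightarrow>
      h \<cdot> cohomology_class A X n T x = h' \<cdot> cohomology_class A X n T x"
  shows "h = h'"
proof -
  have id: "idm A (cohomology_ob A X n) \<in> Mor A (cohomology_ob A X n) (cohomology_ob A X n)"
    using cohomology_ob_Ob[OF X] by (rule idm_Mor)
  obtain T' t x where t: "is_epi A T' (cohomology_ob A X n) t" "cocycle A X n T' x"
    "cohomology_class A X n T' x = idm A (cohomology_ob A X n) \<cdot> t"
    using cohomology_class_surj[OF X id] by blast
  then have "h \<cdot> t = h' \<cdot> t"
    using eq[OF t(2)] idm_left[OF is_epi_Mor[OF t(1)]] by simp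
  then show ?thesis
    using is_epi_cancel[OF t(1) h] by blast
qed

lemma cocycle_chain_map:
  assumes X: "bounded_complex A X" and Y: "bounded_complex A Y" and f: "chain_map A X Y f"
    and x: "cocycle A X n T x"
  shows "cocycle A Y n T (f n \<cdot> x)"
proof (rule cocycleI)
  note fM = chain_mapD[OF f]
  have x': "x \<in> Mor A T (cob X n)" "cdiff X n \<cdot> x = mzero A T (cob X (n + 1))"
    using x by (auto simp: cocycle_def)
  show "f n \<cdot> x \<in> Mor A T (cob Y n)"
    using x'(1) fM(1) by (rule cmp_Mor)
  have "cdiff Y n \<cdot> (f n \<cdot> x) = f (n + 1) \<cdot> (cdiff X n \<cdot> x)"
    using cmp_assoc[OF x'(1) fM(1) bounded_complex_cdiff(1)[OF Y]]
      cmp_assoc[OF x'(1) bounded_complex_cdiff(1)[OF X] fM(1)] fM(2) by simp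
  then show "cdiff Y n \<cdot> (f n \<cdot> x) = mzero A T (cob Y (n + 1))"
    using x'(2) fM(1) Mor_Ob[OF x'(1)] by (simp add: cmp_mzero)
qed

text \<open>The second fact is the working description of the induced map: on classes it is
  composition with \<open>f n\<close>.\<close>

lemma cohomology_map:
  assumes X: "bounded_complex A X" and Y: "bounded_complex A Y" and f: "chain_map A X Y f"
  shows "cohomology_map A X Y f n \<in> Mor A (cohomology_ob A X n) (cohomology_ob A Y n)" (is ?Mor)
    and "cocycle A X n T x \<Longrightarrow> cohomology_map A X Y f n \<cdot> cohomology_class A X n T x =
      cohomology_class A Y n T (f n \<cdot> x)"
proof -
  note fM = chain_mapD[OF f] and dX = bounded_complex_cdiff[OF X] and dY = bounded_complex_cdiff[OF Y]
  have "?Mor \<and> (\<forall>T x. cocycle A X n T x \<longrightarrow> cohomology_map A X Y f n \<cdot> cohomology_class A X n T x =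
      cohomology_class A Y n T (f n \<cdot> x))"
  proof (rule cohomology_data[OF X, of n], rule cohomology_data[OF Y, of n])
    fix K k c e K' k' c' e'
    assume k: "is_kernel A (cob X n) (cob X (n + 1)) (cdiff X n) K k"
      and e: "e \<in> Mor A (cob X (n - 1)) K" "k \<cdot> e = cdiff X (n - 1)"
      and c: "is_cokernel A (cob X (n - 1)) K e (cohomology_ob A X n) c"
      and D: "cohomology A X n = (K, k, cohomology_ob A X n, c)"
      and cl: "\<And>T u. u \<in> Mor A T K \<Longrightarrow> cohomology_class A X n T (k \<cdot> u) = c \<cdot> u"
      and k': "is_kernel A (cob Y n) (cob Y (n + 1)) (cdiff Y n) K' k'"
      and e': "e' \<in> Mor A (cob Y (n - 1)) K'" "k' \<cdot> e' = cdiff Y (n - 1)"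
      and c': "is_cokernel A (cob Y (n - 1)) K' e' (cohomology_ob A Y n) c'"
      and D': "cohomology A Y n = (K', k', cohomology_ob A Y n, c')"
      and cl': "\<And>T u. u \<in> Mor A T K' \<Longrightarrow> cohomology_class A Y n T (k' \<cdot> u) = c' \<cdot> u"
    note kM = is_kernelD[OF k] and cM = is_cokernelD[OF c]
      and kM' = is_kernelD[OF k'] and cM' = is_cokernelD[OF c']
    have "cocycle A X n K k"
      using kM by (simp add: cocycle_def)
    then obtain z where z: "z \<in> Mor A K K'" "k' \<cdot> z = f n \<cdot> k"
      using cocycle_lift[OF k' cocycle_chain_map[OF X Y f]] by blast
    \<comment> \<open>\<open>z\<close> carries the boundary map of \<open>X\<close> to that of
      \<open>Y\<close>, so \<open>c' \<cdot> z\<close> descends to the cokernel that defines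
      cohomology.\<close>
    have ze: "z \<cdot> e = e' \<cdot> f (n - 1)"
    proof (rule is_mono_cancel[OF is_kernel_mono[OF k']])
      show "z \<cdot> e \<in> Mor A (cob X (n - 1)) K'" "e' \<cdot> f (n - 1) \<in> Mor A (cob X (n - 1)) K'"
        using z e e' fM(1) by (auto intro: cmp_Mor)
      have "k' \<cdot> (z \<cdot> e) = f n \<cdot> cdiff X (n - 1)"
        using cmp_assoc[OF e(1) z(1) kM'(2)] cmp_assoc[OF e(1) kM(2) fM(1)] z e by simp
      moreover have "k' \<cdot> (e' \<cdot> f (n - 1)) = cdiff Y (n - 1) \<cdot> f (n - 1)"
        using cmp_assoc[OF fM(1) e'(1) kM'(2)] e' by simp
      ultimately show "k' \<cdot> (z \<cdot> e) = k' \<cdot> (e' \<cdot> f (n - 1))"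
        using fM(3) by simp
    qed
    have c'z: "c' \<cdot> z \<in> Mor A K (cohomology_ob A Y n)"
      using z(1) cM'(2) by (rule cmp_Mor)
    have "c' \<cdot> z \<cdot> e = c' \<cdot> e' \<cdot> f (n - 1)"
      using cmp_assoc[OF e(1) z(1) cM'(2)] cmp_assoc[OF fM(1) e'(1) cM'(2)] ze by simp
    then have "c' \<cdot> z \<cdot> e = mzero A (cob X (n - 1)) (cohomology_ob A Y n)"
      using cM'(3) mzero_cmp[OF fM(1)] cohomology_ob_Ob[OF Y] by simp
    then obtain h where h: "h \<in> Mor A (cohomology_ob A X n) (cohomology_ob A Y n)" "h \<cdot> c = c' \<cdot> z"
      using is_cokernel_factor[OF c c'z] by blast
    \<comment> \<open>The description is unambiguous: \<open>z\<close> is unique because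
      \<open>k'\<close> is mono, and then \<open>h\<close> is unique because \<open>c\<close> is
      epi.\<close>
    have hmap: "cohomology_map A X Y f n = h"
      unfolding cohomology_map_def D D' prod.case
    proof (rule the_equality)
      show "h \<in> Mor A (cohomology_ob A X n) (cohomology_ob A Y n) \<and>
        (\<exists>z \<in> Mor A K K'. k' \<cdot> z = f n \<cdot> k \<and> h \<cdot> c = c' \<cdot> z)"
        using h z by blast
      fix g
      assume g: "g \<in> Mor A (cohomology_ob A X n) (cohomology_ob A Y n) \<and>
        (\<exists>z \<in> Mor A K K'. k' \<cdot> z = f n \<cdot> k \<and> g \<cdot> c = c' \<cdot> z)"
      then obtain z' where z': "z' \<in> Mor A K K'" "k' \<cdot> z' = f n \<cdot> k" "g \<cdot> c = c' \<cdot> z'"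
        by blast
      have "z' = z"
        by (rule is_mono_cancel[OF is_kernel_mono[OF k']]) (use z z' in auto)
      then show "g = h"
        using is_epi_cancel[OF is_cokernel_epi[OF c]] g h z' by metis
    qed
    show ?thesis
      unfolding hmap
    proof (intro conjI allI impI h(1))
      fix T x
      assume x: "cocycle A X n T x"
      obtain u where u: "u \<in> Mor A T K" "k \<cdot> u = x"
        using cocycle_lift[OF k x] by blast
      have "f n \<cdot> x = k' \<cdot> (z \<cdot> u)"
        using cmp_assoc[OF u(1) kM(2) fM(1)] cmp_assoc[OF u(1) z(1) kM'(2)] u z by simp
      then have "cohomology_class A Y n T (f n \<cdot> x) = c' \<cdot> (z \<cdot> u)"
        using cl'[OF cmp_Mor[OF u(1) z(1)]] by simp
      moreover have "h \<cdot> cohomology_class A X n T x = h \<cdot> (c \<cdot> u)"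
        using cl[OF u(1)] u by simp
      ultimately show "h \<cdot> cohomology_class A X n T x = cohomology_class A Y n T (f n \<cdot> x)"
        using cmp_assoc[OF u(1) cM(2) h(1)] cmp_assoc[OF u(1) z(1) cM'(2)] h(2) by simp
    qed
  qed
  then show ?Mor "cocycle A X n T x \<Longrightarrow> cohomology_map A X Y f n \<cdot> cohomology_class A X n T x =
      cohomology_class A Y n T (f n \<cdot> x)"
    by blast+
qed

lemma is_functor_cohomology:
  "is_functor (bounded_complexes A) A (\<lambda>X. cohomology_ob A X n) (\<lambda>X Y f. cohomology_map A X Y f n)"
  unfolding is_functor_def bounded_complexes_simps
proof (intro conjI allI ballI; (elim CollectE conjE)?)
  fix X
  assume X: "bounded_complex A X"
  note id = chain_map_idm[OF X] and Ob = cohomology_ob_Ob[OF X]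
  show "cohomology_ob A X n \<in> Ob A"
    by (rule Ob)
  show "cohomology_map A X X (\<lambda>n. idm A (cob X n)) n = idm A (cohomology_ob A X n)"
  proof (rule cohomology_map_ext[OF X cohomology_map(1)[OF X X id] idm_Mor[OF Ob]])
    fix T x
    assume x: "cocycle A X n T x"
    then have "idm A (cob X n) \<cdot> x = x"
      unfolding cocycle_def using idm_left by blast
    then show "cohomology_map A X X (\<lambda>n. idm A (cob X n)) n \<cdot> cohomology_class A X n T x =
        idm A (cohomology_ob A X n) \<cdot> cohomology_class A X n T x"
      using cohomology_map(2)[OF X X id x] idm_left[OF cohomology_class_Mor[OF X x]] by simp
  qed
next
  fix X Y f
  assume "f \<in> Mor (bounded_complexes A) X Y"
  then show "cohomology_map A X Y f n \<in> Mor A (cohomology_ob A X n) (cohomology_ob A Y n)"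
    using cohomology_map(1) by (simp add: bounded_complexes_simps)
next
  fix X Y Z f g
  assume fg: "f \<in> Mor (bounded_complexes A) X Y" "g \<in> Mor (bounded_complexes A) Y Z"
  then have X: "bounded_complex A X" and Y: "bounded_complex A Y" and Z: "bounded_complex A Z"
    and f: "chain_map A X Y f" and g: "chain_map A Y Z g"
    by (auto simp: bounded_complexes_simps)
  have gf: "chain_map A X Z (\<lambda>n. g n \<cdot> f n)"
    using category.cmp_Mor[OF bounded_complexes_category fg] by (simp add: bounded_complexes_simps)
  note F = cohomology_map[OF X Y f, of n] and G = cohomology_map[OF Y Z g, of n]
    and GF = cohomology_map[OF X Z gf, of n]
  show "cohomology_map A X Z (\<lambda>n. g n \<cdot> f n) n = cohomology_map A Y Z g n \<cdot> cohomology_map A X Y f n"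
  proof (rule cohomology_map_ext[OF X GF(1) cmp_Mor[OF F(1) G(1)]])
    fix T x
    assume x: "cocycle A X n T x"
    then have "x \<in> Mor A T (cob X n)"
      by (simp add: cocycle_def)
    then have "g n \<cdot> f n \<cdot> x = g n \<cdot> (f n \<cdot> x)"
      using cmp_assoc chain_mapD(1)[OF f] chain_mapD(1)[OF g] by metis
    then show "cohomology_map A X Z (\<lambda>n. g n \<cdot> f n) n \<cdot> cohomology_class A X n T x =
        cohomology_map A Y Z g n \<cdot> cohomology_map A X Y f n \<cdot> cohomology_class A X n T x"
      using GF(2)[OF x] F(2)[OF x] G(2)[OF cocycle_chain_map[OF X Y f x]]
        cmp_assoc[OF cohomology_class_Mor[OF X x] F(1) G(1)] by simp
  qed
qed

text \<open>Cohomology inverts quasi-isomorphisms by their very definition, so it extends to a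
  functor on the localization, and functors preserve isomorphisms.\<close>

lemma derived_isomorphic_cohomology:
  assumes "isomorphic (derived_category A) X Y"
  shows "isomorphic A (cohomology_ob A X n) (cohomology_ob A Y n)"
proof -
  let ?D = "derived_category A" and ?H = "\<lambda>X. cohomology_ob A X n"
  have "\<exists>\<psi>. is_functor ?D A ?H \<psi>"
    using cat_localization_universal[OF bounded_complexes_category category_axioms
        is_functor_cohomology[of n], of "quasi_isomorphism A"]
    unfolding derived_category_def quasi_isomorphism_def by blast
  then obtain \<psi> where \<psi>: "is_functor ?D A ?H \<psi>"
    by blast
  obtain f g where fg: "f \<in> Mor ?D X Y" "g \<in> Mor ?D Y X"
    "g \<cdot>\<^bsub>?D\<^esub> f = idm ?D X" "f \<cdot>\<^bsub>?D\<^esub> g = idm ?D Y"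
    using assms unfolding isomorphic_def is_isomorphism_def by blast
  have "category ?D"
    unfolding derived_category_def by (rule category_cat_localization[OF bounded_complexes_category])
  then have Ob: "X \<in> Ob ?D" "Y \<in> Ob ?D"
    using category.Mor_Ob fg(1) by metis+
  have cmp: "\<psi> X Z (g \<cdot>\<^bsub>?D\<^esub> f) = \<psi> Y Z g \<cdot> \<psi> X Y f"
    if "f \<in> Mor ?D X Y" "g \<in> Mor ?D Y Z" for X Y Z f g
    using \<psi> that unfolding is_functor_def by blast
  have id: "\<psi> X X (idm ?D X) = idm A (?H X)" if "X \<in> Ob ?D" for X
    using \<psi> that unfolding is_functor_def by blast
  have "\<psi> X Y f \<in> Mor A (?H X) (?H Y)" "\<psi> Y X g \<in> Mor A (?H Y) (?H X)"
    using \<psi> fg unfolding is_functor_def by blast+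
  moreover have "\<psi> Y X g \<cdot> \<psi> X Y f = idm A (?H X)" "\<psi> X Y f \<cdot> \<psi> Y X g = idm A (?H Y)"
    using cmp[OF fg(1,2)] cmp[OF fg(2,1)] id Ob fg(3,4) by simp_all
  ultimately show ?thesis
    unfolding isomorphic_def is_isomorphism_def by blast
qed

end

section \<open>Mapping cones\<close>

context preadditive_category
begin

lemma mneg_eq_mzero_iff:
  "f \<in> Mor A X Y \<Longrightarrow> mneg A X Y f = mzero A X Y \<longleftrightarrow> f = mzero A X Y"
  using mneg_mneg mneg_mzero Mor_Ob by metis

text \<open>A morphism and its negative annihilate the same elements; this fact and its dual make
  the signs in \<open>shift\<close> invisible to cohomology.\<close>

lemma is_kernel_mneg:
  assumes f: "f \<in> Mor A X Y"
  shows "is_kernel A X Y (mneg A X Y f) K k \<longleftrightarrow> is_kernel A X Y f K k"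
proof -
  have "mneg A X Y f \<cdot> h = mzero A W Y \<longleftrightarrow> f \<cdot> h = mzero A W Y" if "h \<in> Mor A W X" for W h
    using that f by (simp add: mneg_cmp mneg_eq_mzero_iff cmp_Mor)
  then show ?thesis
    by (simp add: is_kernel_def f mneg_Mor[OF f] cong: ball_cong conj_cong)
qed

lemma is_cokernel_mneg:
  assumes f: "f \<in> Mor A X Y"
  shows "is_cokernel A X Y (mneg A X Y f) Q q \<longleftrightarrow> is_cokernel A X Y f Q q"
proof -
  have "h \<cdot> mneg A X Y f = mzero A X W \<longleftrightarrow> h \<cdot> f = mzero A X W" if "h \<in> Mor A Y W" for W h
    using that f by (simp add: cmp_mneg mneg_eq_mzero_iff cmp_Mor)
  then show ?thesis
    by (simp add: is_cokernel_def f mneg_Mor[OF f] cong: ball_cong conj_cong)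
qed

lemma cob_shift [simp]: "cob (shift A X) n = cob X (n + 1)"
  by (simp add: shift_def)

lemma cdiff_shift:
  "cdiff (shift A X) n = mneg A (cob X (n + 1)) (cob X (n + 1 + 1)) (cdiff X (n + 1))"
proof -
  have "n + 1 + 1 = n + 2"
    by simp
  then show ?thesis
    by (simp only: shift_def cochain_complex.simps)
qed

lemma bounded_complex_shift:
  assumes X: "bounded_complex A X"
  shows "bounded_complex A (shift A X)"
  unfolding bounded_complex_def
proof (intro conjI allI)
  fix n :: int
  have d: "cdiff X n \<in> Mor A (cob X n) (cob X (n + 1))"
    "cdiff X (n + 1) \<cdot> cdiff X n = mzero A (cob X n) (cob X (n + 2))" for n
    using X by (auto simp: bounded_complex_def)
  have idx: "n + 1 + 1 + 1 = n + 1 + 2" "n + 2 + 1 = n + 1 + 2"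
    by simp_all
  show "cdiff (shift A X) n \<in> Mor A (cob (shift A X) n) (cob (shift A X) (n + 1))"
    unfolding cdiff_shift cob_shift by (rule mneg_Mor[OF d(1)])
  show "cdiff (shift A X) (n + 1) \<cdot> cdiff (shift A X) n =
      mzero A (cob (shift A X) n) (cob (shift A X) (n + 2))"
    unfolding cdiff_shift cob_shift mneg_cmp[OF mneg_Mor[OF d(1)] d(1)] cmp_mneg[OF d(1) d(1)] d(2)
    unfolding idx using bounded_complex_Ob[OF X] by (simp only: mneg_mzero)
next
  have "{n. \<not> zero_object A (cob (shift A X) n)} \<subseteq> (\<lambda>n. n - 1) ` {n. \<not> zero_object A (cob X n)}"
    by (auto simp: image_iff intro!: exI[of _ "n + 1" for n])
  then show "finite {n. \<not> zero_object A (cob (shift A X) n)}"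
    using X finite_subset unfolding bounded_complex_def by blast
qed

lemma chain_map_shift:
  assumes X: "bounded_complex A X" and Y: "bounded_complex A Y" and f: "chain_map A X Y f"
  shows "chain_map A (shift A X) (shift A Y) (shift_map f)"
  unfolding chain_map_def shift_map_def
proof (intro conjI allI)
  fix n
  note fM = chain_mapD[OF f]
  show "f (n + 1) \<in> Mor A (cob (shift A X) n) (cob (shift A Y) n)"
    unfolding cob_shift by (rule fM)
  show "f (n + 1 + 1) \<cdot> cdiff (shift A X) n = cdiff (shift A Y) n \<cdot> f (n + 1)"
    unfolding cdiff_shift cmp_mneg[OF bounded_complex_cdiff(1)[OF X] fM(1)]
      mneg_cmp[OF fM(1) bounded_complex_cdiff(1)[OF Y]] fM(2) ..
qed

text \<open>The two predicates \<open>is_cohomology\<close> coincide, signs being irrelevant, so the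
  choice operator selects the very same data. The result is an equality rather than an
  isomorphism.\<close>

lemma cohomology_shift:
  assumes X: "bounded_complex A X"
  shows "cohomology A (shift A X) n = cohomology A X (n + 1)"
proof -
  note d = bounded_complex_cdiff[OF X]
  have idx: "n - 1 + 1 = n" "n + 1 - 1 = n"
    by simp_all
  have "is_cohomology A (shift A X) n D = is_cohomology A X (n + 1) D" for D
  proof -
    obtain K k H c where D: "D = (K, k, H, c)"
      by (cases D)
    \<comment> \<open>Replacing \<open>e\<close> by its negative absorbs the sign of the preceding
      differential and leaves the cokernel unchanged.\<close>
    have "(\<exists>e \<in> Mor A (cob X n) K. k \<cdot> e = mneg A (cob X n) (cob X (n + 1)) (cdiff X n) \<and>
        is_cokernel A (cob X n) K e H c) \<longleftrightarrow>
      (\<exists>e \<in> Mor A (cob X n) K. k \<cdot> e = cdiff X n \<and> is_cokernel A (cob X n) K e H c)"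
      if k: "k \<in> Mor A K (cob X (n + 1))"
      by (metis cmp_mneg[OF _ k] d(1) is_cokernel_mneg mneg_Mor mneg_mneg)
    then show ?thesis
      unfolding D is_cohomology_def prod.case cdiff_shift cob_shift idx is_kernel_mneg[OF d(1)]
      using is_kernelD(2) by blast
  qed
  then have "is_cohomology A (shift A X) n = is_cohomology A X (n + 1)"
    by (rule ext)
  then show ?thesis
    unfolding cohomology_def by (rule arg_cong)
qed

lemma cohomology_ob_shift:
  "bounded_complex A X \<Longrightarrow> cohomology_ob A (shift A X) n = cohomology_ob A X (n + 1)"
  by (simp add: cohomology_ob_def cohomology_shift)

lemma cohomology_map_shift:
  "bounded_complex A X \<Longrightarrow> bounded_complex A Y \<Longrightarrow>
    cohomology_map A (shift A X) (shift A Y) (shift_map f) n = cohomology_map A X Y f (n + 1)"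
  by (simp add: cohomology_map_def cohomology_shift shift_map_def)

lemma cohomology_class_shift:
  "bounded_complex A X \<Longrightarrow> cohomology_class A (shift A X) n = cohomology_class A X (n + 1)"
  by (simp add: cohomology_class_def cohomology_shift fun_eq_iff)

lemma cocycle_shift:
  assumes "bounded_complex A X"
  shows "cocycle A (shift A X) n T x \<longleftrightarrow> cocycle A X (n + 1) T x"
proof -
  note d = bounded_complex_cdiff(1)[OF assms, of "n + 1"]
  have "mneg A (cob X (n + 1)) (cob X (n + 1 + 1)) (cdiff X (n + 1)) \<cdot> x = mzero A T (cob X (n + 1 + 1)) \<longleftrightarrow>
      cdiff X (n + 1) \<cdot> x = mzero A T (cob X (n + 1 + 1))" if "x \<in> Mor A T (cob X (n + 1))"
    unfolding mneg_cmp[OF that d] by (rule mneg_eq_mzero_iff[OF cmp_Mor[OF that d]])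
  then show ?thesis
    unfolding cocycle_def cdiff_shift cob_shift by blast
qed

end

context abelian_category
begin

lemma cohomology_class_mzero:
  assumes X: "bounded_complex A X" and T: "T \<in> Ob A"
  shows "cohomology_class A X n T (mzero A T (cob X n)) = mzero A T (cohomology_ob A X n)"
  using cohomology_class_boundary[OF X mzero_Mor[OF T bounded_complex_Ob[OF X]], of n]
    cmp_mzero[OF bounded_complex_cdiff(2)[OF X] T] by simp

text \<open>
  The three degrees are independent so that the criterion also covers the connecting morphism of
  the long exact sequence.
\<close>

lemma exact_at_cohomologyI:
  assumes P: "bounded_complex A P" and Q: "bounded_complex A Q" and R: "bounded_complex A R"
    and f: "f \<in> Mor A (cob P p) (cob Q m)" and g: "g \<in> Mor A (cob Q m) (cob R r)"
    and \<phi>: "\<phi> \<in> Mor A (cohomology_ob A P p) (cohomology_ob A Q m)"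
    and \<psi>: "\<psi> \<in> Mor A (cohomology_ob A Q m) (cohomology_ob A R r)"
    and f_cocycle: "\<And>T x. cocycle A P p T x \<Longrightarrow> cocycle A Q m T (f \<cdot> x)"
    and g_cocycle: "\<And>T y. cocycle A Q m T y \<Longrightarrow> cocycle A R r T (g \<cdot> y)"
    and \<phi>_class: "\<And>T x. cocycle A P p T x \<Longrightarrow>
      \<phi> \<cdot> cohomology_class A P p T x = cohomology_class A Q m T (f \<cdot> x)"
    and \<psi>_class: "\<And>T y. cocycle A Q m T y \<Longrightarrow>
      \<psi> \<cdot> cohomology_class A Q m T y = cohomology_class A R r T (g \<cdot> y)"
    and zero: "\<And>T x. cocycle A P p T x \<Longrightarrow>
      cohomology_class A R r T (g \<cdot> (f \<cdot> x)) = mzero A T (cohomology_ob A R r)"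
    and lift: "\<And>T y z. cocycle A Q m T y \<Longrightarrow> z \<in> Mor A T (cob R (r - 1)) \<Longrightarrow>
      g \<cdot> y = cdiff R (r - 1) \<cdot> z \<Longrightarrow>
      \<exists>x b. cocycle A P p T x \<and> b \<in> Mor A T (cob Q (m - 1)) \<and>
        y = madd A (f \<cdot> x) (cdiff Q (m - 1) \<cdot> b)"
  shows "exact_at (cohomology_ob A P p) (cohomology_ob A Q m) (cohomology_ob A R r) \<phi> \<psi>"
  unfolding exact_at_def
proof (intro conjI \<phi> \<psi> allI ballI impI)
  note Ob = cohomology_ob_Ob[OF P] cohomology_ob_Ob[OF R]
  show "\<psi> \<cdot> \<phi> = mzero A (cohomology_ob A P p) (cohomology_ob A R r)"
  proof (rule cohomology_map_ext[OF P cmp_Mor[OF \<phi> \<psi>] mzero_Mor[OF Ob]])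
    fix T x
    assume x: "cocycle A P p T x"
    note c = cohomology_class_Mor[OF P x]
    show "\<psi> \<cdot> \<phi> \<cdot> cohomology_class A P p T x =
        mzero A (cohomology_ob A P p) (cohomology_ob A R r) \<cdot> cohomology_class A P p T x"
      using cmp_assoc[OF c \<phi> \<psi>] mzero_cmp[OF c Ob(2)] \<phi>_class[OF x] \<psi>_class[OF f_cocycle[OF x]]
        zero[OF x] by simp
  qed
  fix T h
  assume h: "h \<in> Mor A T (cohomology_ob A Q m)" and "\<psi> \<cdot> h = mzero A T (cohomology_ob A R r)"
  \<comment> \<open>Three lifts in turn: \<open>h\<close> becomes the class of a cocycle
    \<open>y\<close>; vanishing of the class of \<open>g \<cdot> y\<close> makes that element a
    boundary after a further epimorphism \<open>s\<close>; finally \<open>lift\<close> writes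
    \<open>y \<cdot> s\<close> as an image under \<open>f\<close> plus a boundary.\<close>
  obtain T1 t y where t: "is_epi A T1 T t" and y: "cocycle A Q m T1 y"
    "cohomology_class A Q m T1 y = h \<cdot> t"
    using cohomology_class_surj[OF Q h] by blast
  note tM = is_epi_Mor[OF t]
  have yM: "y \<in> Mor A T1 (cob Q m)"
    using y(1) by (simp add: cocycle_def)
  have "cohomology_class A R r T1 (g \<cdot> y) = mzero A T1 (cohomology_ob A R r)"
    using \<psi>_class[OF y(1)] y(2) cmp_assoc[OF tM h \<psi>] \<open>\<psi> \<cdot> h = _\<close> mzero_cmp[OF tM Ob(2)] by simp
  then obtain T2 s z where s: "is_epi A T2 T1 s" and z: "z \<in> Mor A T2 (cob R (r - 1))"
    "cdiff R (r - 1) \<cdot> z = g \<cdot> y \<cdot> s"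
    using cohomology_class_zeroD[OF R g_cocycle[OF y(1)]] by blast
  note sM = is_epi_Mor[OF s]
  have "g \<cdot> (y \<cdot> s) = cdiff R (r - 1) \<cdot> z"
    using z(2) cmp_assoc[OF sM yM g] by simp
  then obtain x b where x: "cocycle A P p T2 x" and b: "b \<in> Mor A T2 (cob Q (m - 1))"
    and eq: "y \<cdot> s = madd A (f \<cdot> x) (cdiff Q (m - 1) \<cdot> b)"
    using lift[OF cocycle_cmp[OF Q y(1) sM] z(1)] by blast
  have "cohomology_class A Q m T2 (y \<cdot> s) = cohomology_class A Q m T2 (f \<cdot> x)"
    unfolding eq cohomology_class_add[OF Q f_cocycle[OF x] cocycle_boundary[OF Q b]]
      cohomology_class_boundary[OF Q b]
    by (rule madd_zero_right[OF cohomology_class_Mor[OF Q f_cocycle[OF x]]])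
  then have "\<phi> \<cdot> cohomology_class A P p T2 x = h \<cdot> (t \<cdot> s)"
    using \<phi>_class[OF x] cohomology_class_cmp[OF Q y(1) sM] y(2) cmp_assoc[OF sM tM h] by simp
  then show "\<exists>T' e x. is_epi A T' T e \<and> x \<in> Mor A T' (cohomology_ob A P p) \<and> \<phi> \<cdot> x = h \<cdot> e"
    using is_epi_cmp[OF s t] cohomology_class_Mor[OF P x] by blast
qed

text \<open>
  An element \<open>z\<close> of the cone is described by its components \<open>w \<cdot> z\<close> and \<open>q \<cdot> z\<close>.
\<close>

lemma mapping_cone_components:
  assumes X: "bounded_complex A X" and Y: "bounded_complex A Y" and Z: "bounded_complex A Z"
    and u: "chain_map A X Y u" and cone: "mapping_cone A X Y u Z v w"
  obtains q where
    "\<And>n. v n \<in> Mor A (cob Y n) (cob Z n)"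
    "\<And>n. w n \<in> Mor A (cob Z n) (cob (shift A X) n)"
    "\<And>n. q n \<in> Mor A (cob Z n) (cob Y n)"
    "\<And>n T y. y \<in> Mor A T (cob Y n) \<Longrightarrow> w n \<cdot> (v n \<cdot> y) = mzero A T (cob (shift A X) n)"
    "\<And>n T y. y \<in> Mor A T (cob Y n) \<Longrightarrow> q n \<cdot> (v n \<cdot> y) = y"
    "\<And>n T z. z \<in> Mor A T (cob Z n) \<Longrightarrow> w (n + 1) \<cdot> (cdiff Z n \<cdot> z) = cdiff (shift A X) n \<cdot> (w n \<cdot> z)"
    "\<And>n T z. z \<in> Mor A T (cob Z n) \<Longrightarrow>
      q (n + 1) \<cdot> (cdiff Z n \<cdot> z) = madd A (u (n + 1) \<cdot> (w n \<cdot> z)) (cdiff Y n \<cdot> (q n \<cdot> z))"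
    "\<And>n T z z'. z \<in> Mor A T (cob Z n) \<Longrightarrow> z' \<in> Mor A T (cob Z n) \<Longrightarrow> w n \<cdot> z = w n \<cdot> z' \<Longrightarrow>
      q n \<cdot> z = q n \<cdot> z' \<Longrightarrow> z = z'"
    "\<And>n T a b. a \<in> Mor A T (cob (shift A X) n) \<Longrightarrow> b \<in> Mor A T (cob Y n) \<Longrightarrow>
      \<exists>z \<in> Mor A T (cob Z n). w n \<cdot> z = a \<and> q n \<cdot> z = b"
proof -
  obtain i q where "\<And>n. is_biproduct A (cob (shift A X) n) (cob Y n) (cob Z n) (i n) (v n) (w n) (q n)"
    and dZ: "\<And>n. cdiff Z n =
       madd A (i (n + 1) \<cdot> cdiff (shift A X) n \<cdot> w n)
         (madd A (v (n + 1) \<cdot> u (n + 1) \<cdot> w n) (v (n + 1) \<cdot> cdiff Y n \<cdot> q n))"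
    using cone unfolding mapping_cone_def cob_shift by blast
  then have M: "i n \<in> Mor A (cob (shift A X) n) (cob Z n)" "v n \<in> Mor A (cob Y n) (cob Z n)"
      "w n \<in> Mor A (cob Z n) (cob (shift A X) n)" "q n \<in> Mor A (cob Z n) (cob Y n)"
    and wi: "w n \<cdot> i n = idm A (cob (shift A X) n)" and qv: "q n \<cdot> v n = idm A (cob Y n)"
    and qi: "q n \<cdot> i n = mzero A (cob (shift A X) n) (cob Y n)"
    and wv: "w n \<cdot> v n = mzero A (cob Y n) (cob (shift A X) n)"
    and sum: "madd A (i n \<cdot> w n) (v n \<cdot> q n) = idm A (cob Z n)" for n
    unfolding is_biproduct_def by blast+
  note Ob = bounded_complex_Ob[OF bounded_complex_shift[OF X]] bounded_complex_Ob[OF Y]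
  have wv': "w n \<cdot> (v n \<cdot> y) = mzero A T (cob (shift A X) n)" if "y \<in> Mor A T (cob Y n)" for n T y
    using cmp_assoc[OF that M(2,3)] wv mzero_cmp[OF that Ob(1)] by simp
  have qv': "q n \<cdot> (v n \<cdot> y) = y" if "y \<in> Mor A T (cob Y n)" for n T y
    using cmp_assoc[OF that M(2,4)] qv idm_left[OF that] by simp
  have wi': "w n \<cdot> (i n \<cdot> a) = a" if "a \<in> Mor A T (cob (shift A X) n)" for n T a
    using cmp_assoc[OF that M(1,3)] wi idm_left[OF that] by simp
  have qi': "q n \<cdot> (i n \<cdot> a) = mzero A T (cob Y n)" if "a \<in> Mor A T (cob (shift A X) n)" for n T a
    using cmp_assoc[OF that M(1,4)] qi mzero_cmp[OF that Ob(2)] by simp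
  have comp: "w n \<cdot> madd A (i n \<cdot> a) (v n \<cdot> b) = a" "q n \<cdot> madd A (i n \<cdot> a) (v n \<cdot> b) = b"
    "madd A (i n \<cdot> a) (v n \<cdot> b) \<in> Mor A T (cob Z n)"
    if a: "a \<in> Mor A T (cob (shift A X) n)" and b: "b \<in> Mor A T (cob Y n)" for n T a b
    using cmp_add_right[OF cmp_Mor[OF a M(1)] cmp_Mor[OF b M(2)] M(3)]
      cmp_add_right[OF cmp_Mor[OF a M(1)] cmp_Mor[OF b M(2)] M(4)]
      madd_Mor[OF cmp_Mor[OF a M(1)] cmp_Mor[OF b M(2)]]
      wi'[OF a] wv'[OF b] qi'[OF a] qv'[OF b] madd_zero_right[OF a] madd_zero_left[OF b] by simp_all
  \<comment> \<open>On components (a, b) the differential of the cone is (d a, u a + d b), where d a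
    is taken in the shift and carries its sign.\<close>
  have dZz: "cdiff Z n \<cdot> z = madd A (i (n + 1) \<cdot> (cdiff (shift A X) n \<cdot> (w n \<cdot> z)))
      (v (n + 1) \<cdot> madd A (u (n + 1) \<cdot> (w n \<cdot> z)) (cdiff Y n \<cdot> (q n \<cdot> z)))"
    if z: "z \<in> Mor A T (cob Z n)" for n T z
  proof -
    have uM: "u (n + 1) \<in> Mor A (cob (shift A X) n) (cob Y (n + 1))"
      using chain_mapD(1)[OF u] by simp
    note dX = bounded_complex_cdiff(1)[OF bounded_complex_shift[OF X], of n]
      and dY = bounded_complex_cdiff(1)[OF Y, of n]
      and wz = cmp_Mor[OF z M(3)] and qz = cmp_Mor[OF z M(4)]
    have a: "f \<cdot> g \<cdot> h \<in> Mor A (cob Z n) (cob Z (n + 1)) \<and> f \<cdot> g \<cdot> h \<cdot> z = f \<cdot> (g \<cdot> (h \<cdot> z))"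
      if "f \<in> Mor A V (cob Z (n + 1))" "g \<in> Mor A U V" "h \<in> Mor A (cob Z n) U" for f g h U V
      using cmp_assoc[OF z that(3) cmp_Mor[OF that(2,1)]] cmp_assoc[OF cmp_Mor[OF z that(3)] that(2,1)]
        cmp_Mor[OF that(3) cmp_Mor[OF that(2,1)]] by simp
    note 1 = a[OF M(1) dX M(3)] and 2 = a[OF M(2) uM M(3)] and 3 = a[OF M(2) dY M(4)]
    have "cdiff Z n \<cdot> z = madd A (i (n + 1) \<cdot> (cdiff (shift A X) n \<cdot> (w n \<cdot> z)))
      (madd A (v (n + 1) \<cdot> (u (n + 1) \<cdot> (w n \<cdot> z))) (v (n + 1) \<cdot> (cdiff Y n \<cdot> (q n \<cdot> z))))"
      unfolding dZ using 1 2 3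
        cmp_add_left[OF z 1[THEN conjunct1] madd_Mor[OF 2[THEN conjunct1] 3[THEN conjunct1]]]
        cmp_add_left[OF z 2[THEN conjunct1] 3[THEN conjunct1]] by simp
    then show ?thesis
      using cmp_add_right[OF cmp_Mor[OF wz uM] cmp_Mor[OF qz dY] M(2)] by simp
  qed
  have dMor: "cdiff (shift A X) n \<cdot> (w n \<cdot> z) \<in> Mor A T (cob (shift A X) (n + 1))"
    "madd A (u (n + 1) \<cdot> (w n \<cdot> z)) (cdiff Y n \<cdot> (q n \<cdot> z)) \<in> Mor A T (cob Y (n + 1))"
    if z: "z \<in> Mor A T (cob Z n)" for n T z
  proof -
    have uM: "u (n + 1) \<in> Mor A (cob (shift A X) n) (cob Y (n + 1))"
      using chain_mapD(1)[OF u] by simp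
    show "cdiff (shift A X) n \<cdot> (w n \<cdot> z) \<in> Mor A T (cob (shift A X) (n + 1))"
      by (rule cmp_Mor[OF cmp_Mor[OF z M(3)] bounded_complex_cdiff(1)[OF bounded_complex_shift[OF X]]])
    show "madd A (u (n + 1) \<cdot> (w n \<cdot> z)) (cdiff Y n \<cdot> (q n \<cdot> z)) \<in> Mor A T (cob Y (n + 1))"
      by (intro madd_Mor cmp_Mor[OF cmp_Mor[OF z M(3)] uM]
          cmp_Mor[OF cmp_Mor[OF z M(4)] bounded_complex_cdiff(1)[OF Y]])
  qed
  have decomp: "z = madd A (i n \<cdot> (w n \<cdot> z)) (v n \<cdot> (q n \<cdot> z))" if z: "z \<in> Mor A T (cob Z n)" for n T z
    using cmp_add_left[OF z cmp_Mor[OF M(3,1)] cmp_Mor[OF M(4,2)]] sum idm_left[OF z]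
      cmp_assoc[OF z M(3,1)] cmp_assoc[OF z M(4,2)] by simp
  show thesis
  proof (rule that[OF M(2) M(3) M(4) wv' qv'])
    show "w (n + 1) \<cdot> (cdiff Z n \<cdot> z) = cdiff (shift A X) n \<cdot> (w n \<cdot> z)"
      and "q (n + 1) \<cdot> (cdiff Z n \<cdot> z) = madd A (u (n + 1) \<cdot> (w n \<cdot> z)) (cdiff Y n \<cdot> (q n \<cdot> z))"
      if "z \<in> Mor A T (cob Z n)" for n T z
      unfolding dZz[OF that] using comp(1,2)[OF dMor[OF that]] by blast+
    show "z = z'" if "z \<in> Mor A T (cob Z n)" "z' \<in> Mor A T (cob Z n)" "w n \<cdot> z = w n \<cdot> z'"
      "q n \<cdot> z = q n \<cdot> z'" for n T z z'
      using decomp[OF that(1)] decomp[OF that(2)] that(3,4) by simp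
    show "\<exists>z \<in> Mor A T (cob Z n). w n \<cdot> z = a \<and> q n \<cdot> z = b"
      if "a \<in> Mor A T (cob (shift A X) n)" "b \<in> Mor A T (cob Y n)" for n T a b
      using comp[OF that] by blast
  qed
qed

section \<open>The long exact cohomology sequence of a mapping cone\<close>

context
  fixes X Y Z u v w
  assumes X: "bounded_complex A X" and Y: "bounded_complex A Y" and Z: "bounded_complex A Z"
    and u: "chain_map A X Y u" and cone: "mapping_cone A X Y u Z v w"
begin

private lemma S: "bounded_complex A (shift A X)"
  using X by (rule bounded_complex_shift)

text \<open>The inclusion \<open>v\<close> is compared on both components through
  \<open>ext\<close>; for the projection \<open>w\<close>, the component formula for the
  differential, applied to the identity, is already the claim.\<close>

lemma mapping_cone_chain_maps:
  shows "chain_map A Y Z v" and "chain_map A Z (shift A X) w"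
proof (atomize (full), rule mapping_cone_components[OF X Y Z u cone])
  fix q
  assume M: "\<And>n. v n \<in> Mor A (cob Y n) (cob Z n)"
      "\<And>n. w n \<in> Mor A (cob Z n) (cob (shift A X) n)"
      "\<And>n. q n \<in> Mor A (cob Z n) (cob Y n)"
    and wv: "\<And>n T y. y \<in> Mor A T (cob Y n) \<Longrightarrow> w n \<cdot> (v n \<cdot> y) = mzero A T (cob (shift A X) n)"
    and qv: "\<And>n T y. y \<in> Mor A T (cob Y n) \<Longrightarrow> q n \<cdot> (v n \<cdot> y) = y"
    and wd: "\<And>n T z. z \<in> Mor A T (cob Z n) \<Longrightarrow>
      w (n + 1) \<cdot> (cdiff Z n \<cdot> z) = cdiff (shift A X) n \<cdot> (w n \<cdot> z)"
    and qd: "\<And>n T z. z \<in> Mor A T (cob Z n) \<Longrightarrow>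
      q (n + 1) \<cdot> (cdiff Z n \<cdot> z) = madd A (u (n + 1) \<cdot> (w n \<cdot> z)) (cdiff Y n \<cdot> (q n \<cdot> z))"
    and ext: "\<And>n T z z'. z \<in> Mor A T (cob Z n) \<Longrightarrow> z' \<in> Mor A T (cob Z n) \<Longrightarrow>
      w n \<cdot> z = w n \<cdot> z' \<Longrightarrow> q n \<cdot> z = q n \<cdot> z' \<Longrightarrow> z = z'"
  have "v (n + 1) \<cdot> cdiff Y n = cdiff Z n \<cdot> v n" for n
  proof (rule ext)
    note dY = bounded_complex_cdiff(1)[OF Y, of n] and dS = bounded_complex_cdiff(1)[OF S, of n]
      and Ob = bounded_complex_Ob[OF Y, of n]
    have uM: "u (n + 1) \<in> Mor A (cob (shift A X) n) (cob Y (n + 1))"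
      using chain_mapD(1)[OF u] by simp
    show "v (n + 1) \<cdot> cdiff Y n \<in> Mor A (cob Y n) (cob Z (n + 1))"
      "cdiff Z n \<cdot> v n \<in> Mor A (cob Y n) (cob Z (n + 1))"
      using cmp_Mor[OF dY M(1)] cmp_Mor[OF M(1) bounded_complex_cdiff(1)[OF Z]] .
    have id: "w n \<cdot> v n = mzero A (cob Y n) (cob (shift A X) n)" "q n \<cdot> v n = idm A (cob Y n)"
      using wv[OF idm_Mor[OF Ob]] qv[OF idm_Mor[OF Ob]] idm_right[OF M(1)] by simp_all
    show "w (n + 1) \<cdot> (v (n + 1) \<cdot> cdiff Y n) = w (n + 1) \<cdot> (cdiff Z n \<cdot> v n)"
      unfolding wv[OF dY] wd[OF M(1)] id cmp_mzero[OF dS Ob] ..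
    show "q (n + 1) \<cdot> (v (n + 1) \<cdot> cdiff Y n) = q (n + 1) \<cdot> (cdiff Z n \<cdot> v n)"
      unfolding qv[OF dY] qd[OF M(1)] id cmp_mzero[OF uM Ob] idm_right[OF dY] madd_zero_left[OF dY] ..
  qed
  moreover have "w (n + 1) \<cdot> cdiff Z n = cdiff (shift A X) n \<cdot> w n" for n
    using wd[OF idm_Mor[OF bounded_complex_Ob[OF Z]]] idm_right[OF bounded_complex_cdiff(1)[OF Z]]
      idm_right[OF M(2)] by metis
  ultimately show "chain_map A Y Z v \<and> chain_map A Z (shift A X) w"
    unfolding chain_map_def using M by blast
qed

text \<open>For a cocycle \<open>x\<close>, the element \<open>v (u x)\<close> is the boundary of
  the cone element with components \<open>(x, 0)\<close>. Conversely, if \<open>v y\<close> is the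
  boundary of \<open>(a, b)\<close>, comparing components says that \<open>a\<close> is a cocycle
  and \<open>y = u a + d b\<close>.\<close>

lemma mapping_cone_exact_at_Y:
  "exact_at (cohomology_ob A X n) (cohomology_ob A Y n) (cohomology_ob A Z n)
     (cohomology_map A X Y u n) (cohomology_map A Y Z v n)"
proof (rule mapping_cone_components[OF X Y Z u cone])
  fix q
  assume M: "\<And>n. v n \<in> Mor A (cob Y n) (cob Z n)"
      "\<And>n. w n \<in> Mor A (cob Z n) (cob (shift A X) n)"
      "\<And>n. q n \<in> Mor A (cob Z n) (cob Y n)"
    and wv: "\<And>n T y. y \<in> Mor A T (cob Y n) \<Longrightarrow> w n \<cdot> (v n \<cdot> y) = mzero A T (cob (shift A X) n)"
    and qv: "\<And>n T y. y \<in> Mor A T (cob Y n) \<Longrightarrow> q n \<cdot> (v n \<cdot> y) = y"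
    and wd: "\<And>n T z. z \<in> Mor A T (cob Z n) \<Longrightarrow>
      w (n + 1) \<cdot> (cdiff Z n \<cdot> z) = cdiff (shift A X) n \<cdot> (w n \<cdot> z)"
    and qd: "\<And>n T z. z \<in> Mor A T (cob Z n) \<Longrightarrow>
      q (n + 1) \<cdot> (cdiff Z n \<cdot> z) = madd A (u (n + 1) \<cdot> (w n \<cdot> z)) (cdiff Y n \<cdot> (q n \<cdot> z))"
    and ext: "\<And>n T z z'. z \<in> Mor A T (cob Z n) \<Longrightarrow> z' \<in> Mor A T (cob Z n) \<Longrightarrow>
      w n \<cdot> z = w n \<cdot> z' \<Longrightarrow> q n \<cdot> z = q n \<cdot> z' \<Longrightarrow> z = z'"
    and ex: "\<And>n T a b. a \<in> Mor A T (cob (shift A X) n) \<Longrightarrow> b \<in> Mor A T (cob Y n) \<Longrightarrow>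
      \<exists>z \<in> Mor A T (cob Z n). w n \<cdot> z = a \<and> q n \<cdot> z = b"
  note v = mapping_cone_chain_maps(1)
  note uM = chain_mapD(1)[OF u, of n]
  have wd': "w n \<cdot> (cdiff Z (n - 1) \<cdot> z) = cdiff (shift A X) (n - 1) \<cdot> (w (n - 1) \<cdot> z)"
    and qd': "q n \<cdot> (cdiff Z (n - 1) \<cdot> z) =
      madd A (u n \<cdot> (w (n - 1) \<cdot> z)) (cdiff Y (n - 1) \<cdot> (q (n - 1) \<cdot> z))"
    if "z \<in> Mor A T (cob Z (n - 1))" for T z
    using wd[OF that] qd[OF that] by simp_all
  \<comment> \<open>Elements of \<open>cob X n\<close> sit in degree \<open>n - 1\<close> of the
    shift, whose sign does not affect being a cocycle.\<close>
  have cocycle_S: "cdiff (shift A X) (n - 1) \<cdot> x = mzero A T (cob (shift A X) n) \<longleftrightarrow> cocycle A X n T x"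
    if "x \<in> Mor A T (cob X n)" for T x
    using cocycle_shift[OF X, of "n - 1" T x] that by (simp add: cocycle_def)
  show ?thesis
  proof (rule exact_at_cohomologyI[OF X Y Z chain_mapD(1)[OF u] chain_mapD(1)[OF v]
        cohomology_map(1)[OF X Y u] cohomology_map(1)[OF Y Z v]
        cocycle_chain_map[OF X Y u] cocycle_chain_map[OF Y Z v]
        cohomology_map(2)[OF X Y u] cohomology_map(2)[OF Y Z v]])
    fix T x
    assume x: "cocycle A X n T x"
    then have xM: "x \<in> Mor A T (cob X n)" and T: "T \<in> Ob A"
      using Mor_Ob by (auto simp: cocycle_def)
    note ux = cmp_Mor[OF xM uM]
    have "x \<in> Mor A T (cob (shift A X) (n - 1))"
      using xM by simp
    then obtain z where z: "z \<in> Mor A T (cob Z (n - 1))" "w (n - 1) \<cdot> z = x"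
      "q (n - 1) \<cdot> z = mzero A T (cob Y (n - 1))"
      using ex mzero_Mor[OF T bounded_complex_Ob[OF Y]] by blast
    have "v n \<cdot> (u n \<cdot> x) = cdiff Z (n - 1) \<cdot> z"
    proof (rule ext)
      show "v n \<cdot> (u n \<cdot> x) \<in> Mor A T (cob Z n)" "cdiff Z (n - 1) \<cdot> z \<in> Mor A T (cob Z n)"
        using cmp_Mor[OF ux M(1)] cmp_Mor[OF z(1) bounded_complex_cdiff(2)[OF Z]] .
      show "w n \<cdot> (v n \<cdot> (u n \<cdot> x)) = w n \<cdot> (cdiff Z (n - 1) \<cdot> z)"
        using cocycle_S[OF xM] x unfolding wv[OF ux] wd'[OF z(1)] z by simp
      show "q n \<cdot> (v n \<cdot> (u n \<cdot> x)) = q n \<cdot> (cdiff Z (n - 1) \<cdot> z)"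
        unfolding qv[OF ux] qd'[OF z(1)] z cmp_mzero[OF bounded_complex_cdiff(2)[OF Y] T]
          madd_zero_right[OF ux] ..
    qed
    then show "cohomology_class A Z n T (v n \<cdot> (u n \<cdot> x)) = mzero A T (cohomology_ob A Z n)"
      using cohomology_class_boundary[OF Z z(1)] by simp
  next
    fix T y z
    assume y: "cocycle A Y n T y" and z: "z \<in> Mor A T (cob Z (n - 1))"
      and eq: "v n \<cdot> y = cdiff Z (n - 1) \<cdot> z"
    have yM: "y \<in> Mor A T (cob Y n)"
      using y by (simp add: cocycle_def)
    have aM: "w (n - 1) \<cdot> z \<in> Mor A T (cob X n)"
      using cmp_Mor[OF z M(2)] by simp
    have "cocycle A X n T (w (n - 1) \<cdot> z)"
      using wv[OF yM] wd'[OF z] cocycle_S[OF aM] unfolding eq by simp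
    moreover have "y = madd A (u n \<cdot> (w (n - 1) \<cdot> z)) (cdiff Y (n - 1) \<cdot> (q (n - 1) \<cdot> z))"
      using qv[OF yM] qd'[OF z] unfolding eq by simp
    ultimately show "\<exists>x b. cocycle A X n T x \<and> b \<in> Mor A T (cob Y (n - 1)) \<and>
        y = madd A (u n \<cdot> x) (cdiff Y (n - 1) \<cdot> b)"
      using cmp_Mor[OF z M(3)] by blast
  qed
qed

text \<open>If \<open>w z\<close> is the boundary of \<open>a\<close>, subtract from
  \<open>z\<close> the boundary of a cone element lying over \<open>a\<close>. The difference has
  first component zero, hence comes from an element of \<open>Y\<close>, which is again a
  cocycle.\<close>

lemma mapping_cone_exact_at_Z:
  "exact_at (cohomology_ob A Y n) (cohomology_ob A Z n) (cohomology_ob A X (n + 1))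
     (cohomology_map A Y Z v n) (cohomology_map A Z (shift A X) w n)"
proof (rule mapping_cone_components[OF X Y Z u cone])
  fix q
  assume M: "\<And>n. v n \<in> Mor A (cob Y n) (cob Z n)"
      "\<And>n. w n \<in> Mor A (cob Z n) (cob (shift A X) n)"
      "\<And>n. q n \<in> Mor A (cob Z n) (cob Y n)"
    and wv: "\<And>n T y. y \<in> Mor A T (cob Y n) \<Longrightarrow> w n \<cdot> (v n \<cdot> y) = mzero A T (cob (shift A X) n)"
    and qv: "\<And>n T y. y \<in> Mor A T (cob Y n) \<Longrightarrow> q n \<cdot> (v n \<cdot> y) = y"
    and wd: "\<And>n T z. z \<in> Mor A T (cob Z n) \<Longrightarrow>
      w (n + 1) \<cdot> (cdiff Z n \<cdot> z) = cdiff (shift A X) n \<cdot> (w n \<cdot> z)"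
    and qd: "\<And>n T z. z \<in> Mor A T (cob Z n) \<Longrightarrow>
      q (n + 1) \<cdot> (cdiff Z n \<cdot> z) = madd A (u (n + 1) \<cdot> (w n \<cdot> z)) (cdiff Y n \<cdot> (q n \<cdot> z))"
    and ext: "\<And>n T z z'. z \<in> Mor A T (cob Z n) \<Longrightarrow> z' \<in> Mor A T (cob Z n) \<Longrightarrow>
      w n \<cdot> z = w n \<cdot> z' \<Longrightarrow> q n \<cdot> z = q n \<cdot> z' \<Longrightarrow> z = z'"
    and ex: "\<And>n T a b. a \<in> Mor A T (cob (shift A X) n) \<Longrightarrow> b \<in> Mor A T (cob Y n) \<Longrightarrow>
      \<exists>z \<in> Mor A T (cob Z n). w n \<cdot> z = a \<and> q n \<cdot> z = b"
  note v = mapping_cone_chain_maps(1) and w = mapping_cone_chain_maps(2)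
  have wd': "w n \<cdot> (cdiff Z (n - 1) \<cdot> z) = cdiff (shift A X) (n - 1) \<cdot> (w (n - 1) \<cdot> z)"
    if "z \<in> Mor A T (cob Z (n - 1))" for T z
    using wd[OF that] by simp
  note dZ = bounded_complex_cdiff[OF Z]
  have uM: "u (n + 1) \<in> Mor A (cob (shift A X) n) (cob Y (n + 1))"
    using chain_mapD(1)[OF u] by simp
  show ?thesis
    unfolding cohomology_ob_shift[OF X, symmetric]
  proof (rule exact_at_cohomologyI[OF Y Z S chain_mapD(1)[OF v] chain_mapD(1)[OF w]
        cohomology_map(1)[OF Y Z v] cohomology_map(1)[OF Z S w]
        cocycle_chain_map[OF Y Z v] cocycle_chain_map[OF Z S w]
        cohomology_map(2)[OF Y Z v] cohomology_map(2)[OF Z S w]])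
    fix T y
    assume "cocycle A Y n T y"
    then have y: "y \<in> Mor A T (cob Y n)" "T \<in> Ob A"
      using Mor_Ob by (auto simp: cocycle_def)
    show "cohomology_class A (shift A X) n T (w n \<cdot> (v n \<cdot> y)) =
        mzero A T (cohomology_ob A (shift A X) n)"
      unfolding wv[OF y(1)] by (rule cohomology_class_mzero[OF S y(2)])
  next
    fix T z a
    assume "cocycle A Z n T z" and a: "a \<in> Mor A T (cob (shift A X) (n - 1))"
      and eq: "w n \<cdot> z = cdiff (shift A X) (n - 1) \<cdot> a"
    then have z: "z \<in> Mor A T (cob Z n)" "cdiff Z n \<cdot> z = mzero A T (cob Z (n + 1))"
      and T: "T \<in> Ob A"
      using Mor_Ob by (auto simp: cocycle_def)
    obtain s where s: "s \<in> Mor A T (cob Z (n - 1))" "w (n - 1) \<cdot> s = a"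
      using ex[OF a mzero_Mor[OF T bounded_complex_Ob[OF Y]]] by blast
    define ds where "ds = cdiff Z (n - 1) \<cdot> s"
    have ds: "ds \<in> Mor A T (cob Z n)" "cdiff Z n \<cdot> ds = mzero A T (cob Z (n + 1))" "w n \<cdot> ds = w n \<cdot> z"
      using cocycle_boundary[OF Z s(1)] wd'[OF s(1)] s(2) eq by (auto simp: ds_def cocycle_def)
    define r where "r = madd A z (mneg A T (cob Z n) ds)"
    have r: "r \<in> Mor A T (cob Z n)"
      unfolding r_def using z(1) ds(1) by (intro madd_Mor mneg_Mor)
    have fr: "f \<cdot> r = mzero A T V" if "f \<in> Mor A (cob Z n) V" "f \<cdot> ds = f \<cdot> z" for f V
      unfolding r_def cmp_add_right[OF z(1) mneg_Mor[OF ds(1)] that(1)] cmp_mneg[OF ds(1) that(1)]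
        that(2) by (rule madd_neg_right[OF cmp_Mor[OF z(1) that(1)]])
    have wr: "w n \<cdot> r = mzero A T (cob (shift A X) n)"
      using fr[OF M(2) ds(3)] .
    have dr: "cdiff Z n \<cdot> r = mzero A T (cob Z (n + 1))"
      using fr[OF dZ(1)] ds(2) z(2) by simp
    note qr = cmp_Mor[OF r M(3)]
    have vqr: "v n \<cdot> (q n \<cdot> r) = r"
      by (rule ext[OF cmp_Mor[OF qr M(1)] r]) (simp_all add: wv[OF qr] qv[OF qr] wr)
    have "cdiff Y n \<cdot> (q n \<cdot> r) = mzero A T (cob Y (n + 1))"
      using qd[OF r] wr dr cmp_mzero[OF M(3) T] cmp_mzero[OF uM T]
        madd_zero_left[OF cmp_Mor[OF qr bounded_complex_cdiff(1)[OF Y]]] by simp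
    then have "cocycle A Y n T (q n \<cdot> r)"
      using qr by (rule cocycleI[rotated])
    moreover have "z = madd A (v n \<cdot> (q n \<cdot> r)) (cdiff Z (n - 1) \<cdot> s)"
      unfolding vqr ds_def[symmetric] unfolding r_def madd_assoc[OF z(1) mneg_Mor[OF ds(1)] ds(1)]
        madd_neg_left[OF ds(1)] by (rule madd_zero_right[OF z(1), symmetric])
    ultimately show "\<exists>y b. cocycle A Y n T y \<and> b \<in> Mor A T (cob Z (n - 1)) \<and>
        z = madd A (v n \<cdot> y) (cdiff Z (n - 1) \<cdot> b)"
      using s(1) by blast
  qed
qed

text \<open>The second component of \<open>d z = 0\<close> reads \<open>u (w z) = - d (q z)\<close>,
  so the composite vanishes on classes. Conversely, for a cocycle \<open>y\<close> the equation
  \<open>u y = d z\<close> makes \<open>(y, - z)\<close> a cocycle of the cone lying over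
  \<open>y\<close>.\<close>

lemma mapping_cone_exact_at_X:
  "exact_at (cohomology_ob A Z n) (cohomology_ob A X (n + 1)) (cohomology_ob A Y (n + 1))
     (cohomology_map A Z (shift A X) w n) (cohomology_map A X Y u (n + 1))"
proof (rule mapping_cone_components[OF X Y Z u cone])
  fix q
  assume M: "\<And>n. v n \<in> Mor A (cob Y n) (cob Z n)"
      "\<And>n. w n \<in> Mor A (cob Z n) (cob (shift A X) n)"
      "\<And>n. q n \<in> Mor A (cob Z n) (cob Y n)"
    and wd: "\<And>n T z. z \<in> Mor A T (cob Z n) \<Longrightarrow>
      w (n + 1) \<cdot> (cdiff Z n \<cdot> z) = cdiff (shift A X) n \<cdot> (w n \<cdot> z)"
    and qd: "\<And>n T z. z \<in> Mor A T (cob Z n) \<Longrightarrow>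
      q (n + 1) \<cdot> (cdiff Z n \<cdot> z) = madd A (u (n + 1) \<cdot> (w n \<cdot> z)) (cdiff Y n \<cdot> (q n \<cdot> z))"
    and ext: "\<And>n T z z'. z \<in> Mor A T (cob Z n) \<Longrightarrow> z' \<in> Mor A T (cob Z n) \<Longrightarrow>
      w n \<cdot> z = w n \<cdot> z' \<Longrightarrow> q n \<cdot> z = q n \<cdot> z' \<Longrightarrow> z = z'"
    and ex: "\<And>n T a b. a \<in> Mor A T (cob (shift A X) n) \<Longrightarrow> b \<in> Mor A T (cob Y n) \<Longrightarrow>
      \<exists>z \<in> Mor A T (cob Z n). w n \<cdot> z = a \<and> q n \<cdot> z = b"
  note w = mapping_cone_chain_maps(2)
  note dY = bounded_complex_cdiff(1)[OF Y, of n]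
  have idx: "n + 1 - 1 = n"
    by simp
  have uM: "u (n + 1) \<in> Mor A (cob (shift A X) n) (cob Y (n + 1))"
    using chain_mapD(1)[OF u] by simp
  \<comment> \<open>The middle term is both degree \<open>n\<close> of the shift and degree
    \<open>n + 1\<close> of \<open>X\<close>; the facts about \<open>u\<close> are restated on the
    shift so that both neighbouring maps refer to the same complex.\<close>
  have \<psi>: "cohomology_map A X Y u (n + 1) \<in> Mor A (cohomology_ob A (shift A X) n) (cohomology_ob A Y (n + 1))"
    "\<And>T x. cocycle A (shift A X) n T x \<Longrightarrow> cocycle A Y (n + 1) T (u (n + 1) \<cdot> x)"
    "\<And>T x. cocycle A (shift A X) n T x \<Longrightarrow>
      cohomology_map A X Y u (n + 1) \<cdot> cohomology_class A (shift A X) n T x =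
        cohomology_class A Y (n + 1) T (u (n + 1) \<cdot> x)"
    unfolding cohomology_ob_shift[OF X] cohomology_class_shift[OF X] cocycle_shift[OF X]
    using cohomology_map[OF X Y u] cocycle_chain_map[OF X Y u] by blast+
  show ?thesis
    unfolding cohomology_ob_shift[OF X, symmetric]
  proof (rule exact_at_cohomologyI[OF Z S Y chain_mapD(1)[OF w] uM cohomology_map(1)[OF Z S w] \<psi>(1)
        cocycle_chain_map[OF Z S w] \<psi>(2) cohomology_map(2)[OF Z S w] \<psi>(3)])
    fix T z
    assume "cocycle A Z n T z"
    then have z: "z \<in> Mor A T (cob Z n)" "cdiff Z n \<cdot> z = mzero A T (cob Z (n + 1))" and T: "T \<in> Ob A"
      using Mor_Ob by (auto simp: cocycle_def)
    note qz = cmp_Mor[OF z(1) M(3)]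
    have *: "madd A (u (n + 1) \<cdot> (w n \<cdot> z)) (cdiff Y n \<cdot> (q n \<cdot> z)) = mzero A T (cob Y (n + 1))"
      using qd[OF z(1)] z(2) cmp_mzero[OF M(3) T] by simp
    have "u (n + 1) \<cdot> (w n \<cdot> z) = cdiff Y n \<cdot> mneg A T (cob Y n) (q n \<cdot> z)"
      unfolding cmp_mneg[OF qz dY]
      by (rule mneg_unique[OF cmp_Mor[OF qz dY] cmp_Mor[OF cmp_Mor[OF z(1) M(2)] uM]])
        (use * madd_commute[OF cmp_Mor[OF cmp_Mor[OF z(1) M(2)] uM] cmp_Mor[OF qz dY]] in simp)
    then show "cohomology_class A Y (n + 1) T (u (n + 1) \<cdot> (w n \<cdot> z)) =
        mzero A T (cohomology_ob A Y (n + 1))"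
      using cohomology_class_boundary[OF Y, of _ T "n + 1", unfolded idx, OF mneg_Mor[OF qz]] by simp
  next
    fix T y z
    assume "cocycle A (shift A X) n T y" and z: "z \<in> Mor A T (cob Y (n + 1 - 1))"
      and eq: "u (n + 1) \<cdot> y = cdiff Y (n + 1 - 1) \<cdot> z"
    then have y: "y \<in> Mor A T (cob (shift A X) n)"
      "cdiff (shift A X) n \<cdot> y = mzero A T (cob (shift A X) (n + 1))"
      and T: "T \<in> Ob A"
      unfolding cocycle_def using Mor_Ob by blast+
    have z': "z \<in> Mor A T (cob Y n)"
      using z by simp
    obtain x where x: "x \<in> Mor A T (cob Z n)" "w n \<cdot> x = y" "q n \<cdot> x = mneg A T (cob Y n) z"
      using ex[OF y(1) mneg_Mor[OF z']] by blast
    have "cdiff Z n \<cdot> x = mzero A T (cob Z (n + 1))"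
    proof (rule ext)
      show "cdiff Z n \<cdot> x \<in> Mor A T (cob Z (n + 1))" "mzero A T (cob Z (n + 1)) \<in> Mor A T (cob Z (n + 1))"
        using cmp_Mor[OF x(1) bounded_complex_cdiff(1)[OF Z]] mzero_Mor[OF T bounded_complex_Ob[OF Z]] .
      show "w (n + 1) \<cdot> (cdiff Z n \<cdot> x) = w (n + 1) \<cdot> mzero A T (cob Z (n + 1))"
        unfolding wd[OF x(1)] x y cmp_mzero[OF M(2) T] ..
      show "q (n + 1) \<cdot> (cdiff Z n \<cdot> x) = q (n + 1) \<cdot> mzero A T (cob Z (n + 1))"
        unfolding qd[OF x(1)] x cmp_mzero[OF M(3) T] eq[unfolded idx] cmp_mneg[OF z' dY]
        by (rule madd_neg_right[OF cmp_Mor[OF z' dY]])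
    qed
    then have "cocycle A Z n T x"
      using x(1) by (rule cocycleI[rotated])
    \<comment> \<open>The cocycle \<open>x\<close> maps to \<open>y\<close> on the nose, so the
      boundary term is that of the zero element.\<close>
    moreover have "y = madd A (w n \<cdot> x) (cdiff (shift A X) (n - 1) \<cdot> mzero A T (cob (shift A X) (n - 1)))"
      unfolding x(2) cmp_mzero[OF bounded_complex_cdiff(2)[OF S] T] by (rule madd_zero_right[OF y(1), symmetric])
    ultimately show "\<exists>x b. cocycle A Z n T x \<and> b \<in> Mor A T (cob (shift A X) (n - 1)) \<and>
        y = madd A (w n \<cdot> x) (cdiff (shift A X) (n - 1) \<cdot> b)"
      using mzero_Mor[OF T bounded_complex_Ob[OF S]] by blast
  qed
qed

end

end

section \<open>Triangles\<close>

context preadditive_category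
begin

lemma bounded_complexes_arrow:
  assumes "bounded_complex A X" "bounded_complex A Y" "chain_map A X Y f"
  shows "derived_arrow A X Y f \<in> Mor (derived_category A) X Y"
proof -
  have "f \<in> Mor (bounded_complexes A) X Y"
    using assms by (simp add: bounded_complexes_simps)
  then show ?thesis
    using is_functor_loc_arrow[OF bounded_complexes_category, of "quasi_isomorphism A"]
    unfolding is_functor_def derived_arrow_def derived_category_def by blast
qed

lemma derived_arrow_cmp:
  assumes "bounded_complex A X" "bounded_complex A Y" "bounded_complex A Z"
    "chain_map A X Y f" "chain_map A Y Z g"
  shows "derived_arrow A Y Z g \<cdot>\<^bsub>derived_category A\<^esub> derived_arrow A X Y f =
    derived_arrow A X Z (\<lambda>n. g n \<cdot> f n)"
proof -
  have "f \<in> Mor (bounded_complexes A) X Y" "g \<in> Mor (bounded_complexes A) Y Z"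
    using assms by (simp_all add: bounded_complexes_simps)
  then have "loc_arrow (bounded_complexes A) (quasi_isomorphism A) X Z (g \<cdot>\<^bsub>bounded_complexes A\<^esub> f) =
      derived_arrow A Y Z g \<cdot>\<^bsub>derived_category A\<^esub> derived_arrow A X Y f"
    using is_functor_loc_arrow[OF bounded_complexes_category, of "quasi_isomorphism A"]
    unfolding is_functor_def derived_arrow_def derived_category_def by blast
  then show ?thesis
    by (simp add: derived_arrow_def bounded_complexes_simps)
qed

lemma derived_arrow_idm: "derived_arrow A X X (\<lambda>n. idm A (cob X n)) = idm (derived_category A) X"
  unfolding derived_arrow_def loc_arrow_def derived_category_def cat_localization_def
  by (simp add: bounded_complexes_simps)

lemma derived_category_category: "category (derived_category A)"
  unfolding derived_category_def by (rule category_cat_localization[OF bounded_complexes_category])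

lemma derived_category_Ob: "Ob (derived_category A) = {X. bounded_complex A X}"
  by (simp add: derived_category_def cat_localization_def bounded_complexes_simps)

lemma quasi_isomorphism_derived:
  assumes "bounded_complex A X" "bounded_complex A Y" "quasi_isomorphism A X Y f"
  shows "is_isomorphism (derived_category A) X Y (derived_arrow A X Y f)"
  unfolding derived_category_def derived_arrow_def
  by (rule loc_arrow_inverts[OF bounded_complexes_category])
    (use assms in \<open>auto simp: bounded_complexes_simps quasi_isomorphism_def\<close>)

lemma quasi_isomorphism_shift:
  assumes "bounded_complex A X" "bounded_complex A Y" "quasi_isomorphism A X Y f"
  shows "quasi_isomorphism A (shift A X) (shift A Y) (shift_map f)"
  using assms unfolding quasi_isomorphism_def
  by (simp add: chain_map_shift cohomology_map_shift cohomology_ob_shift)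

lemma bounded_complexes_shift:
  "f \<in> Mor (bounded_complexes A) X Y \<Longrightarrow>
    shift_map f \<in> Mor (bounded_complexes A) (shift A X) (shift A Y)"
  by (simp add: bounded_complexes_simps bounded_complex_shift chain_map_shift)

lemma shift_map_idm:
  "shift_map (idm (bounded_complexes A) X) = idm (bounded_complexes A) (shift A X)"
  by (simp add: bounded_complexes_simps shift_map_def fun_eq_iff)

lemma shift_map_cmp:
  "shift_map (g \<cdot>\<^bsub>bounded_complexes A\<^esub> f) = shift_map g \<cdot>\<^bsub>bounded_complexes A\<^esub> shift_map f"
  by (simp add: bounded_complexes_simps shift_map_def fun_eq_iff)

lemma quasi_isomorphism_shift':
  "w \<in> Mor (bounded_complexes A) X Y \<Longrightarrow> quasi_isomorphism A X Y w \<Longrightarrow>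
    quasi_isomorphism A (shift A X) (shift A Y) (shift_map w)"
  by (simp add: bounded_complexes_simps quasi_isomorphism_shift)

lemma fm_typ_shift:
  "fm_typ (bounded_complexes A) (quasi_isomorphism A) X Y s \<Longrightarrow>
    fm_typ (bounded_complexes A) (quasi_isomorphism A) (shift A X) (shift A Y)
      (map_formal_mor (shift A) shift_map s)"
  by (induction rule: fm_typ.induct)
    (auto intro: fm_typ.intros bounded_complexes_shift quasi_isomorphism_shift')

text \<open>Every defining relation survives because \<open>shift\<close> with
  \<open>shift_map\<close> is a functor on complexes that preserves quasi-isomorphisms. It makes
  \<open>derived_shift\<close> independent of representatives.\<close>

lemma fm_eq_shift:
  "fm_eq (bounded_complexes A) (quasi_isomorphism A) X Y s t \<Longrightarrow>
    fm_eq (bounded_complexes A) (quasi_isomorphism A) (shift A X) (shift A Y)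
      (map_formal_mor (shift A) shift_map s) (map_formal_mor (shift A) shift_map t)"
proof (induction rule: fm_eq.induct)
  case (refl X Y s)
  then show ?case by (intro fm_eq.refl fm_typ_shift)
next
  case (sym X Y s t)
  from sym.IH show ?case by (rule fm_eq.sym)
next
  case (trans X Y s t u)
  from trans.IH show ?case by (rule fm_eq.trans)
next
  case (cong X Y s s' Z t t')
  then show ?case by (simp add: fm_eq.cong)
next
  case (assoc W X s Y t Z u)
  show ?case
    unfolding formal_mor.map by (rule fm_eq.assoc[OF assoc[THEN fm_typ_shift]])
next
  case (unit_left X Y s)
  then show ?case by (simp add: shift_map_idm fm_eq.unit_left fm_typ_shift)
next
  case (unit_right X Y s)
  then show ?case by (simp add: shift_map_idm fm_eq.unit_right fm_typ_shift)
next
  case (gen_cmp f X Y g Z)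
  then show ?case by (simp add: shift_map_cmp fm_eq.gen_cmp bounded_complexes_shift)
next
  case (inv_left w X Y)
  then show ?case
    by (simp add: shift_map_idm fm_eq.inv_left bounded_complexes_shift quasi_isomorphism_shift')
next
  case (inv_right w X Y)
  then show ?case
    by (simp add: shift_map_idm fm_eq.inv_right bounded_complexes_shift quasi_isomorphism_shift')
qed

text \<open>The triangles constructed here are compared with a cone by the identity on their first
  term, so this is the value of \<open>derived_shift\<close> that their last commuting square calls
  for.\<close>

lemma derived_shift_idm:
  assumes "bounded_complex A X"
  shows "derived_shift A (idm (derived_category A) X) = idm (derived_category A) (shift A X)"
proof -
  let ?C = "bounded_complexes A" and ?S = "quasi_isomorphism A"
  let ?e = "Gen X X (idm ?C X)"
  have e: "map_formal_mor (shift A) shift_map ?e = Gen (shift A X) (shift A X) (idm ?C (shift A X))"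
    by (simp add: shift_map_idm)
  have id: "idm (derived_category A) X = {t. fm_eq ?C ?S X X (Gen X X (idm ?C X)) t}" for X
    by (simp add: derived_category_def cat_localization_def)
  have ty: "fm_typ ?C ?S X X ?e"
    using assms category.idm_Mor[OF bounded_complexes_category, of X]
    by (intro fm_typ.gen) (simp add: bounded_complexes_simps(1))
  show ?thesis
  proof (rule Set.set_eqI, rule iffI)
    fix t
    assume "t \<in> derived_shift A (idm (derived_category A) X)"
    then obtain X' Y' s where s: "fm_eq ?C ?S X X ?e s" "fm_typ ?C ?S X' Y' s"
      and t: "fm_eq ?C ?S (shift A X') (shift A Y') (map_formal_mor (shift A) shift_map s) t"
      unfolding derived_shift_def id by blast
    \<comment> \<open>A word determines its endpoints, so the existential endpoints in
      \<open>derived_shift\<close> are forced.\<close>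
    have "X' = X" "Y' = X"
      using fm_typ_unique[OF s(2)] fm_eq_typ[OF bounded_complexes_category s(1)] by blast+
    then show "t \<in> idm (derived_category A) (shift A X)"
      using fm_eq.trans[OF fm_eq_shift[OF s(1)]] t unfolding id e by simp
  next
    fix t
    assume "t \<in> idm (derived_category A) (shift A X)"
    then show "t \<in> derived_shift A (idm (derived_category A) X)"
      unfolding derived_shift_def id e[symmetric] using fm_eq.refl[OF ty] ty by blast
  qed
qed

lemma chain_map_mzero:
  assumes X: "bounded_complex A X" and Y: "bounded_complex A Y"
  shows "chain_map A X Y (\<lambda>n. mzero A (cob X n) (cob Y n))"
  unfolding chain_map_def
proof (intro conjI allI)
  note Ob = bounded_complex_Ob[OF X] bounded_complex_Ob[OF Y]
  show "mzero A (cob X n) (cob Y n) \<in> Mor A (cob X n) (cob Y n)" for n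
    using Ob by (rule mzero_Mor)
  show "mzero A (cob X (n + 1)) (cob Y (n + 1)) \<cdot> cdiff X n = cdiff Y n \<cdot> mzero A (cob X n) (cob Y n)" for n
    unfolding mzero_cmp[OF bounded_complex_cdiff(1)[OF X] Ob(2)]
      cmp_mzero[OF bounded_complex_cdiff(1)[OF Y] Ob(1)] ..
qed

text \<open>Zero maps absorb words: \<open>to Y\<close> after any word from \<open>X\<close> to
  \<open>Y\<close> is \<open>to X\<close>, by induction on the word. At \<open>Y = O'\<close> the
  absorbing map is the identity, so every morphism into \<open>O'\<close> equals
  \<open>to X\<close>; dually for morphisms out of it.\<close>

lemma derived_zero_object:
  assumes OC: "bounded_complex A O'" and zero: "\<And>n. zero_object A (cob O' n)"
  shows "zero_object (derived_category A) O'"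
proof -
  let ?C = "bounded_complexes A" and ?S = "quasi_isomorphism A" and ?D = "derived_category A"
  interpret D: category ?D
    by (rule derived_category_category)
  have O_id: "(\<lambda>n. mzero A (cob O' n) (cob O' n)) = (\<lambda>n. idm A (cob O' n))"
    using zero by (simp add: zero_object_iff)
  define c where "c X Y s = {t. fm_eq ?C ?S X Y s t}" for X Y s
  define to where "to X = derived_arrow A X O' (\<lambda>n. mzero A (cob X n) (cob O' n))" for X
  define from' where "from' X = derived_arrow A O' X (\<lambda>n. mzero A (cob O' n) (cob X n))" for X
  have c_Mor: "c X Y s \<in> Mor ?D X Y" if "fm_typ ?C ?S X Y s" for X Y s
    using that unfolding c_def derived_category_def cat_localization_Mor by blast
  have c_cmp: "c Y Z t \<cdot>\<^bsub>?D\<^esub> c X Y s = c X Z (Cmp t s)"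
    if "fm_typ ?C ?S X Y s" "fm_typ ?C ?S Y Z t" for X Y Z s t
    using that unfolding c_def derived_category_def by (rule cat_localization_cmp[OF bounded_complexes_category])
  have c_Gen: "c X Y (Gen X Y f) = derived_arrow A X Y f" for X Y f
    by (simp add: c_def derived_arrow_def loc_arrow_def)
  have c_inv: "derived_arrow A X Y w \<cdot>\<^bsub>?D\<^esub> c Y X (Inv X Y w) = idm ?D Y"
    "c Y X (Inv X Y w) \<cdot>\<^bsub>?D\<^esub> derived_arrow A X Y w = idm ?D X"
    if "w \<in> Mor ?C X Y" "?S X Y w" for X Y w
  proof -
    note ty = fm_typ.gen[where S = ?S, OF that(1)] fm_typ.inv[where S = ?S, OF that]
    have "c Y Y (Cmp (Gen X Y w) (Inv X Y w)) = c Y Y (Gen Y Y (idm ?C Y))"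
      "c X X (Cmp (Inv X Y w) (Gen X Y w)) = c X X (Gen X X (idm ?C X))"
      unfolding c_def
      using fm_class_eqI[OF fm_eq.inv_right[where S = ?S, OF that]]
        fm_class_eqI[OF fm_eq.inv_left[where S = ?S, OF that]] .
    then show "derived_arrow A X Y w \<cdot>\<^bsub>?D\<^esub> c Y X (Inv X Y w) = idm ?D Y"
      "c Y X (Inv X Y w) \<cdot>\<^bsub>?D\<^esub> derived_arrow A X Y w = idm ?D X"
      using c_cmp[OF ty(2,1)] c_cmp[OF ty(1,2)]
      by (simp_all add: c_Gen bounded_complexes_simps derived_arrow_idm)
  qed
  have to_Mor: "to X \<in> Mor ?D X O'" "from' X \<in> Mor ?D O' X" if "bounded_complex A X" for X
    unfolding to_def from'_def using that OC by (auto intro!: bounded_complexes_arrow chain_map_mzero)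
  have to_arrow: "to Y \<cdot>\<^bsub>?D\<^esub> derived_arrow A X Y f = to X"
    "derived_arrow A X Y f \<cdot>\<^bsub>?D\<^esub> from' X = from' Y"
    if "f \<in> Mor ?C X Y" for X Y f
  proof -
    have X: "bounded_complex A X" and Y: "bounded_complex A Y" and f: "chain_map A X Y f"
      using that by (auto simp: bounded_complexes_simps)
    show "to Y \<cdot>\<^bsub>?D\<^esub> derived_arrow A X Y f = to X"
      unfolding to_def derived_arrow_cmp[OF X Y OC f chain_map_mzero[OF Y OC]]
        mzero_cmp[OF chain_mapD(1)[OF f] bounded_complex_Ob[OF OC]] ..
    show "derived_arrow A X Y f \<cdot>\<^bsub>?D\<^esub> from' X = from' Y"
      unfolding from'_def derived_arrow_cmp[OF OC X Y chain_map_mzero[OF OC X] f]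
        cmp_mzero[OF chain_mapD(1)[OF f] bounded_complex_Ob[OF OC]] ..
  qed
  have Ob: "bounded_complex A X \<and> bounded_complex A Y" if "fm_typ ?C ?S X Y s" for X Y s
    using fm_typ_Ob[OF bounded_complexes_category that] by (simp add: bounded_complexes_simps)
  have absorb: "to Y \<cdot>\<^bsub>?D\<^esub> c X Y s = to X \<and> c X Y s \<cdot>\<^bsub>?D\<^esub> from' X = from' Y"
    if "fm_typ ?C ?S X Y s" for X Y s
    using that
  proof (induction rule: fm_typ.induct)
    case (gen f X Y)
    then show ?case
      using to_arrow unfolding c_Gen by blast
  next
    case (inv w X Y)
    note ty = fm_typ.gen[where S = ?S, OF inv(1)] fm_typ.inv[where S = ?S, OF inv]
    note Ob' = Ob[OF ty(1)] and i = c_Mor[OF ty(2)] and a = c_Mor[OF ty(1), unfolded c_Gen]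
    \<comment> \<open>For a formal inverse, expand \<open>to X\<close> as \<open>to Y\<close> after
      \<open>w\<close>; then \<open>w\<close> cancels against its inverse.\<close>
    have "to X \<cdot>\<^bsub>?D\<^esub> c Y X (Inv X Y w) = to Y \<cdot>\<^bsub>?D\<^esub> derived_arrow A X Y w \<cdot>\<^bsub>?D\<^esub> c Y X (Inv X Y w)"
      unfolding to_arrow[OF inv(1)] ..
    also have "\<dots> = to Y"
      using D.cmp_assoc[OF i a to_Mor(1)] c_inv(1)[OF inv] Ob' D.idm_right[OF to_Mor(1)] by simp
    finally have 1: "to X \<cdot>\<^bsub>?D\<^esub> c Y X (Inv X Y w) = to Y" .
    have "c Y X (Inv X Y w) \<cdot>\<^bsub>?D\<^esub> from' Y = c Y X (Inv X Y w) \<cdot>\<^bsub>?D\<^esub> (derived_arrow A X Y w \<cdot>\<^bsub>?D\<^esub> from' X)"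
      unfolding to_arrow[OF inv(1)] ..
    also have "\<dots> = from' X"
      using D.cmp_assoc[OF to_Mor(2) a i] c_inv(2)[OF inv] Ob' D.idm_left[OF to_Mor(2)] by simp
    finally show ?case
      using 1 by simp
  next
    case (cmp X Y s Z t)
    note s = c_Mor[OF cmp.hyps(1)] and t = c_Mor[OF cmp.hyps(2)]
      and Ob' = Ob[OF cmp.hyps(1)] Ob[OF cmp.hyps(2)]
    show ?case
      unfolding c_cmp[OF cmp.hyps, symmetric]
      using D.cmp_assoc[OF s t to_Mor(1)] D.cmp_assoc[OF to_Mor(2) s t] cmp.IH Ob' by simp
  qed
  have O_eq: "to O' = idm ?D O'" "from' O' = idm ?D O'"
    unfolding to_def from'_def O_id by (rule derived_arrow_idm)+
  have "P = to X" if P: "P \<in> Mor ?D X O'" for P X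
  proof -
    obtain s where "fm_typ ?C ?S X O' s" "P = c X O' s"
      using P unfolding derived_category_def cat_localization_Mor c_def by blast
    then show ?thesis
      using absorb D.idm_left[OF P] O_eq by metis
  qed
  moreover have "P = from' X" if P: "P \<in> Mor ?D O' X" for P X
  proof -
    obtain s where "fm_typ ?C ?S O' X s" "P = c O' X s"
      using P unfolding derived_category_def cat_localization_Mor c_def by blast
    then show ?thesis
      using absorb D.idm_right[OF P] O_eq by metis
  qed
  ultimately show ?thesis
    unfolding zero_object_def derived_category_Ob using OC to_Mor by blast
qed

text \<open>The cone \<open>Z'\<close> is exchanged for the quasi-isomorphic complex
  \<open>Z\<close>: the second map is composed with \<open>r\<close>, the third with the inverse
  \<open>c\<close> of \<open>r\<close> in the derived category.\<close>

lemma quasi_isomorphism_triangle: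
  assumes X: "bounded_complex A X" and Y: "bounded_complex A Y"
    and Z': "bounded_complex A Z'" and Z: "bounded_complex A Z"
    and u: "chain_map A X Y u" and cone: "mapping_cone A X Y u Z' v w"
    and v: "chain_map A Y Z' v" and w: "chain_map A Z' (shift A X) w"
    and r: "quasi_isomorphism A Z' Z r"
  shows "\<exists>f g h. triangle A X Y Z f g h"
proof -
  let ?D = "derived_category A"
  interpret D: category ?D
    by (rule derived_category_category)
  note S = bounded_complex_shift[OF X]
  have r': "is_isomorphism ?D Z' Z (derived_arrow A Z' Z r)"
    by (rule quasi_isomorphism_derived[OF Z' Z r])
  then obtain c where c: "c \<in> Mor ?D Z Z'" "c \<cdot>\<^bsub>?D\<^esub> derived_arrow A Z' Z r = idm ?D Z'"
    "derived_arrow A Z' Z r \<cdot>\<^bsub>?D\<^esub> c = idm ?D Z"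
    unfolding is_isomorphism_def by blast
  have ci: "is_isomorphism ?D Z Z' c"
    using r' c unfolding is_isomorphism_def by blast
  have uM: "derived_arrow A X Y u \<in> Mor ?D X Y" and vM: "derived_arrow A Y Z' v \<in> Mor ?D Y Z'"
    and wM: "derived_arrow A Z' (shift A X) w \<in> Mor ?D Z' (shift A X)"
    and rM: "derived_arrow A Z' Z r \<in> Mor ?D Z' Z"
    using r' X Y Z' S u v w bounded_complexes_arrow unfolding is_isomorphism_def by auto
  have id: "is_isomorphism ?D V V (idm ?D V)" if "bounded_complex A V" for V
    using that D.idm_Mor D.idm_left unfolding is_isomorphism_def derived_category_Ob by blast
  have "triangle A X Y Z (derived_arrow A X Y u) (derived_arrow A Z' Z r \<cdot>\<^bsub>?D\<^esub> derived_arrow A Y Z' v)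
    (derived_arrow A Z' (shift A X) w \<cdot>\<^bsub>?D\<^esub> c)"
    unfolding triangle_def
  proof (intro conjI exI)
    show "idm ?D Y \<cdot>\<^bsub>?D\<^esub> derived_arrow A X Y u = derived_arrow A X Y u \<cdot>\<^bsub>?D\<^esub> idm ?D X"
      using uM D.idm_left D.idm_right by simp
    show "c \<cdot>\<^bsub>?D\<^esub> (derived_arrow A Z' Z r \<cdot>\<^bsub>?D\<^esub> derived_arrow A Y Z' v) =
        derived_arrow A Y Z' v \<cdot>\<^bsub>?D\<^esub> idm ?D Y"
      using D.cmp_assoc[OF vM rM c(1)] c D.idm_left[OF vM] D.idm_right[OF vM] by simp
    show "derived_shift A (idm ?D X) \<cdot>\<^bsub>?D\<^esub> (derived_arrow A Z' (shift A X) w \<cdot>\<^bsub>?D\<^esub> c) =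
        derived_arrow A Z' (shift A X) w \<cdot>\<^bsub>?D\<^esub> c"
      unfolding derived_shift_idm[OF X] by (rule D.idm_left[OF D.cmp_Mor[OF c(1) wM]])
  qed (use X Y Z' u cone id ci uM D.cmp_Mor[OF vM rM] D.cmp_Mor[OF c(1) wM] in simp_all)
  then show ?thesis
    by blast
qed

lemma is_isomorphism_idm: "X \<in> Ob A \<Longrightarrow> is_isomorphism A X X (idm A X)"
  unfolding is_isomorphism_def using idm_Mor idm_left by metis

lemma is_biproduct_zero_right:
  assumes X: "X \<in> Ob A" and Z: "zero_object A Z"
  shows "is_biproduct A X Z X (idm A X) (mzero A Z X) (idm A X) (mzero A X Z)"
proof -
  have Z': "Z \<in> Ob A" "idm A Z = mzero A Z Z"
    using Z by (auto simp: zero_object_iff)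
  note id = idm_Mor[OF X] and z = mzero_Mor[OF X Z'(1)] mzero_Mor[OF Z'(1) X]
  show ?thesis
    unfolding is_biproduct_def Z'(2) idm_left[OF id] mzero_cmp[OF id Z'(1)] cmp_mzero[OF z(1) Z'(1)]
      cmp_mzero[OF z(2) X] cmp_mzero[OF id Z'(1)] madd_zero_right[OF id]
    using id z by simp
qed

lemma is_biproduct_zero_left:
  assumes Y: "Y \<in> Ob A" and Z: "zero_object A Z"
  shows "is_biproduct A Z Y Y (mzero A Z Y) (idm A Y) (mzero A Y Z) (idm A Y)"
proof -
  have Z': "Z \<in> Ob A" "idm A Z = mzero A Z Z"
    using Z by (auto simp: zero_object_iff)
  note id = idm_Mor[OF Y] and z = mzero_Mor[OF Y Z'(1)] mzero_Mor[OF Z'(1) Y]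
  show ?thesis
    unfolding is_biproduct_def Z'(2) idm_left[OF id] mzero_cmp[OF id Z'(1)] cmp_mzero[OF z(1) Z'(1)]
      cmp_mzero[OF z(2) Y] cmp_mzero[OF id Z'(1)] madd_zero_left[OF id]
    using id z by simp
qed

end

section \<open>Stalk complexes, two-term complexes and their triangles\<close>

definition the_zero :: "('o, 'm, 'x) preadditive_scheme \<Rightarrow> 'o" where
  "the_zero A = (SOME Z. zero_object A Z)"

text \<open>Filling the other degrees with \<open>the_zero A\<close>, the zero object that
  \<open>stalk\<close> chooses, makes \<open>stalk\<close> literally the case of degree 0 and the
  shift of a stalk literally a stalk one degree lower.\<close>

definition stalk_at ::
  "('o, 'm, 'x) preadditive_scheme \<Rightarrow> int \<Rightarrow> 'o \<Rightarrow> ('o, 'm) cochain_complex" where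
  "stalk_at A m X = \<lparr>cob = (\<lambda>n. if n = m then X else the_zero A),
     cdiff = (\<lambda>n. mzero A (if n = m then X else the_zero A) (if n + 1 = m then X else the_zero A))\<rparr>"

text \<open>\<open>X\<close> sits in degree \<open>m - 1\<close> and \<open>Y\<close> in degree
  \<open>m\<close>: the shape of the cone of \<open>f\<close>, regarded as a map of stalks in degree
  \<open>m\<close>.\<close>

definition two_term_complex ::
  "('o, 'm, 'x) preadditive_scheme \<Rightarrow> int \<Rightarrow> 'o \<Rightarrow> 'o \<Rightarrow> 'm \<Rightarrow> ('o, 'm) cochain_complex" where
  "two_term_complex A m X Y f =
     (let c = (\<lambda>n. if n = m then Y else if n + 1 = m then X else the_zero A)
      in \<lparr>cob = c, cdiff = (\<lambda>n. if n + 1 = m then f else mzero A (c n) (c (n + 1)))\<rparr>)"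

lemma stalk_eq_stalk_at: "stalk A X = stalk_at A 0 X"
  unfolding stalk_def stalk_at_def the_zero_def Let_def by simp

lemma stalk_at_simps:
  "cob (stalk_at A m X) n = (if n = m then X else the_zero A)"
  "cdiff (stalk_at A m X) n = mzero A (cob (stalk_at A m X) n) (cob (stalk_at A m X) (n + 1))"
  by (simp_all add: stalk_at_def)

lemma two_term_complex_simps:
  "cob (two_term_complex A m X Y f) n = (if n = m then Y else if n + 1 = m then X else the_zero A)"
  "cdiff (two_term_complex A m X Y f) n = (if n + 1 = m then f else
     mzero A (cob (two_term_complex A m X Y f) n) (cob (two_term_complex A m X Y f) (n + 1)))"
  by (simp_all add: two_term_complex_def)

text \<open>All entries are the same chosen object, so the degree leaves no trace. This lets zero
  take part in triangles of stalks in any degree.\<close>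

lemma stalk_at_the_zero: "stalk_at A m (the_zero A) = stalk A (the_zero A)"
  by (simp add: stalk_eq_stalk_at stalk_at_def)

context abelian_category
begin

lemma zero_object_the_zero: "zero_object A (the_zero A)"
  unfolding the_zero_def using ex_zero_object by (rule someI_ex)

lemma the_zero_Ob: "the_zero A \<in> Ob A"
  using zero_object_the_zero by (simp add: zero_object_iff)

lemma idm_the_zero: "idm A (the_zero A) = mzero A (the_zero A) (the_zero A)"
  using zero_object_the_zero by (simp add: zero_object_iff)

lemma bounded_complex_stalk_at:
  assumes "X \<in> Ob A"
  shows "bounded_complex A (stalk_at A m X)"
  unfolding bounded_complex_def
proof (intro conjI allI)
  have Ob: "cob (stalk_at A m X) n \<in> Ob A" for n
    using assms the_zero_Ob by (simp add: stalk_at_simps)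
  fix n
  show "cdiff (stalk_at A m X) n \<in> Mor A (cob (stalk_at A m X) n) (cob (stalk_at A m X) (n + 1))"
    unfolding stalk_at_simps(2) using Ob Ob by (rule mzero_Mor)
  have "n + 1 + 1 = n + 2" for n :: int
    by simp
  then show "cdiff (stalk_at A m X) (n + 1) \<cdot> cdiff (stalk_at A m X) n =
      mzero A (cob (stalk_at A m X) n) (cob (stalk_at A m X) (n + 2))"
    unfolding stalk_at_simps(2) mzero_cmp[OF mzero_Mor[OF Ob Ob] Ob] by (simp only:)
next
  have "{n. \<not> zero_object A (cob (stalk_at A m X) n)} \<subseteq> {m}"
    using zero_object_the_zero by (auto simp: stalk_at_simps)
  then show "finite {n. \<not> zero_object A (cob (stalk_at A m X) n)}"
    using finite_subset by blast
qed

text \<open>The sign introduced by \<open>shift\<close> disappears because every differential of a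
  stalk is zero.\<close>

lemma shift_stalk_at:
  assumes "X \<in> Ob A"
  shows "shift A (stalk_at A m X) = stalk_at A (m - 1) X"
proof -
  have Ob: "cob (stalk_at A m X) n \<in> Ob A" for n
    using assms the_zero_Ob by (simp add: stalk_at_simps)
  have cob: "cob (stalk_at A m X) (n + 1) = cob (stalk_at A (m - 1) X) n" for n
    by (auto simp: stalk_at_simps)
  have "cob (shift A (stalk_at A m X)) = cob (stalk_at A (m - 1) X)"
    unfolding fun_eq_iff cob_shift cob by simp
  moreover have "cdiff (shift A (stalk_at A m X)) = cdiff (stalk_at A (m - 1) X)"
    unfolding fun_eq_iff cdiff_shift stalk_at_simps(2) mneg_mzero[OF Ob Ob]
    unfolding cob by simp
  ultimately show ?thesis
    by simp
qed

lemma bounded_complex_two_term_complex: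
  assumes f: "f \<in> Mor A X Y"
  shows "bounded_complex A (two_term_complex A m X Y f)" (is "bounded_complex A ?C")
  unfolding bounded_complex_def
proof (intro conjI allI)
  have XY: "X \<in> Ob A" "Y \<in> Ob A"
    using Mor_Ob[OF f] by auto
  then have Ob: "cob ?C n \<in> Ob A" for n
    using the_zero_Ob by (simp add: two_term_complex_simps)
  fix n
  show d: "cdiff ?C n \<in> Mor A (cob ?C n) (cob ?C (n + 1))" for n
  proof (cases "n + 1 = m")
    case True
    then show ?thesis
      using f by (auto simp: two_term_complex_simps)
  next
    case False
    then have "cdiff ?C n = mzero A (cob ?C n) (cob ?C (n + 1))"
      by (simp add: two_term_complex_simps)
    then show ?thesis
      using mzero_Mor[OF Ob Ob] by simp
  qed
  have idx: "n + 1 + 1 = n + 2" for n :: int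
    by simp
  show "cdiff ?C (n + 1) \<cdot> cdiff ?C n = mzero A (cob ?C n) (cob ?C (n + 2))"
  proof (cases "n + 1 = m")
    case True
    then have "cdiff ?C (n + 1) = mzero A (cob ?C (n + 1)) (cob ?C (n + 2))"
      unfolding two_term_complex_simps(2) idx by simp
    then show ?thesis
      using mzero_cmp[OF d Ob] by simp
  next
    case False
    then have "cdiff ?C n = mzero A (cob ?C n) (cob ?C (n + 1))"
      by (simp add: two_term_complex_simps)
    then show ?thesis
      using cmp_mzero[OF d[of "n + 1", unfolded idx] Ob] by simp
  qed
next
  have "{n. \<not> zero_object A (cob ?C n)} \<subseteq> {m, m - 1}"
    using zero_object_the_zero by (auto simp: two_term_complex_simps)
  then show "finite {n. \<not> zero_object A (cob ?C n)}"
    using finite_subset by blast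
qed

text \<open>Off degree \<open>m\<close> both stalks consist of the chosen zero object, whose zero
  endomorphism is the default value.\<close>

definition stalk_map :: "int \<Rightarrow> 'b \<Rightarrow> int \<Rightarrow> 'b" where
  "stalk_map m f n = (if n = m then f else mzero A (the_zero A) (the_zero A))"

lemma chain_map_stalk_map:
  assumes f: "f \<in> Mor A X Y"
  shows "chain_map A (stalk_at A m X) (stalk_at A m Y) (stalk_map m f)"
proof -
  have XY: "X \<in> Ob A" "Y \<in> Ob A"
    using Mor_Ob[OF f] by auto
  have s: "stalk_map m f n \<in> Mor A (cob (stalk_at A m X) n) (cob (stalk_at A m Y) n)" for n
    using f mzero_Mor[OF the_zero_Ob the_zero_Ob] by (simp add: stalk_map_def stalk_at_simps)
  have Ob: "cob (stalk_at A m V) n \<in> Ob A" if "V \<in> Ob A" for n V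
    using that the_zero_Ob by (simp add: stalk_at_simps)
  show ?thesis
    unfolding chain_map_def stalk_at_simps(2)
    using s mzero_cmp[OF s] cmp_mzero[OF s] Ob XY by simp
qed

text \<open>In every degree at least one of the two summands is the chosen zero object, so the other
  one itself serves as the biproduct. Of the differential only the entry coming from
  \<open>f\<close> survives.\<close>

lemma mapping_cone_stalk_map:
  assumes f: "f \<in> Mor A X Y"
  shows "\<exists>v w. mapping_cone A (stalk_at A m X) (stalk_at A m Y) (stalk_map m f)
    (two_term_complex A m X Y f) v w"
proof -
  let ?X = "stalk_at A m X" and ?Y = "stalk_at A m Y" and ?Z = "two_term_complex A m X Y f"
  have XY: "X \<in> Ob A" "Y \<in> Ob A"
    using Mor_Ob[OF f] by auto
  have X: "bounded_complex A ?X" and Y: "bounded_complex A ?Y" and Z: "bounded_complex A ?Z"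
    using XY f by (auto intro: bounded_complex_stalk_at bounded_complex_two_term_complex)
  note S = bounded_complex_shift[OF X]
  note Ob = bounded_complex_Ob[OF S] bounded_complex_Ob[OF Y] bounded_complex_Ob[OF Z]
  define i where "i n = (if n + 1 = m then idm A X else mzero A (cob (shift A ?X) n) (cob ?Z n))" for n
  define v where "v n = (if n = m then idm A Y else mzero A (cob ?Y n) (cob ?Z n))" for n
  define w where "w n = (if n + 1 = m then idm A X else mzero A (cob ?Z n) (cob (shift A ?X) n))" for n
  define q where "q n = (if n = m then idm A Y else mzero A (cob ?Z n) (cob ?Y n))" for n
  have bi: "is_biproduct A (cob (shift A ?X) n) (cob ?Y n) (cob ?Z n) (i n) (v n) (w n) (q n)" for n
  proof -
    consider "n + 1 = m" "n \<noteq> m" | "n = m" "n + 1 \<noteq> m" | "n \<noteq> m" "n + 1 \<noteq> m"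
      by linarith
    then show ?thesis
    proof cases
      case 1
      then show ?thesis
        using is_biproduct_zero_right[OF XY(1) zero_object_the_zero]
        by (simp add: i_def v_def w_def q_def stalk_at_simps two_term_complex_simps)
    next
      case 2
      then show ?thesis
        using is_biproduct_zero_left[OF XY(2) zero_object_the_zero]
        by (simp add: i_def v_def w_def q_def stalk_at_simps two_term_complex_simps)
    next
      case 3
      then show ?thesis
        using is_biproduct_zero_left[OF the_zero_Ob zero_object_the_zero]
        by (simp add: i_def v_def w_def q_def stalk_at_simps two_term_complex_simps idm_the_zero)
    qed
  qed
  then have M: "i n \<in> Mor A (cob (shift A ?X) n) (cob ?Z n)" "v n \<in> Mor A (cob ?Y n) (cob ?Z n)"
      "w n \<in> Mor A (cob ?Z n) (cob (shift A ?X) n)" "q n \<in> Mor A (cob ?Z n) (cob ?Y n)" for n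
    unfolding is_biproduct_def by blast+
  have d: "cdiff ?Z n =
       madd A (i (n + 1) \<cdot> cdiff (shift A ?X) n \<cdot> w n)
         (madd A (v (n + 1) \<cdot> stalk_map m f (n + 1) \<cdot> w n) (v (n + 1) \<cdot> cdiff ?Y n \<cdot> q n))" for n
  proof -
    have dS: "cdiff (shift A ?X) n = mzero A (cob (shift A ?X) n) (cob (shift A ?X) (n + 1))"
      unfolding cdiff_shift stalk_at_simps(2) mneg_mzero[OF bounded_complex_Ob[OF X] bounded_complex_Ob[OF X]]
        cob_shift ..
    have 1: "i (n + 1) \<cdot> cdiff (shift A ?X) n \<cdot> w n = mzero A (cob ?Z n) (cob ?Z (n + 1))"
      unfolding dS cmp_mzero[OF M(1) Ob(1)] mzero_cmp[OF M(3) Ob(3)] ..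
    have 2: "v (n + 1) \<cdot> cdiff ?Y n \<cdot> q n = mzero A (cob ?Z n) (cob ?Z (n + 1))"
      unfolding stalk_at_simps(2) cmp_mzero[OF M(2) Ob(2)] mzero_cmp[OF M(4) Ob(3)] ..
    have 3: "v (n + 1) \<cdot> stalk_map m f (n + 1) \<cdot> w n = cdiff ?Z n"
    proof (cases "n + 1 = m")
      case True
      then show ?thesis
        using idm_left[OF f] idm_right[OF f]
        by (simp add: v_def w_def stalk_map_def two_term_complex_simps)
    next
      case False
      have "stalk_map m f (n + 1) = mzero A (cob (shift A ?X) n) (cob ?Y (n + 1))"
        using False by (simp add: stalk_map_def stalk_at_simps)
      then have "v (n + 1) \<cdot> stalk_map m f (n + 1) \<cdot> w n = mzero A (cob ?Z n) (cob ?Z (n + 1))"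
        using cmp_mzero[OF M(2) Ob(1)] mzero_cmp[OF M(3) Ob(3)] by simp
      then show ?thesis
        using False by (simp add: two_term_complex_simps)
    qed
    show ?thesis
      unfolding 1 2 3 madd_zero_right[OF bounded_complex_cdiff(1)[OF Z]]
        madd_zero_left[OF bounded_complex_cdiff(1)[OF Z]] ..
  qed
  have "mapping_cone A ?X ?Y (stalk_map m f) ?Z v w"
    unfolding mapping_cone_def cob_shift[symmetric] using bi d by blast
  then show ?thesis
    by blast
qed

text \<open>A test on cocycles: \<open>inj\<close> pulls boundaries back and makes the induced map
  mono, \<open>surj\<close> lifts cocycles after an epimorphism and makes it epi; in an abelian
  category the two together give an isomorphism.\<close>

lemma cohomology_map_isomorphismI:
  assumes P: "bounded_complex A P" and Q: "bounded_complex A Q" and f: "chain_map A P Q f"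
    and inj: "\<And>T x z. cocycle A P n T x \<Longrightarrow> z \<in> Mor A T (cob Q (n - 1)) \<Longrightarrow>
      f n \<cdot> x = cdiff Q (n - 1) \<cdot> z \<Longrightarrow> \<exists>y \<in> Mor A T (cob P (n - 1)). x = cdiff P (n - 1) \<cdot> y"
    and surj: "\<And>T y. cocycle A Q n T y \<Longrightarrow>
      \<exists>T' t x. is_epi A T' T t \<and> cocycle A P n T' x \<and> f n \<cdot> x = y \<cdot> t"
  shows "is_isomorphism A (cohomology_ob A P n) (cohomology_ob A Q n) (cohomology_map A P Q f n)"
proof (rule mono_epi_is_isomorphism)
  note F = cohomology_map[OF P Q f, of n] and Ob = cohomology_ob_Ob[OF Q]
  show "is_mono A (cohomology_ob A P n) (cohomology_ob A Q n) (cohomology_map A P Q f n)"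
  proof (rule is_monoI[OF F(1)])
    fix T h
    assume h: "h \<in> Mor A T (cohomology_ob A P n)"
      and zero: "cohomology_map A P Q f n \<cdot> h = mzero A T (cohomology_ob A Q n)"
    obtain T1 t x where t: "is_epi A T1 T t" and x: "cocycle A P n T1 x" "cohomology_class A P n T1 x = h \<cdot> t"
      using cohomology_class_surj[OF P h] by blast
    note tM = is_epi_Mor[OF t]
    have "cohomology_class A Q n T1 (f n \<cdot> x) = mzero A T1 (cohomology_ob A Q n)"
      using F(2)[OF x(1)] x(2) cmp_assoc[OF tM h F(1)] zero mzero_cmp[OF tM Ob] by simp
    then obtain T2 s z where s: "is_epi A T2 T1 s" and z: "z \<in> Mor A T2 (cob Q (n - 1))"
      "cdiff Q (n - 1) \<cdot> z = f n \<cdot> x \<cdot> s"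
      using cohomology_class_zeroD[OF Q cocycle_chain_map[OF P Q f x(1)]] by blast
    note sM = is_epi_Mor[OF s]
    have "x \<in> Mor A T1 (cob P n)"
      using x(1) by (simp add: cocycle_def)
    then have "f n \<cdot> (x \<cdot> s) = cdiff Q (n - 1) \<cdot> z"
      using cmp_assoc[OF sM _ chain_mapD(1)[OF f]] z(2) by simp
    then obtain y where y: "y \<in> Mor A T2 (cob P (n - 1))" "x \<cdot> s = cdiff P (n - 1) \<cdot> y"
      using inj[OF cocycle_cmp[OF P x(1) sM] z(1)] by blast
    have "h \<cdot> (t \<cdot> s) = mzero A T2 (cohomology_ob A P n)"
      using cohomology_class_boundary[OF P y(1)] cohomology_class_cmp[OF P x(1) sM] x(2) y(2)
        cmp_assoc[OF sM tM h] by simp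
    then show "h = mzero A T (cohomology_ob A P n)"
      using is_epi_mzeroD[OF is_epi_cmp[OF s t] h] by blast
  qed
  \<comment> \<open>Surjectivity is tested on the universal element, the identity of the
    target.\<close>
  have id: "idm A (cohomology_ob A Q n) \<in> Mor A (cohomology_ob A Q n) (cohomology_ob A Q n)"
    using Ob by (rule idm_Mor)
  then obtain T1 t y where t: "is_epi A T1 (cohomology_ob A Q n) t" and y: "cocycle A Q n T1 y"
    "cohomology_class A Q n T1 y = idm A (cohomology_ob A Q n) \<cdot> t"
    using cohomology_class_surj[OF Q id] by blast
  obtain T2 s x where s: "is_epi A T2 T1 s" and x: "cocycle A P n T2 x" "f n \<cdot> x = y \<cdot> s"
    using surj[OF y(1)] by blast
  have "cohomology_map A P Q f n \<cdot> cohomology_class A P n T2 x = t \<cdot> s"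
    using F(2)[OF x(1)] x(2) cohomology_class_cmp[OF Q y(1) is_epi_Mor[OF s]] y(2)
      idm_left[OF is_epi_Mor[OF t]] by simp
  then show "is_epi A (cohomology_ob A P n) (cohomology_ob A Q n) (cohomology_map A P Q f n)"
    using is_epi_rightI[OF F(1) cohomology_class_Mor[OF P x(1)]] is_epi_cmp[OF s t] by simp
qed

text \<open>The quasi-isomorphism is \<open>g\<close> in degree \<open>m\<close>. There, exactness
  at \<open>Y\<close> gives injectivity on cohomology and \<open>g\<close> being epi gives lifts; in
  degree \<open>m - 1\<close> every cocycle vanishes because \<open>f\<close> is mono, and elsewhere
  the objects are zero.\<close>

lemma quasi_isomorphism_two_term_complex:
  assumes ses: "short_exact A X Y Z f g"
  shows "\<exists>r. quasi_isomorphism A (two_term_complex A m X Y f) (stalk_at A m Z) r"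
proof -
  let ?P = "two_term_complex A m X Y f" and ?Q = "stalk_at A m Z"
  have ker: "is_kernel A Y Z g X f" and coker: "is_cokernel A X Y f Z g"
    using ses by (auto simp: short_exact_def)
  note f = is_kernelD[OF ker] and g = is_cokernelD[OF coker]
  have Ob: "X \<in> Ob A" "Y \<in> Ob A" "Z \<in> Ob A"
    using f g Mor_Ob by auto
  have P: "bounded_complex A ?P" and Q: "bounded_complex A ?Q"
    using Ob f by (auto intro: bounded_complex_stalk_at bounded_complex_two_term_complex)
  note ObP = bounded_complex_Ob[OF P] and ObQ = bounded_complex_Ob[OF Q]
    and dP = bounded_complex_cdiff(1)[OF P] and dQ = bounded_complex_cdiff(1)[OF Q]
  define r where "r n = (if n = m then g else mzero A (cob ?P n) (cob ?Q n))" for n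
  have rM: "r n \<in> Mor A (cob ?P n) (cob ?Q n)" for n
  proof (cases "n = m")
    case True
    then show ?thesis
      using g by (simp add: r_def two_term_complex_simps stalk_at_simps)
  next
    case False
    then show ?thesis
      using mzero_Mor[OF ObP ObQ] by (simp add: r_def)
  qed
  have r: "chain_map A ?P ?Q r"
    unfolding chain_map_def
  proof (intro conjI allI rM)
    fix n
    have "r (n + 1) \<cdot> cdiff ?P n = mzero A (cob ?P n) (cob ?Q (n + 1))"
    proof (cases "n + 1 = m")
      case True
      then show ?thesis
        using g by (auto simp: r_def two_term_complex_simps stalk_at_simps)
    next
      case False
      then have "r (n + 1) = mzero A (cob ?P (n + 1)) (cob ?Q (n + 1))"
        by (simp add: r_def)
      then show ?thesis
        using mzero_cmp[OF dP ObQ] by simp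
    qed
    then show "r (n + 1) \<cdot> cdiff ?P n = cdiff ?Q n \<cdot> r n"
      unfolding stalk_at_simps(2) mzero_cmp[OF rM ObQ] .
  qed
  have "is_isomorphism A (cohomology_ob A ?P n) (cohomology_ob A ?Q n) (cohomology_map A ?P ?Q r n)" for n
  proof (rule cohomology_map_isomorphismI[OF P Q r])
    have dQz: "cdiff ?Q (n - 1) \<cdot> z = mzero A T (cob ?Q n)"
      if "z \<in> Mor A T (cob ?Q (n - 1))" for T z
      using mzero_cmp[OF that ObQ] by (simp add: stalk_at_simps(2))
    fix T x z
    assume x: "cocycle A ?P n T x" and z: "z \<in> Mor A T (cob ?Q (n - 1))"
      and eq: "r n \<cdot> x = cdiff ?Q (n - 1) \<cdot> z"
    have xM: "x \<in> Mor A T (cob ?P n)" "cdiff ?P n \<cdot> x = mzero A T (cob ?P (n + 1))"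
      using x by (auto simp: cocycle_def)
    then have T: "T \<in> Ob A"
      using Mor_Ob by blast
    show "\<exists>y \<in> Mor A T (cob ?P (n - 1)). x = cdiff ?P (n - 1) \<cdot> y"
    proof (cases "n = m")
      case True
      have "x \<in> Mor A T Y" "g \<cdot> x = mzero A T Z"
        using xM eq dQz[OF z] True by (simp_all add: two_term_complex_simps stalk_at_simps r_def)
      then obtain y where "y \<in> Mor A T X" "f \<cdot> y = x"
        using is_kernel_factor[OF ker] by blast
      then show ?thesis
        using True by (auto simp: two_term_complex_simps)
    next
      case False
      have "x = mzero A T (cob ?P n)"
      proof (cases "n + 1 = m")
        case True
        then have "x \<in> Mor A T X" "f \<cdot> x = mzero A T Y"
          using xM by (auto simp: two_term_complex_simps)
        then have "x = mzero A T X"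
          using is_mono_mzeroD[OF is_kernel_mono[OF ker]] by blast
        then show ?thesis
          using True by (auto simp: two_term_complex_simps)
      next
        case neq: False
        then show ?thesis
          using xM(1) zero_object_Mor_to[OF zero_object_the_zero] False
          by (simp add: two_term_complex_simps)
      qed
      then have "x = cdiff ?P (n - 1) \<cdot> mzero A T (cob ?P (n - 1))"
        using cmp_mzero[OF bounded_complex_cdiff(2)[OF P] T] by simp
      then show ?thesis
        using mzero_Mor[OF T ObP] by blast
    qed
  next
    fix T y
    assume "cocycle A ?Q n T y"
    then have y: "y \<in> Mor A T (cob ?Q n)" and T: "T \<in> Ob A"
      using Mor_Ob by (auto simp: cocycle_def)
    show "\<exists>T' t x. is_epi A T' T t \<and> cocycle A ?P n T' x \<and> r n \<cdot> x = y \<cdot> t"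
    proof (cases "n = m")
      case True
      then have "y \<in> Mor A T Z"
        using y by (simp add: stalk_at_simps)
      then obtain T' t x where t: "is_epi A T' T t" and x: "x \<in> Mor A T' Y" "g \<cdot> x = y \<cdot> t"
        using epi_lift[OF is_cokernel_epi[OF coker]] by blast
      have x': "x \<in> Mor A T' (cob ?P n)"
        using x True by (simp add: two_term_complex_simps)
      have "cdiff ?P n = mzero A (cob ?P n) (cob ?P (n + 1))"
        using True by (simp add: two_term_complex_simps)
      then have "cdiff ?P n \<cdot> x = mzero A T' (cob ?P (n + 1))"
        using mzero_cmp[OF x' ObP] by simp
      then have "cocycle A ?P n T' x"
        using x' by (rule cocycleI[rotated])
      then show ?thesis
        using t x True unfolding r_def by auto
    next
      case False
      then have "y = mzero A T (cob ?Q n)"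
        using y zero_object_Mor_to[OF zero_object_the_zero] by (simp add: stalk_at_simps)
      then have "r n \<cdot> mzero A T (cob ?P n) = y \<cdot> idm A T"
        using cmp_mzero[OF rM T] idm_right[OF y] by simp
      moreover have "cocycle A ?P n T (mzero A T (cob ?P n))"
        by (rule cocycleI[OF mzero_Mor[OF T ObP] cmp_mzero[OF dP T]])
      ultimately show ?thesis
        using is_epi_idm[OF T] by blast
    qed
  qed
  then show ?thesis
    unfolding quasi_isomorphism_def using r by blast
qed

text \<open>The cone of \<open>f\<close> on stalks is the two-term complex, which is
  quasi-isomorphic to the stalk of the quotient. For \<open>m = 0\<close> this makes short exact
  sequences into conflations.\<close>

lemma short_exact_triangle:
  assumes ses: "short_exact A X Y Z f g"
  shows "\<exists>f g h. triangle A (stalk_at A m X) (stalk_at A m Y) (stalk_at A m Z) f g h"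
proof -
  have f: "f \<in> Mor A X Y" and g: "g \<in> Mor A Y Z"
    using ses by (auto simp: short_exact_def is_kernel_def)
  have Ob: "X \<in> Ob A" "Y \<in> Ob A" "Z \<in> Ob A"
    using f g Mor_Ob by auto
  note X = bounded_complex_stalk_at[OF Ob(1), of m] and Y = bounded_complex_stalk_at[OF Ob(2), of m]
    and Z = bounded_complex_stalk_at[OF Ob(3), of m] and C = bounded_complex_two_term_complex[OF f, of m]
    and u = chain_map_stalk_map[OF f, of m]
  obtain v w where cone: "mapping_cone A (stalk_at A m X) (stalk_at A m Y) (stalk_map m f)
    (two_term_complex A m X Y f) v w"
    using mapping_cone_stalk_map[OF f] by blast
  obtain r where "quasi_isomorphism A (two_term_complex A m X Y f) (stalk_at A m Z) r"
    using quasi_isomorphism_two_term_complex[OF ses] by blast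
  then show ?thesis
    using quasi_isomorphism_triangle[OF X Y C Z u cone mapping_cone_chain_maps[OF X Y C u cone]] by blast
qed

text \<open>The two-term complex of the map from \<open>X\<close> to zero is literally the stalk of
  \<open>X\<close> one degree lower, so the identity serves as the quasi-isomorphism.\<close>

lemma shift_triangle:
  assumes X: "X \<in> Ob A"
  shows "\<exists>f g h. triangle A (stalk_at A m X) (stalk_at A m (the_zero A)) (stalk_at A (m - 1) X) f g h"
proof -
  let ?f = "mzero A X (the_zero A)"
  have f: "?f \<in> Mor A X (the_zero A)"
    using X the_zero_Ob by (rule mzero_Mor)
  have "cob (two_term_complex A m X (the_zero A) ?f) = cob (stalk_at A (m - 1) X)"
    by (auto simp: fun_eq_iff two_term_complex_simps stalk_at_simps)
  moreover have "cdiff (two_term_complex A m X (the_zero A) ?f) = cdiff (stalk_at A (m - 1) X)"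
    by (auto simp: fun_eq_iff two_term_complex_simps stalk_at_simps)
  ultimately have eq: "two_term_complex A m X (the_zero A) ?f = stalk_at A (m - 1) X"
    by simp
  note X' = bounded_complex_stalk_at[OF X, of m] and Y = bounded_complex_stalk_at[OF the_zero_Ob, of m]
    and C = bounded_complex_stalk_at[OF X, of "m - 1"] and u = chain_map_stalk_map[OF f, of m]
  obtain v w where cone: "mapping_cone A (stalk_at A m X) (stalk_at A m (the_zero A)) (stalk_map m ?f)
    (stalk_at A (m - 1) X) v w"
    using mapping_cone_stalk_map[OF f, of m] unfolding eq by blast
  have "cohomology_map A V V (\<lambda>n. idm A (cob V n)) n = idm A (cohomology_ob A V n)"
    if "bounded_complex A V" for V n
    using is_functor_cohomology[of n] that unfolding is_functor_def bounded_complexes_simps by blast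
  then have "quasi_isomorphism A (stalk_at A (m - 1) X) (stalk_at A (m - 1) X)
      (\<lambda>n. idm A (cob (stalk_at A (m - 1) X) n))"
    unfolding quasi_isomorphism_def
    using chain_map_idm[OF C] C is_isomorphism_idm[OF cohomology_ob_Ob[OF C]] by simp
  then show ?thesis
    using quasi_isomorphism_triangle[OF X' Y C C u cone mapping_cone_chain_maps[OF X' Y C u cone]] by blast
qed

text \<open>Lets additivity imply isomorphism invariance: with a zero end term, the relation of the
  sequence identifies the classes of \<open>X\<close> and \<open>Y\<close>. Applied to an identity,
  it also provides the triangle that places \<open>T[1]\<close> in \<open>F[1] * A\<close>.\<close>

lemma short_exact_isomorphism:
  assumes f: "is_isomorphism A X Y f" and Z: "zero_object A Z"
  shows "short_exact A X Y Z f (mzero A Y Z)"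
proof -
  obtain g where fg: "f \<in> Mor A X Y" "g \<in> Mor A Y X" "g \<cdot> f = idm A X" "f \<cdot> g = idm A Y"
    using f unfolding is_isomorphism_def by blast
  have Ob: "X \<in> Ob A" "Y \<in> Ob A" "Z \<in> Ob A"
    using Mor_Ob[OF fg(1)] Z by (auto simp: zero_object_iff)
  note z = mzero_Mor[OF Ob(2,3)]
  have zf: "mzero A Y Z \<cdot> f = mzero A X Z"
    by (rule mzero_cmp[OF fg(1) Ob(3)])
  have "is_mono A X Y f"
  proof (rule is_monoI[OF fg(1)])
    show "h = mzero A W X" if h: "h \<in> Mor A W X" "f \<cdot> h = mzero A W Y" for W h
      using cmp_assoc[OF h(1) fg(1,2)] fg(3) idm_left[OF h(1)] h(2) cmp_mzero[OF fg(2)] Mor_Ob[OF h(1)]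
      by simp
  qed
  then have "is_kernel A Y Z (mzero A Y Z) X f"
  proof (rule is_kernelI[OF z _ zf])
    show "\<exists>u \<in> Mor A W X. f \<cdot> u = h" if h: "h \<in> Mor A W Y" for W h
      using cmp_assoc[OF h(1) fg(2,1)] fg(4) idm_left[OF h(1)] cmp_Mor[OF h fg(2)] by metis
  qed
  moreover have "is_epi A Y Z (mzero A Y Z)"
    using zero_object_Mor_from[OF Z] by (intro is_epiI[OF z])
  then have "is_cokernel A X Y f Z (mzero A Y Z)"
  proof (rule is_cokernelI[OF fg(1) _ zf])
    fix W h
    assume h: "h \<in> Mor A Y W" "h \<cdot> f = mzero A X W"
    then have W: "W \<in> Ob A"
      using Mor_Ob by blast
    have "h = mzero A Y W"
      using cmp_assoc[OF fg(2,1) h(1)] fg(4) idm_right[OF h(1)] h(2) mzero_cmp[OF fg(2) W] by simp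
    then have "mzero A Z W \<cdot> mzero A Y Z = h"
      using mzero_cmp[OF z W] by simp
    then show "\<exists>u \<in> Mor A Z W. u \<cdot> mzero A Y Z = h"
      using mzero_Mor[OF Ob(3) W] by blast
  qed
  ultimately show ?thesis
    by (simp add: short_exact_def)
qed

text \<open>Supplies the triangle with zero first term that places stalks in
  \<open>F[1] * A\<close>.\<close>

lemma short_exact_zero_left:
  assumes Z: "zero_object A Z" and Y: "Y \<in> Ob A"
  shows "short_exact A Z Y Y (mzero A Z Y) (idm A Y)"
proof -
  have Z': "Z \<in> Ob A"
    using Z by (simp add: zero_object_iff)
  note id = idm_Mor[OF Y] and z = mzero_Mor[OF Z' Y]
  have idz: "idm A Y \<cdot> mzero A Z Y = mzero A Z Y"
    by (rule idm_left[OF z])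
  have "is_mono A Z Y (mzero A Z Y)"
    using zero_object_Mor_to[OF Z] by (intro is_monoI[OF z])
  then have "is_kernel A Y Y (idm A Y) Z (mzero A Z Y)"
  proof (rule is_kernelI[OF id _ idz])
    fix W h
    assume h: "h \<in> Mor A W Y" "idm A Y \<cdot> h = mzero A W Y"
    then have W: "W \<in> Ob A"
      using Mor_Ob by blast
    have "mzero A Z Y \<cdot> mzero A W Z = h"
      using h idm_left[OF h(1)] cmp_mzero[OF z W] by simp
    then show "\<exists>u \<in> Mor A W Z. mzero A Z Y \<cdot> u = h"
      using mzero_Mor[OF W Z'] by blast
  qed
  moreover have "is_cokernel A Z Y (mzero A Z Y) Y (idm A Y)"
    using is_epi_idm[OF Y] idz idm_right by (intro is_cokernelI[OF z]) blast+
  ultimately show ?thesis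
    by (simp add: short_exact_def)
qed

end

section \<open>Grothendieck monoids\<close>

lemma with_short_exact_simps:
  "Ob (with_short_exact A) = Ob A"
  "isomorphic (with_short_exact A) X Y \<longleftrightarrow> isomorphic A X Y"
  "zero_object (with_short_exact A) Z \<longleftrightarrow> zero_object A Z"
  "conflation (with_short_exact A) = short_exact A"
  by (simp_all add: with_short_exact_def isomorphic_def is_isomorphism_def zero_object_def)

lemma shifted_star_category_simps:
  "Ob (shifted_star_category A F) = shifted_star A F"
  "conflation (shifted_star_category A F) X Y Z f g \<longleftrightarrow>
    X \<in> shifted_star A F \<and> Y \<in> shifted_star A F \<and> Z \<in> shifted_star A F \<and> (\<exists>h. triangle A X Y Z f g h)"
  by (simp_all add: shifted_star_category_def)

lemma shifted_star_category_Mor: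
  "X \<in> shifted_star A F \<Longrightarrow> Y \<in> shifted_star A F \<Longrightarrow>
    Mor (shifted_star_category A F) X Y = Mor (derived_category A) X Y"
  by (simp add: shifted_star_category_def)

lemma shifted_star_derived: "X \<in> shifted_star A F \<Longrightarrow> X \<in> Ob (derived_category A)"
  by (simp add: shifted_star_def)

lemma shifted_star_isomorphic:
  assumes "isomorphic (shifted_star_category A F) X Y"
  shows "isomorphic (derived_category A) X Y"
  using assms unfolding isomorphic_def is_isomorphism_def
  by (auto simp: shifted_star_category_def split: if_splits)

section \<open>Monoid homomorphisms and uniqueness in the two universal properties\<close>

lemma monoid_hom_cmp: "g \<in> monoid_hom M N \<Longrightarrow> h \<in> monoid_hom N P \<Longrightarrow> h \<circ> g \<in> monoid_hom M P"
  by (auto simp: monoid_hom_def hom_def Pi_iff)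

lemma monoid_hom_id: "id \<in> monoid_hom M M"
  by (auto simp: monoid_hom_def hom_def)

lemma monoid_homD:
  assumes "h \<in> monoid_hom M N"
  shows "x \<in> carrier M \<Longrightarrow> h x \<in> carrier N"
    and "x \<in> carrier M \<Longrightarrow> y \<in> carrier M \<Longrightarrow> h (x \<otimes>\<^bsub>M\<^esub> y) = h x \<otimes>\<^bsub>N\<^esub> h y"
    and "h \<one>\<^bsub>M\<^esub> = \<one>\<^bsub>N\<^esub>"
  using assms by (auto simp: monoid_hom_def hom_def)

lemma monoid_hom_Units:
  assumes h: "h \<in> monoid_hom M N" and x: "x \<in> Units M"
  shows "h x \<in> Units N"
proof -
  obtain y where y: "x \<in> carrier M" "y \<in> carrier M" "y \<otimes>\<^bsub>M\<^esub> x = \<one>\<^bsub>M\<^esub>" "x \<otimes>\<^bsub>M\<^esub> y = \<one>\<^bsub>M\<^esub>"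
    using x unfolding Units_def by blast
  then have "h y \<otimes>\<^bsub>N\<^esub> h x = \<one>\<^bsub>N\<^esub>" "h x \<otimes>\<^bsub>N\<^esub> h y = \<one>\<^bsub>N\<^esub>"
    using monoid_homD[OF h] by metis+
  then show ?thesis
    unfolding Units_def using monoid_homD(1)[OF h] y by blast
qed

text \<open>Uniqueness in the universal property, applied to the additive function on objects that
  \<open>h\<close> itself defines.\<close>

lemma grothendieck_monoid_hom_ext:
  assumes N: "comm_monoid N"
    and h: "h \<in> monoid_hom (grothendieck_monoid C) N" "h' \<in> monoid_hom (grothendieck_monoid C) N"
    and eq: "\<And>X. X \<in> Ob C \<Longrightarrow> h (gm_class C X) = h' (gm_class C X)"
    and P: "P \<in> carrier (grothendieck_monoid C)"
  shows "h P = h' P"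
proof -
  note hD = monoid_homD[OF h(1)] and rel = gm_class_relations[where C = C]
  have "\<exists>g \<in> monoid_hom (grothendieck_monoid C) N. (\<forall>X \<in> Ob C. g (gm_class C X) = h (gm_class C X)) \<and>
    (\<forall>g' \<in> monoid_hom (grothendieck_monoid C) N. (\<forall>X \<in> Ob C. g' (gm_class C X) = h (gm_class C X)) \<longrightarrow>
       (\<forall>P \<in> carrier (grothendieck_monoid C). g' P = g P))"
  proof (rule grothendieck_monoid_universal[OF N])
    show "h (gm_class C X) \<in> carrier N" if "X \<in> Ob C" for X
      using hD(1) rel(1) that by blast
    show "h (gm_class C X) = h (gm_class C Y)" if "X \<in> Ob C" "Y \<in> Ob C" "isomorphic C X Y" for X Y
      using rel(2)[OF that] by simp
    show "h (gm_class C Z) = \<one>\<^bsub>N\<^esub>" if "zero_object C Z" for Z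
      using rel(3)[OF that] hD(3) by simp
    show "h (gm_class C Y) = h (gm_class C X) \<otimes>\<^bsub>N\<^esub> h (gm_class C Z)"
      if "X \<in> Ob C" "Y \<in> Ob C" "Z \<in> Ob C" "conflation C X Y Z f g" for X Y Z f g
      using rel(4)[OF that] hD(2)[OF rel(1)[OF that(1)] rel(1)[OF that(3)]] by simp
  qed
  then obtain g where g: "\<forall>g' \<in> monoid_hom (grothendieck_monoid C) N.
      (\<forall>X \<in> Ob C. g' (gm_class C X) = h (gm_class C X)) \<longrightarrow>
      (\<forall>P \<in> carrier (grothendieck_monoid C). g' P = g P)"
    by blast
  have "h P = g P"
    using g h(1) P by blast
  moreover have "h' P = g P"
    using g h(2) P eq by simp
  ultimately show ?thesis
    by simp
qed

text \<open>Uniqueness again, now for the homomorphism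
  \<open>h \<circ> localization_map M S\<close>, which inverts \<open>S\<close> because
  \<open>h\<close> preserves units.\<close>

lemma monoid_localization_hom_ext:
  assumes M: "comm_monoid M" and S: "S \<subseteq> carrier M" and N: "comm_monoid N"
    and h: "h \<in> monoid_hom (monoid_localization M S) N" "h' \<in> monoid_hom (monoid_localization M S) N"
    and eq: "\<And>x. x \<in> carrier M \<Longrightarrow> h (localization_map M S x) = h' (localization_map M S x)"
    and P: "P \<in> carrier (monoid_localization M S)"
  shows "h P = h' P"
proof -
  have g: "h \<circ> localization_map M S \<in> monoid_hom M N"
    using monoid_hom_cmp[OF localization_map_hom[OF M S] h(1)] .
  have "(h \<circ> localization_map M S) s \<in> Units N" if "s \<in> S" for s
    using monoid_hom_Units[OF h(1) localization_map_inverts[OF M S that]] by simp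
  from monoid_localization_universal[OF M S N g this] obtain k where k:
    "\<forall>h' \<in> monoid_hom (monoid_localization M S) N.
      (\<forall>x \<in> carrier M. h' (localization_map M S x) = (h \<circ> localization_map M S) x) \<longrightarrow>
      (\<forall>P \<in> carrier (monoid_localization M S). h' P = k P)"
    by blast
  have "h P = k P"
    using k h(1) P by simp
  moreover have "h' P = k P"
    using k h(2) P eq by simp
  ultimately show ?thesis
    by simp
qed

lemma (in comm_monoid) Units_if_inverse:
  assumes "x \<in> carrier G" "y \<in> carrier G" "x \<otimes> y = \<one>"
  shows "x \<in> Units G"
proof -
  have "y \<otimes> x = \<one>"
    using m_comm[OF assms(1,2)] assms(3) by simp
  then show ?thesis
    using assms unfolding Units_def by blast
qed

text \<open>Passes from the subtraction-free relation to additivity of fractions. The indices 1, 2,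
  3 stand for the three terms of a triangle, \<open>b\<close> for the class of cohomology in degree
  -1 and \<open>c\<close> for the class in degree 0.\<close>

lemma (in comm_monoid) fraction_mult_eq:
  assumes b: "b1 \<in> Units G" "b2 \<in> Units G" "b3 \<in> Units G"
    and c: "c1 \<in> carrier G" "c2 \<in> carrier G" "c3 \<in> carrier G"
    and eq: "b1 \<otimes> b3 \<otimes> c2 = b2 \<otimes> c1 \<otimes> c3"
  shows "c2 \<otimes> inv b2 = c1 \<otimes> inv b1 \<otimes> (c3 \<otimes> inv b3)"
proof -
  note i = b[THEN Units_inv_closed] b[THEN Units_closed]
  \<comment> \<open>The factors \<open>b1\<close> and \<open>b3\<close> are inserted with their
    inverses so that the left side of \<open>eq\<close> appears.\<close>
  have "c2 \<otimes> inv b2 = c2 \<otimes> inv b2 \<otimes> (b1 \<otimes> inv b1) \<otimes> (b3 \<otimes> inv b3)"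
    using b c i by simp
  also have "\<dots> = b1 \<otimes> b3 \<otimes> c2 \<otimes> (inv b1 \<otimes> inv b2 \<otimes> inv b3)"
    using c i by (simp add: m_ac del: Units_r_inv Units_l_inv)
  also have "\<dots> = c1 \<otimes> inv b1 \<otimes> (c3 \<otimes> inv b3) \<otimes> (b2 \<otimes> inv b2)"
    unfolding eq using c i by (simp add: m_ac del: Units_r_inv Units_l_inv)
  also have "\<dots> = c1 \<otimes> inv b1 \<otimes> (c3 \<otimes> inv b3)"
    using b c i by simp
  finally show ?thesis .
qed

section \<open>From triangles to relations between classes\<close>

context abelian_category
begin

lemma zero_object_isomorphic:
  assumes "isomorphic A X Y" and X: "zero_object A X"
  shows "zero_object A Y"
proof -
  obtain f g where fg: "f \<in> Mor A X Y" "g \<in> Mor A Y X" "f \<cdot> g = idm A Y"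
    using assms(1) unfolding isomorphic_def is_isomorphism_def by blast
  have "f = mzero A X Y"
    using zero_object_Mor_from[OF X fg(1)] .
  then have "idm A Y = mzero A Y Y"
    using mzero_cmp[OF fg(2)] fg Mor_Ob by metis
  then show ?thesis
    using Mor_Ob[OF fg(1)] by (simp add: zero_object_iff)
qed

lemma zero_objects_isomorphic:
  assumes X: "zero_object A X" and Y: "zero_object A Y"
  shows "isomorphic A X Y"
proof -
  have Ob: "X \<in> Ob A" "Y \<in> Ob A"
    using X Y by (auto simp: zero_object_iff)
  have "mzero A Y X \<cdot> mzero A X Y = idm A X" "mzero A X Y \<cdot> mzero A Y X = idm A Y"
    using X Y Ob by (simp_all add: zero_object_iff mzero_cmp[OF mzero_Mor])
  then show ?thesis
    unfolding isomorphic_def is_isomorphism_def using mzero_Mor Ob by blast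
qed

text \<open>After an epimorphism, the identity of the cohomology object is represented by a cocycle
  in a zero object, so the identity itself vanishes.\<close>

lemma zero_object_cohomology:
  assumes X: "bounded_complex A X" and zero: "zero_object A (cob X n)"
  shows "zero_object A (cohomology_ob A X n)"
proof -
  note Ob = cohomology_ob_Ob[OF X, of n]
  note id = idm_Mor[OF Ob]
  obtain T t x where t: "is_epi A T (cohomology_ob A X n) t" and x: "cocycle A X n T x"
    "cohomology_class A X n T x = idm A (cohomology_ob A X n) \<cdot> t"
    using cohomology_class_surj[OF X id] by blast
  have "x = mzero A T (cob X n)"
    using x(1) zero_object_Mor_to[OF zero] by (simp add: cocycle_def)
  then have "idm A (cohomology_ob A X n) \<cdot> t = mzero A T (cohomology_ob A X n)"
    using x(2) cohomology_class_mzero[OF X] Mor_Ob[OF is_epi_Mor[OF t]] by simp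
  then show ?thesis
    using is_epi_mzeroD[OF t id] Ob by (simp add: zero_object_iff)
qed

lemma zero_object_cohomology_stalk_at:
  "X \<in> Ob A \<Longrightarrow> n \<noteq> m \<Longrightarrow> zero_object A (cohomology_ob A (stalk_at A m X) n)"
  by (rule zero_object_cohomology[OF bounded_complex_stalk_at])
    (simp_all add: stalk_at_simps zero_object_the_zero)

text \<open>All differentials vanish, so every element is a cocycle and every boundary is zero; the
  class of the identity of \<open>X\<close> is the isomorphism.\<close>

lemma cohomology_stalk_at:
  assumes X: "X \<in> Ob A"
  shows "isomorphic A X (cohomology_ob A (stalk_at A m X) m)"
proof -
  let ?S = "stalk_at A m X"
  note S = bounded_complex_stalk_at[OF X, of m]
  have cob: "cob ?S m = X"
    by (simp add: stalk_at_simps)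
  note Ob = bounded_complex_Ob[OF S]
  have cocycle: "cocycle A ?S m T x" if "x \<in> Mor A T X" for T x
    using that mzero_cmp[OF that Ob] by (simp add: cocycle_def stalk_at_simps(2) cob)
  define c where "c = cohomology_class A ?S m X (idm A X)"
  note id = cocycle[OF idm_Mor[OF X]]
  have cM: "c \<in> Mor A X (cohomology_ob A ?S m)"
    unfolding c_def by (rule cohomology_class_Mor[OF S id])
  have c: "cohomology_class A ?S m T x = c \<cdot> x" if "x \<in> Mor A T X" for T x
    using cohomology_class_cmp[OF S id that] idm_left[OF that] by (simp add: c_def)
  have "is_mono A X (cohomology_ob A ?S m) c"
  proof (rule is_monoI[OF cM])
    fix T x
    assume x: "x \<in> Mor A T X" "c \<cdot> x = mzero A T (cohomology_ob A ?S m)"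
    then obtain T' t y where t: "is_epi A T' T t" "y \<in> Mor A T' (cob ?S (m - 1))"
      "cdiff ?S (m - 1) \<cdot> y = x \<cdot> t"
      using cohomology_class_zeroD[OF S cocycle[OF x(1)]] c[OF x(1)] by auto
    have "x \<cdot> t = mzero A T' X"
      using t(3) mzero_cmp[OF t(2) Ob, of m] by (simp add: stalk_at_simps(2) cob)
    then show "x = mzero A T X"
      using is_epi_mzeroD[OF t(1) x(1)] by blast
  qed
  moreover have "is_epi A X (cohomology_ob A ?S m) c"
  proof -
    obtain T t x where t: "is_epi A T (cohomology_ob A ?S m) t" "cocycle A ?S m T x"
      "cohomology_class A ?S m T x = idm A (cohomology_ob A ?S m) \<cdot> t"
      using cohomology_class_surj[OF S idm_Mor[OF cohomology_ob_Ob[OF S]]] by blast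
    then have "x \<in> Mor A T X" "c \<cdot> x = t"
      using c idm_left[OF is_epi_Mor[OF t(1)]] by (simp_all add: cocycle_def cob)
    then show ?thesis
      using is_epi_rightI[OF cM] t(1) by simp
  qed
  ultimately show ?thesis
    unfolding isomorphic_def using mono_epi_is_isomorphism by blast
qed

lemma shift_stalk: "T \<in> Ob A \<Longrightarrow> shift A (stalk A T) = stalk_at A (-1) T"
  using shift_stalk_at[of T 0] by (simp add: stalk_eq_stalk_at)

lemma exact_at_gm_class:
  assumes "exact_at X Y Z f g" "is_kernel A X Y f K k" "is_kernel A Y Z g L l"
  shows "gm_class (with_short_exact A) X = gm_class (with_short_exact A) K
    \<otimes>\<^bsub>grothendieck_monoid (with_short_exact A)\<^esub> gm_class (with_short_exact A) L"
proof -
  obtain p where "short_exact A K X L k p"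
    using exact_at_short_exact[OF assms] by blast
  moreover have "K \<in> Ob A" "X \<in> Ob A" "L \<in> Ob A"
    using is_kernelD(2) assms(2,3) Mor_Ob by blast+
  ultimately show ?thesis
    using gm_class_relations(4)[of K "with_short_exact A" X L k p] by (simp add: with_short_exact_simps)
qed

text \<open>The class of each term is the sum of the classes of the kernel of its own outgoing map
  and of the next one, so both sides expand to the same sum. At the ends, the zero object
  \<open>X0\<close> is the kernel of \<open>f1\<close>, and all of \<open>X6\<close> is the kernel
  of \<open>f6\<close> because \<open>X7\<close> is zero.\<close>

lemma six_term_gm_class:
  assumes zero: "zero_object A X0" "zero_object A X7"
    and ex: "exact_at X0 X1 X2 f0 f1" "exact_at X1 X2 X3 f1 f2" "exact_at X2 X3 X4 f2 f3"
      "exact_at X3 X4 X5 f3 f4" "exact_at X4 X5 X6 f4 f5" "exact_at X5 X6 X7 f5 f6"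
  defines "M \<equiv> grothendieck_monoid (with_short_exact A)" and "c \<equiv> gm_class (with_short_exact A)"
  shows "c X1 \<otimes>\<^bsub>M\<^esub> c X3 \<otimes>\<^bsub>M\<^esub> c X5 = c X2 \<otimes>\<^bsub>M\<^esub> c X4 \<otimes>\<^bsub>M\<^esub> c X6"
proof -
  interpret M: comm_monoid M
    unfolding M_def by (rule comm_monoid_grothendieck_monoid)
  have f: "f0 \<in> Mor A X0 X1" "f1 \<in> Mor A X1 X2" "f2 \<in> Mor A X2 X3" "f3 \<in> Mor A X3 X4"
    "f4 \<in> Mor A X4 X5" "f5 \<in> Mor A X5 X6" "f6 \<in> Mor A X6 X7"
    using ex unfolding exact_at_def by blast+
  obtain K2 k2 K3 k3 K4 k4 K5 k5 where K: "is_kernel A X2 X3 f2 K2 k2" "is_kernel A X3 X4 f3 K3 k3"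
    "is_kernel A X4 X5 f4 K4 k4" "is_kernel A X5 X6 f5 K5 k5"
    using ex_kernel f by meson
  have K1: "is_kernel A X1 X2 f1 X0 f0"
  proof (rule is_kernelI[OF f(2)])
    show "is_mono A X0 X1 f0"
      using zero_object_Mor_to[OF zero(1)] by (intro is_monoI[OF f(1)])
    show "f1 \<cdot> f0 = mzero A X0 X2"
      using ex(1) by (simp add: exact_at_def)
    fix W h
    assume h: "h \<in> Mor A W X1" "f1 \<cdot> h = mzero A W X2"
    then obtain T e x where e: "is_epi A T W e" "x \<in> Mor A T X0" "f0 \<cdot> x = h \<cdot> e"
      using ex(1) unfolding exact_at_def by blast
    have Ob: "T \<in> Ob A" "W \<in> Ob A" "X0 \<in> Ob A"
      using Mor_Ob e(2) h(1) by auto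
    have "h \<cdot> e = mzero A T X1"
      using e(3) zero_object_Mor_to[OF zero(1) e(2)] cmp_mzero[OF f(1) Ob(1)] by simp
    then have "h = mzero A W X1"
      using is_epi_mzeroD[OF e(1) h(1)] by blast
    then show "\<exists>u \<in> Mor A W X0. f0 \<cdot> u = h"
      using cmp_mzero[OF f(1) Ob(2)] mzero_Mor[OF Ob(2,3)] by blast
  qed
  have X6: "X6 \<in> Ob A"
    using Mor_Ob[OF f(7)] by blast
  have K6: "is_kernel A X6 X7 f6 X6 (idm A X6)"
  proof (rule is_kernelI[OF f(7)])
    show "is_mono A X6 X6 (idm A X6)"
      using idm_left by (intro is_monoI[OF idm_Mor[OF X6]]) metis
    show "f6 \<cdot> idm A X6 = mzero A X6 X7"
      using zero_object_Mor_to[OF zero(2) f(7)] idm_right[OF f(7)] by simp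
    show "\<exists>u \<in> Mor A W X6. idm A X6 \<cdot> u = h" if "h \<in> Mor A W X6" for W h
      using idm_left[OF that] that by blast
  qed
  have cM: "c V \<in> carrier M" if "V \<in> Ob A" for V
    unfolding c_def M_def using that by (intro gm_class_relations(1)) (simp add: with_short_exact_simps)
  have carr: "c K2 \<in> carrier M" "c K3 \<in> carrier M" "c K4 \<in> carrier M" "c K5 \<in> carrier M" "c X6 \<in> carrier M"
    using K[THEN is_kernelD(2)] Mor_Ob X6 by (blast intro: cM)+
  have one: "c X0 = \<one>\<^bsub>M\<^esub>"
    unfolding c_def M_def using zero(1) by (intro gm_class_relations(3)) (simp add: with_short_exact_simps)
  have "c X1 = c K2" "c X2 = c K2 \<otimes>\<^bsub>M\<^esub> c K3" "c X3 = c K3 \<otimes>\<^bsub>M\<^esub> c K4" "c X4 = c K4 \<otimes>\<^bsub>M\<^esub> c K5"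
    "c X5 = c K5 \<otimes>\<^bsub>M\<^esub> c X6"
    using exact_at_gm_class[OF ex(2) K1 K(1)] exact_at_gm_class[OF ex(3) K(1,2)]
      exact_at_gm_class[OF ex(4) K(2,3)] exact_at_gm_class[OF ex(5) K(3,4)]
      exact_at_gm_class[OF ex(6) K(4) K6] one carr
    by (simp_all add: c_def[symmetric] M_def[symmetric])
  then show ?thesis
    using carr by (simp add: M.m_ac)
qed

text \<open>Keeps, of the isomorphism with a cone, what it says about cohomology objects up to
  isomorphism, which is all that classes in \<open>M(A)\<close> detect.\<close>

lemma triangle_isomorphic_cone:
  assumes "triangle A X Y Z f g h"
  obtains X' Y' Z' u v w where
    "bounded_complex A X'" "bounded_complex A Y'" "bounded_complex A Z'"
    "chain_map A X' Y' u" "mapping_cone A X' Y' u Z' v w"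
    "\<And>n. isomorphic A (cohomology_ob A X n) (cohomology_ob A X' n)"
    "\<And>n. isomorphic A (cohomology_ob A Y n) (cohomology_ob A Y' n)"
    "\<And>n. isomorphic A (cohomology_ob A Z n) (cohomology_ob A Z' n)"
proof -
  obtain X' Y' Z' u v w a b c where *: "bounded_complex A X'" "bounded_complex A Y'" "bounded_complex A Z'"
    "chain_map A X' Y' u" "mapping_cone A X' Y' u Z' v w"
    "is_isomorphism (derived_category A) X X' a" "is_isomorphism (derived_category A) Y Y' b"
    "is_isomorphism (derived_category A) Z Z' c"
    using assms unfolding triangle_def by blast
  then have "isomorphic (derived_category A) X X'" "isomorphic (derived_category A) Y Y'"
    "isomorphic (derived_category A) Z Z'"
    unfolding isomorphic_def by blast+
  then show thesis
    using that[OF *(1-5)] derived_isomorphic_cohomology by blast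
qed

text \<open>The two vanishing hypotheses concern the neighbours of the six terms in the long exact
  sequence: degree -2 of \<open>Z\<close> on the left and degree 1 of \<open>X\<close> on the
  right.\<close>

lemma triangle_gm_class:
  assumes tri: "triangle A X Y Z f g h"
    and zero: "zero_object A (cohomology_ob A Z (-2))" "zero_object A (cohomology_ob A X 1)"
  defines "M \<equiv> grothendieck_monoid (with_short_exact A)" and "c \<equiv> gm_class (with_short_exact A)"
  shows "c (cohomology_ob A X (-1)) \<otimes>\<^bsub>M\<^esub> c (cohomology_ob A Z (-1)) \<otimes>\<^bsub>M\<^esub> c (cohomology_ob A Y 0) =
    c (cohomology_ob A Y (-1)) \<otimes>\<^bsub>M\<^esub> c (cohomology_ob A X 0) \<otimes>\<^bsub>M\<^esub> c (cohomology_ob A Z 0)"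
proof -
  obtain X' Y' Z' u v w where *: "bounded_complex A X'" "bounded_complex A Y'" "bounded_complex A Z'"
    "chain_map A X' Y' u" "mapping_cone A X' Y' u Z' v w"
    and iso: "\<And>n. isomorphic A (cohomology_ob A X n) (cohomology_ob A X' n)"
    "\<And>n. isomorphic A (cohomology_ob A Y n) (cohomology_ob A Y' n)"
    "\<And>n. isomorphic A (cohomology_ob A Z n) (cohomology_ob A Z' n)"
    using triangle_isomorphic_cone[OF tri] by blast
  have c_iso: "c V = c W" if iso: "isomorphic A V W" for V W
  proof -
    have "V \<in> Ob A" "W \<in> Ob A"
      using iso Mor_Ob unfolding isomorphic_def is_isomorphism_def by blast+
    then show ?thesis
      unfolding c_def using iso by (intro gm_class_relations(2)) (simp_all add: with_short_exact_simps)
  qed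
  note exX = mapping_cone_exact_at_X[OF *] and exY = mapping_cone_exact_at_Y[OF *]
    and exZ = mapping_cone_exact_at_Z[OF *]
  have "c (cohomology_ob A X' (-1)) \<otimes>\<^bsub>M\<^esub> c (cohomology_ob A Z' (-1)) \<otimes>\<^bsub>M\<^esub> c (cohomology_ob A Y' 0) =
    c (cohomology_ob A Y' (-1)) \<otimes>\<^bsub>M\<^esub> c (cohomology_ob A X' 0) \<otimes>\<^bsub>M\<^esub> c (cohomology_ob A Z' 0)"
    unfolding c_def M_def
  proof (rule six_term_gm_class)
    show "zero_object A (cohomology_ob A Z' (-2))" "zero_object A (cohomology_ob A X' 1)"
      using zero_object_isomorphic iso zero by blast+
    show "exact_at (cohomology_ob A Z' (-2)) (cohomology_ob A X' (-1)) (cohomology_ob A Y' (-1))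
        (cohomology_map A Z' (shift A X') w (-2)) (cohomology_map A X' Y' u (-1))"
      using exX[of "-2"] by simp
    show "exact_at (cohomology_ob A X' (-1)) (cohomology_ob A Y' (-1)) (cohomology_ob A Z' (-1))
        (cohomology_map A X' Y' u (-1)) (cohomology_map A Y' Z' v (-1))"
      by (rule exY)
    show "exact_at (cohomology_ob A Y' (-1)) (cohomology_ob A Z' (-1)) (cohomology_ob A X' 0)
        (cohomology_map A Y' Z' v (-1)) (cohomology_map A Z' (shift A X') w (-1))"
      using exZ[of "-1"] by simp
    show "exact_at (cohomology_ob A Z' (-1)) (cohomology_ob A X' 0) (cohomology_ob A Y' 0)
        (cohomology_map A Z' (shift A X') w (-1)) (cohomology_map A X' Y' u 0)"
      using exX[of "-1"] by simp
    show "exact_at (cohomology_ob A X' 0) (cohomology_ob A Y' 0) (cohomology_ob A Z' 0)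
        (cohomology_map A X' Y' u 0) (cohomology_map A Y' Z' v 0)"
      by (rule exY)
    show "exact_at (cohomology_ob A Y' 0) (cohomology_ob A Z' 0) (cohomology_ob A X' 1)
        (cohomology_map A Y' Z' v 0) (cohomology_map A Z' (shift A X') w 0)"
      using exZ[of 0] by simp
  qed
  then show ?thesis
    unfolding c_iso[OF iso(1)] c_iso[OF iso(2)] c_iso[OF iso(3)] .
qed

lemma exact_at_zero_isomorphism:
  assumes ex: "exact_at W X Y d f" "exact_at X Y Z f g"
    and W: "zero_object A W" and Z: "zero_object A Z"
  shows "is_isomorphism A X Y f"
proof (rule mono_epi_is_isomorphism)
  have f: "f \<in> Mor A X Y" "d \<in> Mor A W X" "g \<in> Mor A Y Z"
    using ex by (auto simp: exact_at_def)
  show "is_mono A X Y f"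
  proof (rule is_monoI[OF f(1)])
    fix T x
    assume x: "x \<in> Mor A T X" "f \<cdot> x = mzero A T Y"
    then obtain T' e y where e: "is_epi A T' T e" "y \<in> Mor A T' W" "d \<cdot> y = x \<cdot> e"
      using ex(1) unfolding exact_at_def by blast
    then have "x \<cdot> e = mzero A T' X"
      using zero_object_Mor_to[OF W e(2)] cmp_mzero[OF f(2)] Mor_Ob[OF e(2)] by simp
    then show "x = mzero A T X"
      using is_epi_mzeroD[OF e(1) x(1)] by blast
  qed
  have "Y \<in> Ob A"
    using Mor_Ob[OF f(1)] by blast
  note id = idm_Mor[OF this]
  have "g \<cdot> idm A Y = mzero A Y Z"
    using idm_right[OF f(3)] zero_object_Mor_to[OF Z f(3)] by simp
  then obtain T' e x where "is_epi A T' Y e" "x \<in> Mor A T' X" "f \<cdot> x = idm A Y \<cdot> e"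
    using ex(2) id unfolding exact_at_def by blast
  then show "is_epi A X Y f"
    using is_epi_rightI[OF f(1)] idm_left[OF is_epi_Mor] by metis
qed

lemma exact_at_zero_object:
  assumes ex: "exact_at X Y Z f g" and X: "zero_object A X" and Z: "zero_object A Z"
  shows "zero_object A Y"
proof -
  have f: "f \<in> Mor A X Y" "g \<in> Mor A Y Z"
    using ex by (auto simp: exact_at_def)
  have Y: "Y \<in> Ob A"
    using Mor_Ob[OF f(1)] by blast
  note id = idm_Mor[OF this]
  have "g \<cdot> idm A Y = mzero A Y Z"
    using idm_right[OF f(2)] zero_object_Mor_to[OF Z f(2)] by simp
  then obtain T' e x where e: "is_epi A T' Y e" "x \<in> Mor A T' X" "f \<cdot> x = idm A Y \<cdot> e"
    using ex id unfolding exact_at_def by blast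
  then have "idm A Y \<cdot> e = mzero A T' Y"
    using zero_object_Mor_to[OF X e(2)] cmp_mzero[OF f(1)] Mor_Ob[OF e(2)] by simp
  then show ?thesis
    using is_epi_mzeroD[OF e(1) id] Y by (simp add: zero_object_iff)
qed

text \<open>In the defining triangle the outer terms have cohomology only \<open>T\<close> in degree
  -1 and only \<open>B\<close> in degree 0. The long exact sequence then identifies cohomology of
  \<open>X\<close> in degree -1 with \<open>T\<close> and squeezes every degree other than -1 and 0
  between zero objects.\<close>

lemma shifted_star_cohomology:
  assumes F: "torsionfree_class A F" and X: "X \<in> shifted_star A F"
  shows "bounded_complex A X" and "cohomology_ob A X (-1) \<in> F"
    and "n \<noteq> -1 \<Longrightarrow> n \<noteq> 0 \<Longrightarrow> zero_object A (cohomology_ob A X n)"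
proof -
  obtain T B f g h where T: "T \<in> F" and B: "B \<in> Ob A"
    and tri: "triangle A (shift A (stalk A T)) X (stalk A B) f g h"
    using X unfolding shifted_star_def by blast
  show "bounded_complex A X"
    using X by (simp add: shifted_star_def derived_category_Ob)
  have TOb: "T \<in> Ob A"
    using F T unfolding torsionfree_class_def by blast
  have sT: "shift A (stalk A T) = stalk_at A (-1) T"
    using shift_stalk_at[OF TOb, of 0] by (simp add: stalk_eq_stalk_at)
  obtain X' Y' Z' u v w where *: "bounded_complex A X'" "bounded_complex A Y'" "bounded_complex A Z'"
    "chain_map A X' Y' u" "mapping_cone A X' Y' u Z' v w"
    and iso: "\<And>n. isomorphic A (cohomology_ob A (stalk_at A (-1) T) n) (cohomology_ob A X' n)"
    "\<And>n. isomorphic A (cohomology_ob A X n) (cohomology_ob A Y' n)"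
    "\<And>n. isomorphic A (cohomology_ob A (stalk_at A 0 B) n) (cohomology_ob A Z' n)"
    using triangle_isomorphic_cone[OF tri] unfolding sT unfolding stalk_eq_stalk_at by blast
  note exX = mapping_cone_exact_at_X[OF *] and exY = mapping_cone_exact_at_Y[OF *]
  have X'0: "zero_object A (cohomology_ob A X' n)" if "n \<noteq> -1" for n
    using zero_object_isomorphic[OF iso(1)] zero_object_cohomology_stalk_at[OF TOb that] by blast
  have Z'0: "zero_object A (cohomology_ob A Z' n)" if "n \<noteq> 0" for n
    using zero_object_isomorphic[OF iso(3)] zero_object_cohomology_stalk_at[OF B that] by blast
  \<comment> \<open>The neighbours in the exact sequence are degrees -2 and -1 of the stalk of
    \<open>B\<close>, both zero.\<close>
  have "is_isomorphism A (cohomology_ob A X' (-1)) (cohomology_ob A Y' (-1)) (cohomology_map A X' Y' u (-1))"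
    using exact_at_zero_isomorphism[OF exX[of "-2", simplified] exY[of "-1"]] Z'0 by simp
  then have "isomorphic A (cohomology_ob A X' (-1)) (cohomology_ob A Y' (-1))"
    unfolding isomorphic_def by blast
  then have "isomorphic A T (cohomology_ob A X (-1))"
    using cohomology_stalk_at[OF TOb] iso isomorphic_trans isomorphic_sym by meson
  then show "cohomology_ob A X (-1) \<in> F"
    using F T unfolding torsionfree_class_def by blast
  show "zero_object A (cohomology_ob A X n)" if "n \<noteq> -1" "n \<noteq> 0"
    using zero_object_isomorphic[OF isomorphic_sym[OF iso(2)]]
      exact_at_zero_object[OF exY X'0[OF that(1)] Z'0[OF that(2)]] by blast
qed

section \<open>Stalks, shifted stalks and zero objects in \<open>F[1] * A\<close>\<close>

context
  fixes F
  assumes F: "torsionfree_class A F"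
begin

lemma torsionfree_class_Ob: "T \<in> F \<Longrightarrow> T \<in> Ob A"
  using F unfolding torsionfree_class_def by blast

lemma the_zero_torsionfree: "the_zero A \<in> F"
  using F zero_object_the_zero unfolding torsionfree_class_def by blast

lemma stalk_shifted_star:
  assumes B: "B \<in> Ob A"
  shows "stalk A B \<in> shifted_star A F"
proof -
  have "\<exists>f g h. triangle A (shift A (stalk A (the_zero A))) (stalk A B) (stalk A B) f g h"
    \<comment> \<open>The shifted stalk of zero equals the unshifted one, so all three terms sit in
      degree 0, where \<open>0 \<rightarrow> B \<rightarrow> B\<close> supplies the
      triangle.\<close>
    unfolding shift_stalk[OF the_zero_Ob] stalk_at_the_zero unfolding stalk_eq_stalk_at
    by (rule short_exact_triangle[OF short_exact_zero_left[OF zero_object_the_zero B]])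
  moreover have "stalk A B \<in> Ob (derived_category A)"
    using bounded_complex_stalk_at[OF B, of 0] by (simp add: derived_category_Ob stalk_eq_stalk_at)
  ultimately show ?thesis
    unfolding shifted_star_def using B the_zero_torsionfree by blast
qed

lemma shift_stalk_shifted_star:
  assumes T: "T \<in> F"
  shows "shift A (stalk A T) \<in> shifted_star A F"
proof -
  note Ob = torsionfree_class_Ob[OF T]
  have "\<exists>f g h. triangle A (shift A (stalk A T)) (shift A (stalk A T)) (stalk A (the_zero A)) f g h"
    \<comment> \<open>Here zero is moved to degree -1 instead, and the triangle is that of
      \<open>T \<rightarrow> T \<rightarrow> 0\<close> in this degree.\<close>
    unfolding shift_stalk[OF Ob] stalk_at_the_zero[of A "-1", symmetric]
    by (rule short_exact_triangle[OF short_exact_isomorphism[OF is_isomorphism_idm[OF Ob] zero_object_the_zero]])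
  moreover have "shift A (stalk A T) \<in> Ob (derived_category A)"
    using bounded_complex_shift[OF bounded_complex_stalk_at[OF Ob, of 0]]
    by (simp add: derived_category_Ob stalk_eq_stalk_at)
  ultimately show ?thesis
    unfolding shifted_star_def using T the_zero_Ob by blast
qed

lemma zero_object_stalk_the_zero: "zero_object (shifted_star_category A F) (stalk A (the_zero A))"
proof -
  have "zero_object (derived_category A) (stalk A (the_zero A))"
    using bounded_complex_stalk_at[OF the_zero_Ob, of 0] zero_object_the_zero
    by (intro derived_zero_object) (simp_all add: stalk_eq_stalk_at stalk_at_simps)
  then show ?thesis
    unfolding zero_object_def shifted_star_category_simps
    using stalk_shifted_star[OF the_zero_Ob] by (simp add: shifted_star_derived shifted_star_category_Mor)
qed

text \<open>A zero object of the subcategory is isomorphic to the stalk of zero; by fullness this is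
  an isomorphism of the derived category, and it carries over to cohomology.\<close>

lemma shifted_star_zero_cohomology:
  assumes X: "zero_object (shifted_star_category A F) X"
  shows "zero_object A (cohomology_ob A X n)"
proof -
  let ?D = "derived_category A" and ?O = "stalk A (the_zero A)"
  interpret D: category ?D
    by (rule derived_category_category)
  note O' = zero_object_stalk_the_zero
  have S: "X \<in> shifted_star A F" "?O \<in> shifted_star A F"
    using X O' by (auto simp: zero_object_def shifted_star_category_simps)
  have X1: "\<exists>!f. f \<in> Mor ?D X X" "\<exists>!f. f \<in> Mor ?D X ?O" "\<exists>!f. f \<in> Mor ?D ?O X"
    using X S unfolding zero_object_def shifted_star_category_simps
    by (auto simp: shifted_star_category_Mor)
  have O1: "\<exists>!f. f \<in> Mor ?D ?O ?O"
    using O' S unfolding zero_object_def shifted_star_category_simps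
    by (auto simp: shifted_star_category_Mor)
  obtain f g where fg: "f \<in> Mor ?D X ?O" "g \<in> Mor ?D ?O X"
    using X1(2,3)[THEN ex1_implies_ex] by blast
  have uniq: "a = b" if "\<exists>!a. a \<in> M" "a \<in> M" "b \<in> M" for a b :: "('a, 'b) derived_mor" and M
    using that by blast
  have "g \<cdot>\<^bsub>?D\<^esub> f = idm ?D X" "f \<cdot>\<^bsub>?D\<^esub> g = idm ?D ?O"
    using uniq[OF X1(1) D.cmp_Mor[OF fg] D.idm_Mor[OF shifted_star_derived[OF S(1)]]]
      uniq[OF O1 D.cmp_Mor[OF fg(2,1)] D.idm_Mor[OF shifted_star_derived[OF S(2)]]] .
  then have "isomorphic ?D ?O X"
    unfolding isomorphic_def is_isomorphism_def using fg by blast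
  then have "isomorphic A (cohomology_ob A ?O n) (cohomology_ob A X n)"
    by (rule derived_isomorphic_cohomology)
  moreover have "zero_object A (cohomology_ob A ?O n)"
    using bounded_complex_stalk_at[OF the_zero_Ob, of 0] zero_object_the_zero
    by (intro zero_object_cohomology) (simp_all add: stalk_eq_stalk_at stalk_at_simps)
  ultimately show ?thesis
    using zero_object_isomorphic by blast
qed

end

end

theorem theorem4:
  fixes A :: "('o, 'm) preadditive" and F :: "'o set"
  assumes "abelian_category A" and "torsionfree_class A F"
  defines "MA \<equiv> grothendieck_monoid (with_short_exact A)"
    and "MF \<equiv> gm_class (with_short_exact A) ` F"
    and "MFA \<equiv> grothendieck_monoid (shifted_star_category A F)"
  shows "\<exists>\<phi> \<in> monoid_hom MA MFA.
    (\<forall>X \<in> Ob A. \<phi> (gm_class (with_short_exact A) X) =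
       gm_class (shifted_star_category A F) (stalk A X)) \<and>
    (\<exists>\<psi> \<in> iso (monoid_localization MA MF) MFA.
       \<forall>x \<in> carrier MA. \<psi> (localization_map MA MF x) = \<phi> x)"
proof -
  interpret abelian_category A
    by fact
  note F = assms(2)
  let ?C = "with_short_exact A" and ?S = "shifted_star_category A F"
  let ?cA = "gm_class ?C" and ?cS = "gm_class ?S"
  define L where "L = monoid_localization MA MF"
  define loc where "loc = localization_map MA MF"
  have MA: "comm_monoid MA" and MFA: "comm_monoid MFA"
    unfolding MA_def MFA_def by (rule comm_monoid_grothendieck_monoid)+
  interpret MFA: comm_monoid MFA
    by (rule MFA)
  note S_simps = shifted_star_category_simps[of A F]
  note rel = gm_class_relations[where C = ?C, folded MA_def, unfolded with_short_exact_simps]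
  note rel' = gm_class_relations[where C = ?S, folded MFA_def, unfolded S_simps]
  have MF: "MF \<subseteq> carrier MA"
    unfolding MF_def using rel(1) torsionfree_class_Ob[OF F] by blast
  have L: "comm_monoid L"
    unfolding L_def by (rule comm_monoid_monoid_localization[OF MA MF])
  interpret L: comm_monoid L
    by (rule L)
  have loc: "loc \<in> monoid_hom MA L"
    unfolding loc_def L_def by (rule localization_map_hom[OF MA MF])
  note locD = monoid_homD[OF loc]
  have loc_Units: "loc (?cA T) \<in> Units L" if "T \<in> F" for T
    unfolding loc_def L_def using that by (intro localization_map_inverts[OF MA MF]) (simp add: MF_def)
  have conf: "?cS Y = ?cS X \<otimes>\<^bsub>MFA\<^esub> ?cS Z"
    if "X \<in> shifted_star A F" "Y \<in> shifted_star A F" "Z \<in> shifted_star A F"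
      "\<exists>f g h. triangle A X Y Z f g h" for X Y Z
    using rel'(4)[OF that(1-3)] that by blast
  note stalk_S = stalk_shifted_star[OF F]
  have stalk_conf: "?cS (stalk A Y) = ?cS (stalk A X) \<otimes>\<^bsub>MFA\<^esub> ?cS (stalk A Z)"
    if ses: "short_exact A X Y Z f g" for X Y Z f g
  proof -
    have "X \<in> Ob A" "Y \<in> Ob A" "Z \<in> Ob A"
      using ses Mor_Ob unfolding short_exact_def is_kernel_def by blast+
    then show ?thesis
      using short_exact_triangle[OF ses, of 0] stalk_S by (intro conf) (simp_all add: stalk_eq_stalk_at)
  qed
  have zero: "?cS (stalk A (the_zero A)) = \<one>\<^bsub>MFA\<^esub>"
    by (rule rel'(3)[OF zero_object_stalk_the_zero[OF F]])
  have stalk_iso: "?cS (stalk A X) = ?cS (stalk A Y)" if iso: "isomorphic A X Y" for X Y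
  proof -
    obtain f where f: "is_isomorphism A X Y f"
      using iso unfolding isomorphic_def by blast
    have "X \<in> Ob A"
      using f Mor_Ob unfolding is_isomorphism_def by blast
    then show ?thesis
      using stalk_conf[OF short_exact_isomorphism[OF f zero_object_the_zero]] zero rel'(1)[OF stalk_S]
      by simp
  qed
  obtain \<phi> where \<phi>: "\<phi> \<in> monoid_hom MA MFA" "\<And>X. X \<in> Ob A \<Longrightarrow> \<phi> (?cA X) = ?cS (stalk A X)"
  proof -
    have "\<exists>h \<in> monoid_hom (grothendieck_monoid ?C) MFA. (\<forall>X \<in> Ob ?C. h (?cA X) = ?cS (stalk A X)) \<and>
      (\<forall>h' \<in> monoid_hom (grothendieck_monoid ?C) MFA. (\<forall>X \<in> Ob ?C. h' (?cA X) = ?cS (stalk A X)) \<longrightarrow>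
         (\<forall>P \<in> carrier (grothendieck_monoid ?C). h' P = h P))"
    proof (rule grothendieck_monoid_universal[OF MFA]; unfold with_short_exact_simps)
      show "?cS (stalk A X) \<in> carrier MFA" if "X \<in> Ob A" for X
        using rel'(1) stalk_S that by blast
      show "?cS (stalk A X) = ?cS (stalk A Y)" if "isomorphic A X Y" for X Y
        using stalk_iso that .
      show "?cS (stalk A Z) = \<one>\<^bsub>MFA\<^esub>" if "zero_object A Z" for Z
        using stalk_iso[OF zero_objects_isomorphic[OF that zero_object_the_zero]] zero by simp
      show "?cS (stalk A Y) = ?cS (stalk A X) \<otimes>\<^bsub>MFA\<^esub> ?cS (stalk A Z)"
        if "short_exact A X Y Z f g" for X Y Z f g
        using stalk_conf that .
    qed
    then obtain h where "h \<in> monoid_hom (grothendieck_monoid ?C) MFA"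
      "\<forall>X \<in> Ob ?C. h (?cA X) = ?cS (stalk A X)"
      by (elim bexE conjE)
    then show thesis
      by (intro that[of h]) (simp_all add: MA_def with_short_exact_simps)
  qed
  have inverse: "?cS (stalk A T) \<otimes>\<^bsub>MFA\<^esub> ?cS (shift A (stalk A T)) = \<one>\<^bsub>MFA\<^esub>" if T: "T \<in> F" for T
  proof -
    note Ob = torsionfree_class_Ob[OF F T]
    have "\<exists>f g h. triangle A (stalk A T) (stalk A (the_zero A)) (shift A (stalk A T)) f g h"
      unfolding shift_stalk[OF Ob] unfolding stalk_eq_stalk_at
      using shift_triangle[OF Ob, of 0] by simp
    then show ?thesis
      using conf[OF stalk_S[OF Ob] stalk_S[OF the_zero_Ob] shift_stalk_shifted_star[OF F T]] zero by simp
  qed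
  have \<phi>_Units: "\<phi> s \<in> Units MFA" if s: "s \<in> MF" for s
  proof -
    obtain T where T: "T \<in> F" "s = ?cA T"
      using s unfolding MF_def by blast
    note Ob = torsionfree_class_Ob[OF F T(1)]
    have c: "?cS (stalk A T) \<in> carrier MFA" "?cS (shift A (stalk A T)) \<in> carrier MFA"
      using rel'(1)[OF stalk_S[OF Ob]] rel'(1)[OF shift_stalk_shifted_star[OF F T(1)]] .
    show ?thesis
      unfolding T(2) \<phi>(2)[OF Ob] by (rule MFA.Units_if_inverse[OF c inverse[OF T(1)]])
  qed
  have "\<exists>h \<in> monoid_hom L MFA. \<forall>x \<in> carrier MA. h (loc x) = \<phi> x"
    unfolding L_def loc_def
    by (rule bexE[OF monoid_localization_universal[OF MA MF MFA \<phi>(1) \<phi>_Units]],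
        assumption, elim conjE, rule bexI)
  then obtain \<psi> where \<psi>: "\<psi> \<in> monoid_hom L MFA" "\<And>x. x \<in> carrier MA \<Longrightarrow> \<psi> (loc x) = \<phi> x"
    by blast
  define \<xi> where "\<xi> X = loc (?cA (cohomology_ob A X 0)) \<otimes>\<^bsub>L\<^esub> inv\<^bsub>L\<^esub> loc (?cA (cohomology_ob A X (-1)))" for X
  note coh = shifted_star_cohomology[OF F]
  have locH: "loc (?cA (cohomology_ob A X n)) \<in> carrier L" if "X \<in> shifted_star A F" for X n
    using locD(1) rel(1) cohomology_ob_Ob[OF coh(1)[OF that]] by blast
  have locH1: "loc (?cA (cohomology_ob A X (-1))) \<in> Units L" if "X \<in> shifted_star A F" for X
    using loc_Units coh(2)[OF that] .
  have cA_iso: "?cA X = ?cA Y" if iso: "isomorphic A X Y" for X Y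
  proof -
    have "X \<in> Ob A" "Y \<in> Ob A"
      using iso Mor_Ob unfolding isomorphic_def is_isomorphism_def by blast+
    then show ?thesis
      using rel(2) iso by blast
  qed
  obtain \<chi> where \<chi>: "\<chi> \<in> monoid_hom MFA L" "\<And>X. X \<in> shifted_star A F \<Longrightarrow> \<chi> (?cS X) = \<xi> X"
  proof -
    have "\<exists>h \<in> monoid_hom (grothendieck_monoid ?S) L. (\<forall>X \<in> Ob ?S. h (?cS X) = \<xi> X) \<and>
      (\<forall>h' \<in> monoid_hom (grothendieck_monoid ?S) L. (\<forall>X \<in> Ob ?S. h' (?cS X) = \<xi> X) \<longrightarrow>
         (\<forall>P \<in> carrier (grothendieck_monoid ?S). h' P = h P))"
    proof (rule grothendieck_monoid_universal[OF L]; (unfold S_simps)?)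
      show "\<xi> X \<in> carrier L" if "X \<in> shifted_star A F" for X
        unfolding \<xi>_def using locH locH1 that by simp
      show "\<xi> X = \<xi> Y" if "isomorphic ?S X Y" for X Y
        unfolding \<xi>_def
        using cA_iso[OF derived_isomorphic_cohomology[OF shifted_star_isomorphic[OF that]]] by simp
      show "\<xi> Z = \<one>\<^bsub>L\<^esub>" if "zero_object ?S Z" for Z
        unfolding \<xi>_def using rel(3)[OF shifted_star_zero_cohomology[OF F that]] locD(3) by simp
      show "\<xi> Y = \<xi> X \<otimes>\<^bsub>L\<^esub> \<xi> Z"
        if *: "X \<in> shifted_star A F" "Y \<in> shifted_star A F" "Z \<in> shifted_star A F"
          and tri: "X \<in> shifted_star A F \<and> Y \<in> shifted_star A F \<and> Z \<in> shifted_star A F \<and>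
            (\<exists>h. triangle A X Y Z f g h)" for X Y Z f g
      proof -
        obtain h where h: "triangle A X Y Z f g h"
          using tri by blast
        have carr: "?cA (cohomology_ob A V n) \<in> carrier MA" if "V \<in> shifted_star A F" for V n
          using rel(1) cohomology_ob_Ob[OF coh(1)[OF that]] by blast
        interpret MA: comm_monoid MA
          by (rule MA)
        have loc3: "loc (a \<otimes>\<^bsub>MA\<^esub> b \<otimes>\<^bsub>MA\<^esub> d) = loc a \<otimes>\<^bsub>L\<^esub> loc b \<otimes>\<^bsub>L\<^esub> loc d"
          if "a \<in> carrier MA" "b \<in> carrier MA" "d \<in> carrier MA" for a b d
          using locD(2) that by simp
        have "zero_object A (cohomology_ob A Z (-2))" "zero_object A (cohomology_ob A X 1)"
          using coh(3) * by simp_all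
        \<comment> \<open>The relation in \<open>MA\<close> is pushed to \<open>L\<close>, where the
          classes in degree -1 are units, and \<open>fraction_mult_eq\<close> turns it into
          additivity of \<open>\<xi>\<close>.\<close>
        from arg_cong[OF triangle_gm_class[OF h this, folded MA_def], of loc]
        show ?thesis
          unfolding \<xi>_def loc3[OF carr[OF *(1)] carr[OF *(3)] carr[OF *(2)]]
            loc3[OF carr[OF *(2)] carr[OF *(1)] carr[OF *(3)]]
          by (intro L.fraction_mult_eq locH locH1 *)
      qed
    qed
    then obtain h where "h \<in> monoid_hom (grothendieck_monoid ?S) L" "\<forall>X \<in> Ob ?S. h (?cS X) = \<xi> X"
      by (elim bexE conjE)
    then show thesis
      by (intro that[of h]) (simp_all add: MFA_def S_simps)
  qed
  \<comment> \<open>A stalk has no cohomology in degree -1, so its denominator is the unit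
    element.\<close>
  have \<xi>_stalk: "\<xi> (stalk A B) = loc (?cA B)" if B: "B \<in> Ob A" for B
  proof -
    have "?cA (cohomology_ob A (stalk A B) (-1)) = \<one>\<^bsub>MA\<^esub>"
      unfolding stalk_eq_stalk_at using zero_object_cohomology_stalk_at[OF B] by (intro rel(3)) simp
    moreover have "?cA (cohomology_ob A (stalk A B) 0) = ?cA B"
      unfolding stalk_eq_stalk_at using cA_iso[OF cohomology_stalk_at[OF B]] by simp
    ultimately show ?thesis
      unfolding \<xi>_def using locD(3) locD(1)[OF rel(1)[OF B]] by simp
  qed
  have \<psi>\<chi>: "\<psi> (\<chi> P) = P" if "P \<in> carrier MFA" for P
  proof -
    note \<theta> = monoid_hom_cmp[OF \<chi>(1) \<psi>(1)]
    note \<theta>D = monoid_homD[OF \<theta>]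
    have stalk: "(\<psi> \<circ> \<chi>) (?cS (stalk A B)) = ?cS (stalk A B)" if B: "B \<in> Ob A" for B
      using \<chi>(2)[OF stalk_S[OF B]] \<xi>_stalk[OF B] \<psi>(2)[OF rel(1)[OF B]] \<phi>(2)[OF B] by simp
    \<comment> \<open>Every generator is the sum of the class of a shifted stalk and that of a
      stalk. Stalk classes are fixed by computation; the image of \<open>?s\<close> is then inverse
      to the fixed class \<open>?t\<close>, as \<open>?s\<close> is, and inverses are
      unique.\<close>
    have "(\<psi> \<circ> \<chi>) (?cS X) = id (?cS X)" if X: "X \<in> Ob ?S" for X
    proof -
      have X': "X \<in> shifted_star A F"
        using X by (simp add: S_simps)
      then obtain T B where T: "T \<in> F" and B: "B \<in> Ob A"
        and tri: "\<exists>f g h. triangle A (shift A (stalk A T)) X (stalk A B) f g h"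
        unfolding shifted_star_def by blast
      note Ob = torsionfree_class_Ob[OF F T] and sT = shift_stalk_shifted_star[OF F T]
      let ?t = "?cS (stalk A T)" and ?s = "?cS (shift A (stalk A T))"
      have c: "?t \<in> carrier MFA" "?s \<in> carrier MFA" "?cS (stalk A B) \<in> carrier MFA"
        using rel'(1)[OF stalk_S[OF Ob]] rel'(1)[OF sT] rel'(1)[OF stalk_S[OF B]] .
      have "?t \<otimes>\<^bsub>MFA\<^esub> (\<psi> \<circ> \<chi>) ?s = \<one>\<^bsub>MFA\<^esub>"
        using \<theta>D(2)[OF c(1,2)] \<theta>D(3) stalk[OF Ob] inverse[OF T] by simp
      then have "(\<psi> \<circ> \<chi>) ?s = ?s"
        using MFA.inv_unique[of ?s ?t "(\<psi> \<circ> \<chi>) ?s"] inverse[OF T] MFA.m_comm[OF c(1,2)] c \<theta>D(1)[OF c(2)]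
        by simp
      then show ?thesis
        using conf[OF sT X' stalk_S[OF B] tri] \<theta>D(2)[OF c(2,3)] stalk[OF B] by simp
    qed
    then show ?thesis
      using grothendieck_monoid_hom_ext[OF MFA, where C = ?S, folded MFA_def, OF \<theta> monoid_hom_id _ that] by simp
  qed
  have \<chi>\<psi>: "\<chi> (\<psi> P) = P" if "P \<in> carrier L" for P
  proof -
    \<comment> \<open>Two uniqueness principles are chained: agreement on classes of objects gives
      agreement on \<open>MA\<close>, and agreement on the image of \<open>loc\<close> gives
      agreement on \<open>L\<close>.\<close>
    have "(\<chi> \<circ> \<phi>) (?cA X) = loc (?cA X)" if "X \<in> Ob ?C" for X
      using that \<phi>(2) \<chi>(2) stalk_S \<xi>_stalk by (simp add: with_short_exact_simps)
    then have "(\<chi> \<circ> \<phi>) x = loc x" if "x \<in> carrier MA" for x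
      using grothendieck_monoid_hom_ext[OF L, where C = ?C, folded MA_def,
          OF monoid_hom_cmp[OF \<phi>(1) \<chi>(1)] loc _ that] by blast
    then have "(\<chi> \<circ> \<psi>) (loc x) = id (loc x)" if "x \<in> carrier MA" for x
      using \<psi>(2)[OF that] that by simp
    then show ?thesis
      using monoid_localization_hom_ext[OF MA MF L, folded L_def loc_def,
          OF monoid_hom_cmp[OF \<psi>(1) \<chi>(1)] monoid_hom_id _ that] by simp
  qed
  have "bij_betw \<psi> (carrier L) (carrier MFA)"
    using \<psi>\<chi> \<chi>\<psi> monoid_homD(1)[OF \<psi>(1)] monoid_homD(1)[OF \<chi>(1)]
    by (intro bij_betw_byWitness[where f' = \<chi>]) auto
  then have "\<psi> \<in> iso L MFA"
    using \<psi>(1) by (simp add: iso_def monoid_hom_def)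
  then show ?thesis
    using \<phi> \<psi>(2) unfolding L_def loc_def by blast
qed

end
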